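(* Let $\bar A=(A_0,A_1)$ be a compatible couple of (quasi-)Banach spaces with $A_0\cap A_1\neq\{0\}$. Let $0<q_1,r_1\le\infty$ and $a_1,b_1\in SV$ be such that $\|s^{-1/r_1}b_1(s)\|_{r_1,(1,\infty)}<\infty$ and $\left\|s^{-1/r_1}b_1(s)\|u^{-1/q_1}a_1(u)\|_{q_1,(0,s)}\right\|_{r_1,(0,1)}<\infty$, and put $$\chi_1(t)=\left\|s^{-1/r_1}b_1(s)\|u^{-1/q_1}a_1(u)\|_{q_1,(0,s)}\right\|_{r_1,(0,t)}+\|s^{-1/r_1}b_1(s)\|_{r_1,(t,\infty)}\|u^{-1/q_1}a_1(u)\|_{q_1,(0,t)}.$$ Let $0<\theta_0<1$, $0<r,r_0\le\infty$, and $a,b_0\in SV$. Put $\rho(t)=t^{1-\theta_0}\frac{b_0(t)}{\chi_1(t)}$. For given $0\le\theta\le1$ denote $a^{\#}=b_0^{1-\theta}\chi_1^{\theta}\,(a\circ\rho)$ and $\eta=(1-\theta)\theta_0+\theta$. (i) If $0<\theta<1$, then $\left(\bar A_{\theta_0,r_0,b_0},\bar A^{\mathcal L}_{1,r_1,b_1,q_1,a_1}\right)_{\theta,r,a}=\bar A_{\eta,r,a^{\#}}$. (ii) If $\|s^{-1/r}a(s)\|_{r,(1,\infty)}<\infty$, then $\left(\bar A_{\theta_0,r_0,b_0},\bar A^{\mathcal L}_{1,r_1,b_1,q_1,a_1}\right)_{0,r,a}=\bar A^{\mathcal L}_{\theta_0,r,a\circ\rho,r_0,b_0}$. (iii) If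 $\|s^{-1/r}a(s)\|_{r,(0,1)}<\infty$, then, with $\theta=1$ (i.e. $a^{\#}=\chi_1\,(a\circ\rho)$), $\left(\bar A_{\theta_0,r_0,b_0},\bar A^{\mathcal L}_{1,r_1,b_1,q_1,a_1}\right)_{1,r,a}=\bar A_{1,r,a^{\#}}\cap\bar A^{\mathcal L,\mathcal R}_{1,r,a\circ\rho,r_1,b_1,q_1,a_1}$.
   Context: Conventions: $1/\infty=0$; $\|\cdot\|_{q,(a,b)}$ is the usual (quasi-)norm of $L_q$ on the interval $(a,b)$, $0<q\le\infty$. Two positive functions satisfy $f\approx g$ (are equivalent) if $C^{-1}g\le f\le Cg$ for some constant $C>0$ independent of all significant quantities. $b\in SV$ (slowly varying) means that $b$ is a positive Lebesgue measurable function on $(0,\infty)$ such that for each $\varepsilon>0$ the function $t^{\varepsilon}b(t)$ is equivalent to an increasing function and $t^{-\varepsilon}b(t)$ is equivalent to a decreasing function. For a compatible couple $(X_0,X_1)$ of (quasi-)normed spaces, $K(t,f;X_0,X_1)=\inf\{\|f_0\|_{X_0}+t\|f_1\|_{X_1}: f=f_0+f_1,\ f_i\in X_i\}$ for $f\in X_0+X_1$, $t>0$; $K(t,f):=K(t,f;A_0,A_1)$. For $0\le\theta\le1$, $0<q\le\infty$, $b\in SV$, $(X_0,X_1)_{\theta,q,b}$ is the space of all $f\in X_0+X_1$ with finite (quasi-)norm $\|u^{-\theta-1/q}b(u)K(u,f;X_0,X_1)\|_{q,(0,\infty)}$, and $\bar A_{\theta,q,b}:=(A_0,A_1)_{\theta,q,b}$.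 For $0<p,r,q\le\infty$ and $a,b,c\in SV$, the following are the spaces of all $f\in A_0+A_1$ with finite (quasi-)norm: - $\bar A^{\mathcal L}_{\theta,r,b,q,a}$: $\left\|t^{-1/r}b(t)\|u^{-\theta-1/q}a(u)K(u,f)\|_{q,(0,t)}\right\|_{r,(0,\infty)}$; - $\bar A^{\mathcal L,\mathcal R}_{\theta,p,c,r,b,q,a}$: $\left\|t^{-1/p}c(t)\left\|u^{-1/r}b(u)\|v^{-\theta-1/q}a(v)K(v,f)\|_{q,(t,u)}\right\|_{r,(t,\infty)}\right\|_{p,(0,\infty)}$. Equality of (quasi-)normed spaces means that each is continuously embedded in the other; intersections carry the maximum (equivalently, the sum) of the (quasi-)norms. Standing assumption: none of the spaces under consideration is $\{0\}$. *)

theory Defs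
  imports "HOL-Analysis.Analysis"
begin

section \<open>Quasi-normed spaces inside an ambient vector space\<close>

text \<open>A quasi-normed space is a linear subspace of an ambient real vector space together with a
  real-valued quasi-norm, whose values outside the subspace are irrelevant.\<close>

datatype 'v qspace = QSpace (pts: "'v set") (qnorm: "'v \<Rightarrow> real")

definition quasi_normed :: "'v::real_vector qspace \<Rightarrow> bool" where
  "quasi_normed X \<longleftrightarrow>
     subspace (pts X) \<and>
     (\<forall>x\<in>pts X. 0 \<le> qnorm X x \<and> (qnorm X x = 0 \<longleftrightarrow> x = 0)) \<and>
     (\<forall>c. \<forall>x\<in>pts X. qnorm X (c *\<^sub>R x) = \<bar>c\<bar> * qnorm X x) \<and>
     (\<exists>M. \<forall>x\<in>pts X. \<forall>y\<in>pts X. qnorm X (x + y) \<le> M * (qnorm X x + qnorm X y))"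

definition quasi_banach :: "'v::real_vector qspace \<Rightarrow> bool" where
  "quasi_banach X \<longleftrightarrow>
     quasi_normed X \<and>
     (\<forall>s. (\<forall>n. s n \<in> pts X) \<and>
          (\<forall>e>0. \<exists>N. \<forall>m\<ge>N. \<forall>n\<ge>N. qnorm X (s m - s n) < e) \<longrightarrow>
          (\<exists>x\<in>pts X. (\<lambda>n::nat. qnorm X (s n - x)) \<longlonglongrightarrow> 0))"

definition hausdorff_tvs :: "'v::real_vector topology \<Rightarrow> bool" where
  "hausdorff_tvs T \<longleftrightarrow>
     topspace T = UNIV \<and> Hausdorff_space T \<and>
     continuous_map (prod_topology T T) T (\<lambda>(x, y). x + y) \<and>
     continuous_map (prod_topology euclidean T) T (\<lambda>(c::real, x). c *\<^sub>R x)"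

text \<open>Continuity of the inclusion of a quasi-normed space into a topological vector space.\<close>

definition continuously_in :: "'v::real_vector qspace \<Rightarrow> 'v topology \<Rightarrow> bool" where
  "continuously_in X T \<longleftrightarrow>
     (\<forall>x\<in>pts X. \<forall>U. openin T U \<and> x \<in> U \<longrightarrow>
        (\<exists>d>0. \<forall>y\<in>pts X. qnorm X (y - x) < d \<longrightarrow> y \<in> U))"

definition quasi_banach_couple :: "'v::real_vector qspace \<Rightarrow> 'v qspace \<Rightarrow> bool" where
  "quasi_banach_couple X0 X1 \<longleftrightarrow>
     quasi_banach X0 \<and> quasi_banach X1 \<and>
     (\<exists>T. hausdorff_tvs T \<and> continuously_in X0 T \<and> continuously_in X1 T)"

definition sum_pts :: "'v::real_vector qspace \<Rightarrow> 'v qspace \<Rightarrow> 'v set" where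
  "sum_pts X0 X1 = {f0 + f1 | f0 f1. f0 \<in> pts X0 \<and> f1 \<in> pts X1}"

definition inter_space :: "'v::real_vector qspace \<Rightarrow> 'v qspace \<Rightarrow> 'v qspace" where
  "inter_space X Y = QSpace (pts X \<inter> pts Y) (\<lambda>f. max (qnorm X f) (qnorm Y f))"

definition embedded :: "'v::real_vector qspace \<Rightarrow> 'v qspace \<Rightarrow> bool" where
  "embedded X Y \<longleftrightarrow> pts X \<subseteq> pts Y \<and> (\<exists>C. \<forall>f\<in>pts X. qnorm Y f \<le> C * qnorm X f)"

definition space_eq :: "'v::real_vector qspace \<Rightarrow> 'v qspace \<Rightarrow> bool"  (infix "\<cong>" 50) where
  "X \<cong> Y \<longleftrightarrow> embedded X Y \<and> embedded Y X"


section \<open>Lebesgue quasi-norms and slowly varying functions\<close>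

text \<open>Exponents are elements of \<^typ>\<open>ennreal\<close>; \<open>rexp q\<close> is \<open>1/q\<close>, with \<open>1/\<infinity> = 0\<close>.\<close>

definition rexp :: "ennreal \<Rightarrow> real" where
  "rexp q = enn2real (1 / q)"

text \<open>Real powers of extended nonnegative numbers; used for exponents \<open>p > 0\<close> only.\<close>

definition epowr :: "ennreal \<Rightarrow> real \<Rightarrow> ennreal" where
  "epowr x p = (if x = \<infinity> then \<infinity> else ennreal (enn2real x powr p))"

text \<open>The essential supremum is written out because \<open>esssup\<close> of HOL-Probability is \<open>\<infinity>\<close> on
  every non-measurable function.  A composition such as \<open>a \<circ> \<rho>\<close> of Lebesgue measurable slowly
  varying functions need not be Lebesgue measurable, but it lies between two constant multiples
  of a measurable function; the quasi-norm below is monotone and is thus determined up to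
  equivalence in that case, also for finite \<open>q\<close>, where \<^const>\<open>nn_integral\<close> is a lower
  integral.\<close>

definition Lq_norm :: "ennreal \<Rightarrow> real set \<Rightarrow> (real \<Rightarrow> ennreal) \<Rightarrow> ennreal" where
  "Lq_norm q I F =
     (if q = \<infinity> then Inf {C. AE x in lebesgue_on I. F x \<le> C}
      else epowr (\<integral>\<^sup>+ x. epowr (F x) (enn2real q) \<partial>lebesgue_on I) (1 / enn2real q))"

definition equivalent_on_pos :: "(real \<Rightarrow> real) \<Rightarrow> (real \<Rightarrow> real) \<Rightarrow> bool" where
  "equivalent_on_pos f g \<longleftrightarrow>
     (\<exists>C>0. \<forall>t>0. inverse C * g t \<le> f t \<and> f t \<le> C * g t)"

definition SV :: "(real \<Rightarrow> real) set" where
  "SV = {b. b \<in> borel_measurable (lebesgue_on {0<..}) \<and> (\<forall>t>0. 0 < b t) \<and>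
     (\<forall>\<epsilon>>0.
        (\<exists>g. (\<forall>t>0. 0 < g t) \<and> mono_on {0<..} g \<and>
             equivalent_on_pos (\<lambda>t. t powr \<epsilon> * b t) g) \<and>
        (\<exists>g. (\<forall>t>0. 0 < g t) \<and> antimono_on {0<..} g \<and>
             equivalent_on_pos (\<lambda>t. t powr (- \<epsilon>) * b t) g))}"


section \<open>K-functional and interpolation spaces\<close>

definition K_fun :: "'v::real_vector qspace \<Rightarrow> 'v qspace \<Rightarrow> real \<Rightarrow> 'v \<Rightarrow> real" where
  "K_fun X0 X1 t f =
     Inf {qnorm X0 f0 + t * qnorm X1 f1 | f0 f1. f0 \<in> pts X0 \<and> f1 \<in> pts X1 \<and> f = f0 + f1}"

definition finite_space ::
  "'v::real_vector qspace \<Rightarrow> 'v qspace \<Rightarrow> ('v \<Rightarrow> ennreal) \<Rightarrow> 'v qspace" where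
  "finite_space X0 X1 N = QSpace {f \<in> sum_pts X0 X1. N f < \<infinity>} (\<lambda>f. enn2real (N f))"

definition interp ::
  "real \<Rightarrow> ennreal \<Rightarrow> (real \<Rightarrow> real) \<Rightarrow> 'v::real_vector qspace \<Rightarrow> 'v qspace \<Rightarrow> 'v qspace" where
  "interp \<theta> q b X0 X1 = finite_space X0 X1 (\<lambda>f.
     Lq_norm q {0<..} (\<lambda>u. ennreal (u powr (- \<theta> - rexp q) * b u * K_fun X0 X1 u f)))"

definition interp_L ::
  "real \<Rightarrow> ennreal \<Rightarrow> (real \<Rightarrow> real) \<Rightarrow> ennreal \<Rightarrow> (real \<Rightarrow> real) \<Rightarrow>
   'v::real_vector qspace \<Rightarrow> 'v qspace \<Rightarrow> 'v qspace" where
  "interp_L \<theta> r b q a X0 X1 = finite_space X0 X1 (\<lambda>f.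
     Lq_norm r {0<..} (\<lambda>t. ennreal (t powr (- rexp r) * b t) *
       Lq_norm q {0<..<t} (\<lambda>u. ennreal (u powr (- \<theta> - rexp q) * a u * K_fun X0 X1 u f))))"

definition interp_LR ::
  "real \<Rightarrow> ennreal \<Rightarrow> (real \<Rightarrow> real) \<Rightarrow> ennreal \<Rightarrow> (real \<Rightarrow> real) \<Rightarrow> ennreal \<Rightarrow> (real \<Rightarrow> real) \<Rightarrow>
   'v::real_vector qspace \<Rightarrow> 'v qspace \<Rightarrow> 'v qspace" where
  "interp_LR \<theta> p c r b q a X0 X1 = finite_space X0 X1 (\<lambda>f.
     Lq_norm p {0<..} (\<lambda>t. ennreal (t powr (- rexp p) * c t) *
       Lq_norm r {t<..} (\<lambda>u. ennreal (u powr (- rexp r) * b u) *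
         Lq_norm q {t<..<u} (\<lambda>v. ennreal (v powr (- \<theta> - rexp q) * a v * K_fun X0 X1 v f)))))"


section \<open>The auxiliary functions of the reiteration formula\<close>

definition sv_norm :: "ennreal \<Rightarrow> (real \<Rightarrow> real) \<Rightarrow> real set \<Rightarrow> ennreal" where
  "sv_norm q b I = Lq_norm q I (\<lambda>s. ennreal (s powr (- rexp q) * b s))"

definition nested_sv_norm ::
  "ennreal \<Rightarrow> (real \<Rightarrow> real) \<Rightarrow> ennreal \<Rightarrow> (real \<Rightarrow> real) \<Rightarrow> real \<Rightarrow> ennreal" where
  "nested_sv_norm r b q a t =
     Lq_norm r {0<..<t} (\<lambda>s. ennreal (s powr (- rexp r) * b s) * sv_norm q a {0<..<s})"

text \<open>The conversion to \<^typ>\<open>real\<close> is harmless: for \<open>a, b \<in> SV\<close> the sum is positive, and finite for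
  every \<open>t > 0\<close> as soon as \<open>sv_norm r b {1<..}\<close> and \<open>nested_sv_norm r b q a 1\<close> are.\<close>

definition chi ::
  "ennreal \<Rightarrow> (real \<Rightarrow> real) \<Rightarrow> ennreal \<Rightarrow> (real \<Rightarrow> real) \<Rightarrow> real \<Rightarrow> real" where
  "chi r b q a t =
     enn2real (nested_sv_norm r b q a t + sv_norm r b {t<..} * sv_norm q a {0<..<t})"

definition rho :: "real \<Rightarrow> (real \<Rightarrow> real) \<Rightarrow> (real \<Rightarrow> real) \<Rightarrow> real \<Rightarrow> real" where
  "rho \<theta>0 b0 \<kappa> t = t powr (1 - \<theta>0) * (b0 t / \<kappa> t)"

definition a_sharp ::
  "real \<Rightarrow> (real \<Rightarrow> real) \<Rightarrow> (real \<Rightarrow> real) \<Rightarrow> (real \<Rightarrow> real) \<Rightarrow> (real \<Rightarrow> real) \<Rightarrow> real \<Rightarrow> real" where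
  "a_sharp \<theta> b0 \<kappa> a \<rho> t = b0 t powr (1 - \<theta>) * \<kappa> t powr \<theta> * a (\<rho> t)"

end

theory Submission
  imports Defs
begin

text \<open>Write \<open>\<kappa>(t)\<close> for \<open>K(t, f; A0, A1)\<close> and \<open>X0\<close>, \<open>X1\<close> for the two spaces that are interpolated.  The theorem
  rests on a formula of Holmstedt's type, \<open>K(\<rho>(t), f; X0, X1) \<approx> P(t) + \<rho>(t) R(t)\<close>, where \<open>P(t)\<close> is the part
  of the norm of \<open>X0\<close> that sees \<open>\<kappa>\<close> on \<open>(0, t)\<close>, and \<open>R(t)\<close> is the part of the iterated norm of \<open>X1\<close> in
  which the outer variable exceeds \<open>t\<close> and the inner one lies between \<open>t\<close> and the outer one.

  The upper estimate (\<open>K_upper\<close>) splits \<open>f\<close> almost optimally for \<open>K(t, f; A0, A1)\<close>.  The first summand behaves like \<open>f\<close>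
  before \<open>t\<close> and is bounded after \<open>t\<close>, the second one is linear before \<open>t\<close> and behaves like \<open>f\<close> after \<open>t\<close>
  (\<open>good_decomposition\<close>).  The linear growth before \<open>t\<close> contributes \<open>\<chi>(t) \<kappa>(t) / t\<close> to the norm in \<open>X1\<close>, which
  explains the two terms of \<open>\<chi>\<close>; since \<open>\<rho>(t) \<chi>(t) / t = t powr (- \<theta>0) * b0(t)\<close>, it is absorbed by \<open>P(t)\<close>.  The lower
  estimate (\<open>K_lower\<close>) applies \<open>P\<close> and \<open>R\<close> to both summands of an arbitrary decomposition.  The two cross terms are
  harmless because \<open>\<chi>(t) \<kappa>(t) / t\<close> is bounded by the norm of \<open>X1\<close>, because \<open>t powr (- \<theta>0) * b0(t) \<kappa>(t)\<close>
  is bounded by the norm of \<open>X0\<close>, and because \<open>\<rho>\<close> grows like a positive power.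

  Inserting this formula in the norm of the interpolation space with parameter \<open>\<theta>\<close>, at the points
  \<open>\<rho>(t)\<close>, leaves weighted norms of \<open>P\<close> and of \<open>\<rho> R\<close> with the weight \<open>\<rho> powr (- \<theta>) * (a \<circ> \<rho>)\<close>.  For \<open>\<theta> > 0\<close>
  this weight decays like a power, so Hardy's inequality (\<open>hardy\<close>) replaces \<open>P\<close> by its last term; for \<open>\<theta> < 1\<close> the
  weight of \<open>R\<close> grows like a power, and the same happens to \<open>\<rho> R\<close>.  Both then become the norm with the
  weight \<open>a_sharp\<close>.  At \<open>\<theta> = 0\<close> the term with \<open>P\<close> survives and gives the L-space, and at \<open>\<theta> = 1\<close> the term
  with \<open>R\<close> survives and gives the LR-space.

  Everything is carried out for sequences.  All functions that occur vary by at most a constant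
  factor on an interval whose endpoints have bounded ratio, so every norm over the half-line is equivalent
  to an \<open>l_q\<close> norm of samples along a geometric grid (\<open>sample_upper\<close>, \<open>sample_lower\<close>).  The substitution
  \<open>u = \<rho>(t)\<close> becomes a change of the grid, for which only the growth of \<open>\<rho>\<close> between
  neighbouring points matters; step functions replace the possibly non-measurable \<open>a \<circ> \<rho>\<close>.
  Slow variation enters only through the Potter-type bounds of the predicate \<open>slow\<close>.\<close>

section \<open>Sequence norms over the integers\<close>

lemma epowr_mono: "0 < p \<Longrightarrow> x \<le> y \<Longrightarrow> epowr x p \<le> epowr y p"
  by (cases x; cases y) (auto simp: epowr_def top_unique intro!: ennreal_leI powr_mono2)

lemma epowr_mult: "0 < p \<Longrightarrow> epowr (x * y) p = epowr x p * epowr y p"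
proof (cases x; cases y)
  fix r s assume "0 < p" "0 \<le> r" "x = ennreal r" "0 \<le> s" "y = ennreal s"
  then show ?thesis by (simp add: epowr_def ennreal_mult[symmetric] powr_mult)
next
  fix r assume "0 < p" "0 \<le> r" "x = ennreal r" "y = top"
  then show ?thesis by (cases "r = 0") (auto simp: epowr_def ennreal_mult_top)
next
  fix r assume "0 < p" "0 \<le> r" "y = ennreal r" "x = top"
  then show ?thesis by (cases "r = 0") (auto simp: epowr_def ennreal_top_mult)
qed (auto simp: epowr_def)

lemma epowr_inverse: "0 < p \<Longrightarrow> epowr (epowr x p) (1 / p) = x"
  "0 < p \<Longrightarrow> epowr (epowr x (1 / p)) p = x"
  by (cases x; auto simp: epowr_def powr_powr)+

lemma epowr_0 [simp]: "epowr 0 p = 0"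
  by (simp add: epowr_def)

lemma epowr_less_top: "x < top \<Longrightarrow> epowr x p < top"
  by (auto simp: epowr_def)

text \<open>A crude constant suffices: \<open>x + y\<close> is at most twice the maximum.  It replaces Minkowski's inequality, which
  fails for exponents below 1.\<close>

lemma epowr_add_le:
  assumes "0 < p" shows "epowr (x + y) p \<le> epowr 2 p * (epowr x p + epowr y p)"
proof -
  have "x + y \<le> 2 * max x y"
    by (metis add_mono max.cobounded1 max.cobounded2 mult_2)
  then have "epowr (x + y) p \<le> epowr 2 p * epowr (max x y) p"
    using epowr_mono[OF assms, of "x + y" "2 * max x y"] by (simp only: epowr_mult[OF assms])
  also have "\<dots> \<le> epowr 2 p * (epowr x p + epowr y p)"
    by (intro mult_left_mono) (auto simp: max_def)
  finally show ?thesis .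
qed

text \<open>The quasi-norm of \<open>l_q(S)\<close>, written like \<^const>\<open>Lq_norm\<close> with extended values, so that no summability has to
  be discussed.\<close>

definition lq :: "ennreal \<Rightarrow> int set \<Rightarrow> (int \<Rightarrow> ennreal) \<Rightarrow> ennreal" where
  "lq q S x = (if q = \<infinity> then SUP k\<in>S. x k
     else epowr (\<integral>\<^sup>+ k. epowr (x k) (enn2real q) \<partial>count_space S) (1 / enn2real q))"

lemma enn2real_pos: "0 < q \<Longrightarrow> q \<noteq> \<infinity> \<Longrightarrow> 0 < enn2real q"
  by (cases q) auto

lemma nn_integral_count_space_mono:
  assumes "S \<subseteq> T" "\<And>k. k \<in> S \<Longrightarrow> f k \<le> g k"
  shows "(\<integral>\<^sup>+ k. f k \<partial>count_space S) \<le> (\<integral>\<^sup>+ k. g k \<partial>count_space T)"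
proof -
  have "(\<integral>\<^sup>+ k. f k * indicator S k \<partial>count_space UNIV) \<le> (\<integral>\<^sup>+ k. g k * indicator T k \<partial>count_space UNIV)"
    using assms by (intro nn_integral_mono) (auto simp: indicator_def)
  then show ?thesis
    by (cases "S = UNIV"; cases "T = UNIV") (auto simp: nn_integral_count_space_indicator)
qed

lemma lq_mono:
  assumes "0 < q" "S \<subseteq> T" "\<And>k. k \<in> S \<Longrightarrow> x k \<le> y k"
  shows "lq q S x \<le> lq q T y"
proof (cases "q = \<infinity>")
  case True
  then show ?thesis using assms by (auto simp: lq_def intro!: SUP_mono)
next
  case False
  then have "0 < enn2real q" using assms enn2real_pos by blast
  then show ?thesis using False assms
    by (auto simp: lq_def intro!: epowr_mono nn_integral_count_space_mono)
qed

lemma lq_cmult: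
  assumes "0 < q" shows "lq q S (\<lambda>k. c * x k) = c * lq q S x"
proof (cases "q = \<infinity>")
  case True
  then show ?thesis by (simp add: lq_def SUP_mult_left_ennreal)
next
  case False
  then have "0 < enn2real q" using assms enn2real_pos by blast
  then show ?thesis using False
    by (simp add: lq_def epowr_mult nn_integral_cmult epowr_inverse)
qed

lemma lq_le:
  assumes "0 < q" "S \<subseteq> T" "\<And>k. k \<in> S \<Longrightarrow> x k \<le> C * y k"
  shows "lq q S x \<le> C * lq q T y"
  using lq_mono[OF assms(1,2), of x "\<lambda>k. C * y k"] assms(3) by (simp add: lq_cmult[OF assms(1)])

lemma lq_ge_point:
  assumes "0 < q" "k \<in> S" shows "x k \<le> lq q S x"
proof (cases "q = \<infinity>")
  case True
  then show ?thesis using assms by (auto simp: lq_def intro: SUP_upper)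
next
  case False
  then have p: "0 < enn2real q" using assms enn2real_pos by blast
  have "epowr (epowr (x k) (enn2real q)) (1 / enn2real q)
      \<le> epowr (\<integral>\<^sup>+ k. epowr (x k) (enn2real q) \<partial>count_space S) (1 / enn2real q)"
    using p assms by (intro epowr_mono nn_integral_ge_point) auto
  then show ?thesis using False p by (simp add: lq_def epowr_inverse)
qed

lemma lq_reindex:
  assumes "bij_betw g S T" shows "lq q S (\<lambda>k. x (g k)) = lq q T x"
proof (cases "q = \<infinity>")
  case True
  have "T = g ` S" using assms by (simp add: bij_betw_def)
  then show ?thesis using True by (simp add: lq_def image_image)
next
  case False
  then show ?thesis using nn_integral_bij_count_space[OF assms, of "\<lambda>k. epowr (x k) (enn2real q)"]
    by (simp add: lq_def)
qed

lemma lq_shift_atMost: "lq q {..k + m} x = lq q {..k} (\<lambda>j. x (j + m))" for m :: int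
  by (rule lq_reindex[symmetric]) (auto intro!: bij_betwI[where g="\<lambda>j. j - m"])

lemma lq_shift_atLeast: "lq q {k + m..} x = lq q {k..} (\<lambda>j. x (j + m))" for m :: int
  by (rule lq_reindex[symmetric]) (auto intro!: bij_betwI[where g="\<lambda>j. j - m"])

lemma lq_shift_Icc: "lq q {k + m..l + m} x = lq q {k..l} (\<lambda>j. x (j + m))" for m :: int
  by (rule lq_reindex[symmetric]) (auto intro!: bij_betwI[where g="\<lambda>j. j - m"])

lemma lq_add:
  assumes "0 < q"
  shows "\<exists>C<top. \<forall>S x y. lq q S (\<lambda>k. x k + y k) \<le> C * (lq q S x + lq q S y)"
proof (cases "q = \<infinity>")
  case True
  then show ?thesis
    by (intro exI[of _ 1]) (auto simp: lq_def intro!: SUP_least add_mono SUP_upper)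
next
  case False
  define p where "p = enn2real q"
  have p: "0 < p" using assms enn2real_pos False by (auto simp: p_def)
  define D where "D = epowr (epowr 2 p) (1/p) * epowr 2 (1/p)"
  show ?thesis
  proof (intro exI[of _ D] conjI allI)
    show "D < top" by (auto simp: D_def ennreal_mult_less_top intro!: epowr_less_top)
    fix S :: "int set" and x y :: "int \<Rightarrow> ennreal"
    let ?I = "\<lambda>x. \<integral>\<^sup>+ k. epowr (x k) p \<partial>count_space S"
    have "?I (\<lambda>k. x k + y k) \<le> \<integral>\<^sup>+ k. epowr 2 p * (epowr (x k) p + epowr (y k) p) \<partial>count_space S"
      by (intro nn_integral_mono epowr_add_le p)
    also have "\<dots> = epowr 2 p * (?I x + ?I y)"
      by (simp add: nn_integral_cmult nn_integral_add)
    finally have "epowr (?I (\<lambda>k. x k + y k)) (1/p) \<le> epowr (epowr 2 p * (?I x + ?I y)) (1/p)"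
      using p by (intro epowr_mono) auto
    also have "\<dots> = epowr (epowr 2 p) (1/p) * epowr (?I x + ?I y) (1/p)"
      using p by (intro epowr_mult) auto
    also have "\<dots> \<le> epowr (epowr 2 p) (1/p) * (epowr 2 (1/p) * (epowr (?I x) (1/p) + epowr (?I y) (1/p)))"
      using p by (intro mult_left_mono epowr_add_le) auto
    finally show "lq q S (\<lambda>k. x k + y k) \<le> D * (lq q S x + lq q S y)"
      using False by (simp add: lq_def p_def[symmetric] D_def mult.assoc)
  qed
qed

lemma lq_union:
  assumes "0 < q"
  shows "\<exists>C<top. \<forall>S T x. lq q (S \<union> T) x \<le> C * (lq q S x + lq q T x)"
proof (cases "q = \<infinity>")
  case True
  then show ?thesis
    by (intro exI[of _ 1]) (auto simp: lq_def SUP_union intro!: le_supI add_increasing add_increasing2)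
next
  case False
  define p where "p = enn2real q"
  have p: "0 < p" using assms enn2real_pos False by (auto simp: p_def)
  show ?thesis
  proof (intro exI[of _ "epowr 2 (1/p)"] conjI allI)
    show "epowr 2 (1/p) < top" by (auto intro!: epowr_less_top)
    fix S T :: "int set" and x :: "int \<Rightarrow> ennreal"
    let ?I = "\<lambda>S. \<integral>\<^sup>+ k. epowr (x k) p \<partial>count_space S"
    have e: "?I S = \<integral>\<^sup>+ k. epowr (x k) p * indicator S k \<partial>count_space UNIV" for S :: "int set"
      by (cases "S = UNIV") (auto simp: nn_integral_count_space_indicator)
    have "?I (S \<union> T) \<le> ?I S + ?I T"
      unfolding e by (subst nn_integral_add[symmetric]) (auto intro!: nn_integral_mono simp: indicator_def)
    then have "epowr (?I (S \<union> T)) (1/p) \<le> epowr (?I S + ?I T) (1/p)"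
      using p by (intro epowr_mono) auto
    also have "\<dots> \<le> epowr 2 (1/p) * (epowr (?I S) (1/p) + epowr (?I T) (1/p))"
      using p by (intro epowr_add_le) auto
    finally show "lq q (S \<union> T) x \<le> epowr 2 (1/p) * (lq q S x + lq q T x)"
      using False by (simp add: lq_def p_def[symmetric])
  qed
qed

text \<open>The two-sided geometric sequence with centre \<open>k\<close>.  A negative \<open>\<delta>\<close> is allowed and expresses growth of at
  most that rate.\<close>

definition geo :: "real \<Rightarrow> int \<Rightarrow> int \<Rightarrow> ennreal" where
  "geo \<delta> j k = ennreal (exp (- \<delta> * \<bar>real_of_int (j - k)\<bar>))"

lemma geo_sym: "geo \<delta> j k = geo \<delta> k j"
  by (simp add: geo_def abs_minus_commute)

lemma epowr_geo: "epowr (geo \<delta> j k) p = geo (\<delta> * p) j k"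
  by (simp add: geo_def epowr_def powr_def mult.commute mult.left_commute)

lemma sum_geo:
  assumes "0 < \<delta>"
  shows "\<exists>C<top. \<forall>k. (\<integral>\<^sup>+ j. geo \<delta> j k \<partial>count_space UNIV) \<le> C"
proof -
  define C where "C = (\<Sum>n. ennreal (exp (-\<delta>) ^ n))"
  have C: "C < top"
    using assms unfolding C_def by (subst suminf_ennreal2) (auto intro!: summable_geometric)
  have "(\<integral>\<^sup>+ j. geo \<delta> j k \<partial>count_space UNIV) \<le> C + C" for k
  proof -
    have "(\<integral>\<^sup>+ j. geo \<delta> j k \<partial>count_space UNIV) \<le>
      (\<integral>\<^sup>+ j. geo \<delta> j k * indicator {k..} j + geo \<delta> j k * indicator {..k} j \<partial>count_space UNIV)"
      by (intro nn_integral_mono) (auto simp: indicator_def)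
    also have "\<dots> = (\<integral>\<^sup>+ j. geo \<delta> j k \<partial>count_space {k..}) + (\<integral>\<^sup>+ j. geo \<delta> j k \<partial>count_space {..k})"
      by (simp add: nn_integral_add nn_integral_count_space_indicator)
    also have "(\<integral>\<^sup>+ j. geo \<delta> j k \<partial>count_space {k..}) = (\<integral>\<^sup>+ n. geo \<delta> (k + int n) k \<partial>count_space UNIV)"
      by (rule nn_integral_bij_count_space[symmetric])
         (auto intro!: bij_betwI[where g="\<lambda>j. nat (j - k)"])
    also have "\<dots> = C"
      by (simp add: C_def nn_integral_count_space_nat geo_def exp_of_nat_mult[symmetric] mult.commute)
    also have "(\<integral>\<^sup>+ j. geo \<delta> j k \<partial>count_space {..k}) = (\<integral>\<^sup>+ n. geo \<delta> (k - int n) k \<partial>count_space UNIV)"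
      by (rule nn_integral_bij_count_space[symmetric])
         (auto intro!: bij_betwI[where g="\<lambda>j. nat (k - j)"])
    also have "\<dots> = C"
      by (simp add: C_def nn_integral_count_space_nat geo_def exp_of_nat_mult[symmetric] mult.commute)
    finally show ?thesis .
  qed
  then show ?thesis using C by (intro exI[of _ "C + C"]) auto
qed

lemma lq_geo:
  assumes "0 < \<delta>" "0 < q"
  shows "\<exists>C<top. \<forall>k. lq q UNIV (\<lambda>j. geo \<delta> j k) \<le> C"
proof (cases "q = \<infinity>")
  case True
  have "geo \<delta> j k \<le> 1" for j k using assms by (auto simp: geo_def)
  then show ?thesis using True by (intro exI[of _ 1]) (auto simp: lq_def intro!: SUP_least)
next
  case False
  define p where "p = enn2real q"
  have p: "0 < p" using assms enn2real_pos False by (auto simp: p_def)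
  obtain C where C: "C < top" "\<And>k. (\<integral>\<^sup>+ j. geo (\<delta> * p) j k \<partial>count_space UNIV) \<le> C"
    using sum_geo[of "\<delta> * p"] assms p by auto
  then show ?thesis using False p
    by (intro exI[of _ "epowr C (1/p)"])
       (auto simp: lq_def p_def[symmetric] epowr_geo intro!: epowr_mono epowr_less_top)
qed

text \<open>Hardy's inequalities are all derived from this bound: a supremum against a geometric kernel is
  harmless in every \<open>l_r\<close>.  For finite \<open>r\<close> the supremum is dominated by the \<open>l_r\<close> sum of its terms, and after
  exchanging the two summations the kernel contributes a geometric series.  This argument treats
  \<open>r < 1\<close> and \<open>r \<ge> 1\<close> alike.\<close>

lemma lq_convolution:
  assumes "0 < \<delta>" "0 < r"
  shows "\<exists>C<top. \<forall>f g. (\<forall>k. f k \<le> (SUP j. geo \<delta> j k * g j)) \<longrightarrow> lq r UNIV f \<le> C * lq r UNIV g"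
proof (cases "r = \<infinity>")
  case True
  have "geo \<delta> j k * g j \<le> g j" for j k g
    using assms mult_right_mono[of "geo \<delta> j k" 1 "g j"] by (auto simp: geo_def)
  moreover have "g j \<le> (SUP j. g j)" for g :: "int \<Rightarrow> ennreal" and j by (intro SUP_upper) auto
  ultimately have "(SUP j. geo \<delta> j k * g j) \<le> (SUP j. g j)" for k g
    by (meson SUP_least order_trans)
  then show ?thesis using True
    by (intro exI[of _ 1]) (simp add: lq_def, blast intro: SUP_least order_trans)
next
  case False
  define p where "p = enn2real r"
  have p: "0 < p" using assms enn2real_pos False by (auto simp: p_def)
  obtain C where C: "C < top" "\<And>k. (\<integral>\<^sup>+ j. geo (\<delta> * p) j k \<partial>count_space UNIV) \<le> C"
    using sum_geo[of "\<delta> * p"] assms p by auto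
  show ?thesis
  proof (intro exI[of _ "epowr C (1/p)"] conjI allI impI)
    show "epowr C (1/p) < top" using C by (intro epowr_less_top)
    fix f g :: "int \<Rightarrow> ennreal" assume f: "\<forall>k. f k \<le> (SUP j. geo \<delta> j k * g j)"
    have "epowr (f k) p \<le> (\<integral>\<^sup>+ j. geo (\<delta> * p) j k * epowr (g j) p \<partial>count_space UNIV)" (is "_ \<le> ?J k") for k
    proof -
      have "f k \<le> lq r UNIV (\<lambda>j. geo \<delta> j k * g j)"
        by (intro order_trans[OF f[rule_format]] SUP_least lq_ge_point[where x="\<lambda>j. geo \<delta> j k * g j"] assms) auto
      then have "epowr (f k) p \<le> epowr (lq r UNIV (\<lambda>j. geo \<delta> j k * g j)) p"
        by (rule epowr_mono[OF p])
      then show ?thesis using False p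
        by (simp add: lq_def p_def[symmetric] epowr_inverse epowr_mult epowr_geo)
    qed
    then have "(\<integral>\<^sup>+ k. epowr (f k) p \<partial>count_space UNIV) \<le> (\<integral>\<^sup>+ k. ?J k \<partial>count_space UNIV)"
      by (intro nn_integral_mono) auto
    also have "\<dots> = (\<integral>\<^sup>+ j. (\<integral>\<^sup>+ k. geo (\<delta> * p) j k * epowr (g j) p \<partial>count_space UNIV) \<partial>count_space UNIV)"
      by (intro nn_integral_count_space_nn_integral) auto
    also have "\<dots> \<le> (\<integral>\<^sup>+ j. C * epowr (g j) p \<partial>count_space UNIV)"
      using C(2) by (intro nn_integral_mono) (auto simp: nn_integral_multc geo_sym[of _ j for j] intro!: mult_right_mono)
    also have "\<dots> = C * (\<integral>\<^sup>+ j. epowr (g j) p \<partial>count_space UNIV)"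
      by (intro nn_integral_cmult) auto
    finally have "epowr (\<integral>\<^sup>+ k. epowr (f k) p \<partial>count_space UNIV) (1/p) \<le> epowr (C * (\<integral>\<^sup>+ j. epowr (g j) p \<partial>count_space UNIV)) (1/p)"
      using p by (intro epowr_mono) auto
    then show "lq r UNIV f \<le> epowr C (1/p) * lq r UNIV g"
      using False p by (simp add: lq_def p_def[symmetric] epowr_mult)
  qed
qed

section \<open>Sampling Lebesgue norms along geometric grids\<close>

text \<open>The ratio of neighbouring points is at least 2, so the cells \<open>[x k, x (k + 1))\<close> cover the half-line, and at
  most \<open>M\<close>, so that the functions below are comparable to constants on each cell.\<close>

definition grid :: "(int \<Rightarrow> real) \<Rightarrow> real \<Rightarrow> bool" where
  "grid x M \<longleftrightarrow> (\<forall>k. 0 < x k \<and> 2 * x k \<le> x (k + 1) \<and> x (k + 1) \<le> M * x k)"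

lemma grid_mono:
  assumes "grid x M" "j \<le> k" shows "x j \<le> x k"
  using assms(2)
proof (induction rule: int_ge_induct)
  case (step i)
  have "x i \<le> x (i + 1)" using assms(1) unfolding grid_def by (smt (verit))
  then show ?case using step by linarith
qed simp

lemma grid_growth:
  assumes "grid x M" shows "2 ^ n * x k \<le> x (k + int n)"
proof (induction n)
  case (Suc n)
  have "2 * x (k + int n) \<le> x (k + int n + 1)" using assms unfolding grid_def by blast
  moreover have "k + int n + 1 = k + int (Suc n)" by simp
  ultimately have "2 * x (k + int n) \<le> x (k + int (Suc n))" by metis
  then show ?case using Suc by simp
qed simp

lemma grid_cover:
  assumes x: "grid x M" and u: "0 < u"
  obtains k where "x k \<le> u" "u < x (k + 1)"
proof (rule ccontr)
  assume "\<not> thesis"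
  with that have *: "x k \<le> u \<Longrightarrow> x (k + 1) \<le> u" for k by (meson not_le_imp_less)
  have pos: "0 < x k" for k using x by (simp add: grid_def)
  \<comment> \<open>If no cell contained \<open>u\<close>, all points after one to the left of \<open>u\<close> would stay to the left of \<open>u\<close>.\<close>
  obtain m where m: "x 0 / u < 2 ^ m" using real_arch_pow[of 2 "x 0 / u"] by auto
  have "2 ^ m * x (- int m) \<le> x 0" using grid_growth[OF x, of m "- int m"] by simp
  also have "\<dots> < 2 ^ m * u" using m u by (simp add: field_simps)
  finally have base: "x (- int m) \<le> u" by simp
  have le: "x (- int m + int i) \<le> u" for i
  proof (induction i)
    case (Suc i)
    then show ?case using *[of "- int m + int i"] by (simp add: algebra_simps)
  qed (use base in simp)
  obtain n where n: "u / x (- int m) < 2 ^ n" using real_arch_pow[of 2 "u / x (- int m)"] by auto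
  have "u < 2 ^ n * x (- int m)" using n pos[of "- int m"] by (simp add: field_simps)
  also have "\<dots> \<le> x (- int m + int n)" by (rule grid_growth[OF x])
  finally show False using le[of n] by simp
qed

lemma grid_index_less:
  assumes "grid x M" "x j \<le> u" "u < x (k + 1)" shows "j \<le> k"
proof (rule ccontr)
  assume "\<not> j \<le> k"
  then have "x (k + 1) \<le> x j" using grid_mono[OF assms(1), of "k + 1" j] by simp
  then show False using assms by linarith
qed

lemma grid_ln:
  assumes "grid x M"
  shows "1 < M" "\<bar>ln (x (k + 1)) - ln (x k)\<bar> \<le> ln M"
    "x k \<le> u \<Longrightarrow> u < x (k + 1) \<Longrightarrow> \<bar>ln u - ln (x k)\<bar> \<le> ln M"
proof -
  have p: "0 < x i" "2 * x i \<le> x (i + 1)" "x (i + 1) \<le> M * x i" for i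
    using assms by (auto simp: grid_def)
  have "2 * x 0 \<le> M * x 0" using p(2)[of 0] p(3)[of 0] by simp
  then show M: "1 < M" using p(1)[of 0] by simp
  have u: "x k \<le> u \<Longrightarrow> u \<le> x (k + 1) \<Longrightarrow> \<bar>ln u - ln (x k)\<bar> \<le> ln M" for u
  proof -
    assume u: "x k \<le> u" "u \<le> x (k + 1)"
    have "ln u \<le> ln (M * x k)"
      using u p[of k] M by simp
    then have "ln u \<le> ln M + ln (x k)" using M p(1)[of k] by (simp add: ln_mult)
    moreover have "ln (x k) \<le> ln u" using u p(1)[of k] by simp
    ultimately show ?thesis by simp
  qed
  show "\<bar>ln (x (k + 1)) - ln (x k)\<bar> \<le> ln M" using u[of "x (k + 1)"] p(1,2)[of k] by simp
  show "x k \<le> u \<Longrightarrow> u < x (k + 1) \<Longrightarrow> \<bar>ln u - ln (x k)\<bar> \<le> ln M" using u[of u] by simp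
qed

lemma rexp_inverse: "0 < q \<Longrightarrow> q \<noteq> \<infinity> \<Longrightarrow> rexp q = 1 / enn2real q"
  by (cases q) (auto simp: rexp_def divide_ennreal_def inverse_ennreal inverse_eq_divide)

lemma rexp_top: "rexp top = 0"
  by (simp add: rexp_def)

text \<open>The factor \<open>u powr (- 1/q)\<close> in front of an integrand turns Lebesgue measure into \<open>du/u\<close>, for which all
  cells of a grid have comparable mass.\<close>

lemma epowr_weight:
  assumes "0 < q" "q \<noteq> \<infinity>" "0 < u"
  shows "epowr (ennreal (u powr - rexp q) * y) (enn2real q) = ennreal (1 / u) * epowr y (enn2real q)"
proof -
  have p: "0 < enn2real q" using assms by (intro enn2real_pos)
  have "epowr (ennreal (u powr - rexp q)) (enn2real q) = ennreal (1 / u)"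
  proof -
    have "(u powr - rexp q) powr enn2real q = u powr - 1"
      using p assms by (simp add: rexp_inverse powr_powr)
    also have "\<dots> = 1 / u" using assms by (simp add: powr_minus_divide)
    finally show ?thesis by (simp add: epowr_def)
  qed
  then show ?thesis using p by (simp add: epowr_mult)
qed

text \<open>The quasi-norm of \<open>L_q(I, du/u)\<close>.\<close>

abbreviation log_norm :: "ennreal \<Rightarrow> real set \<Rightarrow> (real \<Rightarrow> ennreal) \<Rightarrow> ennreal" where
  "log_norm q I F \<equiv> Lq_norm q I (\<lambda>u. ennreal (u powr - rexp q) * F u)"

lemma emeasure_cell:
  assumes "grid x M" shows "emeasure lebesgue {x k..<x (k + 1)} = ennreal (x (k + 1) - x k)"
proof -
  have "0 < x k" "2 * x k \<le> x (k + 1)" using assms by (auto simp: grid_def)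
  then have "x k \<le> x (k + 1)" by linarith
  then show ?thesis by simp
qed

text \<open>The integrand is dominated by the step function with value \<open>f k\<close> on the cell of \<open>x k\<close>.  That function is
  measurable, so its integral is a sum over the cells; for \<open>F\<close> itself only the monotonicity of the
  integral is used, since \<open>F\<close> may be built from a composition \<open>a \<circ> \<rho>\<close> that is not measurable.\<close>

lemma sample_upper:
  assumes x: "grid x M" and q: "0 < q"
  shows "\<exists>C<top. \<forall>I S F f. I \<in> sets borel \<longrightarrow> I \<subseteq> {0<..} \<longrightarrow>
    (\<forall>u\<in>I. \<exists>k\<in>S. x k \<le> u \<and> u < x (k + 1) \<and> F u \<le> f k) \<longrightarrow>
    log_norm q I F \<le> C * lq q S f"
proof (cases "q = \<infinity>")
  case True
  show ?thesis
  proof (intro exI[of _ 1] conjI allI impI)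
    fix I S F and f :: "int \<Rightarrow> ennreal"
    assume I: "I \<in> sets borel" "I \<subseteq> {0<..}"
      and F: "\<forall>u\<in>I. \<exists>k\<in>S. x k \<le> u \<and> u < x (k + 1) \<and> F u \<le> f k"
    have "F u \<le> lq q S f" if "u \<in> I" for u
      using F that by (meson lq_ge_point order_trans q)
    then have "AE u in lebesgue_on I. ennreal (u powr - rexp q) * F u \<le> lq q S f"
      using I True by (intro AE_I2) (auto simp: rexp_top)
    then show "log_norm q I F \<le> 1 * lq q S f"
      using True by (auto simp: Lq_norm_def intro: Inf_lower)
  qed auto
next
  case False
  define p where "p = enn2real q"
  have p: "0 < p" using q enn2real_pos False by (auto simp: p_def)
  show ?thesis
  proof (intro exI[of _ "epowr (ennreal M) (1/p)"] conjI allI impI)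
    show "epowr (ennreal M) (1/p) < top" by (auto intro!: epowr_less_top)
    fix I S F and f :: "int \<Rightarrow> ennreal"
    assume I: "I \<in> sets borel" "I \<subseteq> {0<..}"
      and F: "\<forall>u\<in>I. \<exists>k\<in>S. x k \<le> u \<and> u < x (k + 1) \<and> F u \<le> f k"
    let ?c = "\<lambda>k. epowr (f k) p * ennreal (1 / x k)"
    have pt: "epowr (ennreal (u powr - rexp q) * F u) p * indicator I u
       \<le> (\<integral>\<^sup>+ k. ?c k * indicator {x k..<x (k + 1)} u \<partial>count_space S)" for u
    proof (cases "u \<in> I")
      case True
      then obtain k where k: "k \<in> S" "x k \<le> u" "u < x (k + 1)" "F u \<le> f k" using F by blast
      have "0 < x k" using x by (simp add: grid_def)
      have "epowr (ennreal (u powr - rexp q) * F u) p = epowr (F u) p * ennreal (1 / u)"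
        using epowr_weight[OF q False, of u "F u"] True I by (auto simp: p_def mult.commute)
      also have "\<dots> \<le> ?c k * indicator {x k..<x (k + 1)} u"
        using k \<open>0 < x k\<close> p by (auto intro!: mult_mono epowr_mono ennreal_leI divide_left_mono)
      also have "\<dots> \<le> (\<integral>\<^sup>+ k. ?c k * indicator {x k..<x (k + 1)} u \<partial>count_space S)"
        using k(1) by (rule nn_integral_ge_point)
      finally show ?thesis using True by simp
    qed simp
    have "(\<integral>\<^sup>+ u. epowr (ennreal (u powr - rexp q) * F u) p \<partial>lebesgue_on I)
      = (\<integral>\<^sup>+ u. epowr (ennreal (u powr - rexp q) * F u) p * indicator I u \<partial>lebesgue)"
      using I by (intro nn_integral_restrict_space) auto
    also have "\<dots> \<le> (\<integral>\<^sup>+ u. (\<integral>\<^sup>+ k. ?c k * indicator {x k..<x (k + 1)} u \<partial>count_space S) \<partial>lebesgue)"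
      by (intro nn_integral_mono pt)
    also have "\<dots> = (\<integral>\<^sup>+ k. (\<integral>\<^sup>+ u. ?c k * indicator {x k..<x (k + 1)} u \<partial>lebesgue) \<partial>count_space S)"
      by (intro nn_integral_count_space_nn_integral borel_measurable_times_ennreal borel_measurable_indicator) auto
    also have "\<dots> \<le> (\<integral>\<^sup>+ k. ennreal M * epowr (f k) p \<partial>count_space S)"
    proof (intro nn_integral_mono)
      fix k
      have g: "0 < x k" "2 * x k \<le> x (k + 1)" "x (k + 1) \<le> M * x k" using x by (auto simp: grid_def)
      have "(\<integral>\<^sup>+ u. ?c k * indicator {x k..<x (k + 1)} u \<partial>lebesgue)
          = epowr (f k) p * (ennreal (1 / x k) * ennreal (x (k + 1) - x k))"
        by (subst nn_integral_cmult_indicator) (simp_all only: emeasure_cell[OF x] mult.assoc, simp)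
      also have "ennreal (1 / x k) * ennreal (x (k + 1) - x k) = ennreal ((x (k + 1) - x k) / x k)"
        using g by (simp add: ennreal_mult[symmetric])
      also have "\<dots> \<le> ennreal M" using g by (intro ennreal_leI) (simp add: field_simps)
      finally show "(\<integral>\<^sup>+ u. ?c k * indicator {x k..<x (k + 1)} u \<partial>lebesgue) \<le> ennreal M * epowr (f k) p"
        by (subst (2) mult.commute) (simp add: mult_left_mono)
    qed
    also have "\<dots> = ennreal M * (\<integral>\<^sup>+ k. epowr (f k) p \<partial>count_space S)"
      by (intro nn_integral_cmult) auto
    finally have "epowr (\<integral>\<^sup>+ u. epowr (ennreal (u powr - rexp q) * F u) p \<partial>lebesgue_on I) (1/p)
       \<le> epowr (ennreal M * (\<integral>\<^sup>+ k. epowr (f k) p \<partial>count_space S)) (1/p)"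
      using p by (intro epowr_mono) auto
    then show "log_norm q I F \<le> epowr (ennreal M) (1/p) * lq q S f"
      using False p by (simp add: Lq_norm_def lq_def p_def[symmetric] epowr_mult)
  qed
qed

text \<open>Now the step function is a minorant.  The cells are disjoint, so at most one summand is nonzero at each
  point; the case of infinite \<open>q\<close> uses that cells have positive measure.\<close>

lemma sample_lower:
  assumes x: "grid x M" and q: "0 < q"
  shows "\<exists>C<top. \<forall>I S F f. I \<in> sets borel \<longrightarrow>
    (\<forall>k\<in>S. \<forall>u. x k \<le> u \<and> u < x (k + 1) \<longrightarrow> u \<in> I \<and> f k \<le> F u) \<longrightarrow>
    lq q S f \<le> C * log_norm q I F"
proof (cases "q = \<infinity>")
  case True
  show ?thesis
  proof (intro exI[of _ 1] conjI allI impI)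
    fix I S F and f :: "int \<Rightarrow> ennreal"
    assume I: "I \<in> sets borel"
      and F: "\<forall>k\<in>S. \<forall>u. x k \<le> u \<and> u < x (k + 1) \<longrightarrow> u \<in> I \<and> f k \<le> F u"
    have "f k \<le> C" if k: "k \<in> S" and C: "AE u in lebesgue_on I. ennreal (u powr - rexp q) * F u \<le> C" for k C
    proof (rule ccontr)
      assume n: "\<not> f k \<le> C"
      have g: "0 < x k" "2 * x k \<le> x (k + 1)" using x by (auto simp: grid_def)
      have "AE u in lebesgue. u \<in> I \<longrightarrow> ennreal (u powr - rexp q) * F u \<le> C"
        using C I by (simp add: AE_restrict_space_iff)
      then have "AE u in lebesgue. u \<notin> {x k..<x (k + 1)}"
      proof (rule AE_mp, intro AE_I2 impI)
        fix u assume u: "u \<in> I \<longrightarrow> ennreal (u powr - rexp q) * F u \<le> C"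
        show "u \<notin> {x k..<x (k + 1)}"
        proof
          assume "u \<in> {x k..<x (k + 1)}"
          then have "u \<in> I" "f k \<le> F u" "0 < u" using F k g by auto
          then show False using u n True by (auto simp: rexp_top)
        qed
      qed
      then have "{x k..<x (k + 1)} \<in> null_sets lebesgue"
        by (subst AE_iff_null_sets) auto
      then have "emeasure lebesgue {x k..<x (k + 1)} = 0" by auto
      then show False using emeasure_cell[OF x, of k] g by simp
    qed
    then show "lq q S f \<le> 1 * log_norm q I F"
      using True by (auto simp: lq_def Lq_norm_def intro!: SUP_least Inf_greatest)
  qed auto
next
  case False
  define p where "p = enn2real q"
  have p: "0 < p" using q enn2real_pos False by (auto simp: p_def)
  show ?thesis
  proof (intro exI[of _ "epowr 2 (1/p)"] conjI allI impI)
    show "epowr 2 (1/p) < top" by (auto intro!: epowr_less_top)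
    fix I S F and f :: "int \<Rightarrow> ennreal"
    assume I: "I \<in> sets borel"
      and F: "\<forall>k\<in>S. \<forall>u. x k \<le> u \<and> u < x (k + 1) \<longrightarrow> u \<in> I \<and> f k \<le> F u"
    let ?c = "\<lambda>k. epowr (f k) p * ennreal (1 / x (k + 1))"
    have pt: "(\<integral>\<^sup>+ k. ?c k * indicator {x k..<x (k + 1)} u \<partial>count_space S)
        \<le> epowr (ennreal (u powr - rexp q) * F u) p * indicator I u" (is "?L \<le> ?R") for u
    proof (cases "\<exists>k\<in>S. x k \<le> u \<and> u < x (k + 1)")
      case True
      then obtain k where k: "k \<in> S" "x k \<le> u" "u < x (k + 1)" by blast
      have g: "0 < x k" using x by (auto simp: grid_def)
      then have u: "0 < u" using k by linarith
      have uniq: "j = k" if "x j \<le> u" "u < x (j + 1)" for j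
        using grid_index_less[OF x, of j u k] grid_index_less[OF x, of k u j] that k by simp
      have uI: "u \<in> I" and fk: "f k \<le> F u" using F k by blast+
      have "1 / x (k + 1) \<le> 1 / u" using k u by (intro divide_left_mono) auto
      then have "?c k \<le> epowr (F u) p * ennreal (1 / u)"
        using fk p by (intro mult_mono epowr_mono ennreal_leI) auto
      also have "\<dots> = ?R"
        unfolding p_def epowr_weight[OF q False u] using uI by (simp add: mult.commute)
      finally have c: "?c k \<le> ?R" .
      have "?L \<le> (\<integral>\<^sup>+ j. ?R * indicator {k} j \<partial>count_space S)"
      proof (intro nn_integral_mono)
        fix j
        show "?c j * indicator {x j..<x (j + 1)} u \<le> ?R * indicator {k} j"
          using uniq[of j] c by (cases "j = k") (auto simp: indicator_def)
      qed
      also have "\<dots> = ?R"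
        using k(1) by (subst nn_integral_cmult_indicator) auto
      finally show ?thesis .
    next
      case False
      then have "?L = (\<integral>\<^sup>+ k. 0 \<partial>count_space S)" by (intro nn_integral_cong) (auto simp: indicator_def)
      then show ?thesis by simp
    qed
    have "(\<integral>\<^sup>+ k. epowr (f k) p \<partial>count_space S)
      \<le> (\<integral>\<^sup>+ k. 2 * (\<integral>\<^sup>+ u. ?c k * indicator {x k..<x (k + 1)} u \<partial>lebesgue) \<partial>count_space S)"
    proof (intro nn_integral_mono)
      fix k
      have g: "0 < x k" "2 * x k \<le> x (k + 1)" using x by (auto simp: grid_def)
      have "(\<integral>\<^sup>+ u. ?c k * indicator {x k..<x (k + 1)} u \<partial>lebesgue)
          = epowr (f k) p * (ennreal (1 / x (k + 1)) * ennreal (x (k + 1) - x k))"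
        by (subst nn_integral_cmult_indicator) (simp_all only: emeasure_cell[OF x] mult.assoc, simp)
      also have "ennreal (1 / x (k + 1)) * ennreal (x (k + 1) - x k) = ennreal ((x (k + 1) - x k) / x (k + 1))"
        using g by (simp add: ennreal_mult[symmetric])
      also have "2 * (epowr (f k) p * \<dots>) = epowr (f k) p * (ennreal 2 * ennreal ((x (k + 1) - x k) / x (k + 1)))"
        by (simp add: mult.left_commute)
      also have "ennreal 2 * ennreal ((x (k + 1) - x k) / x (k + 1)) = ennreal (2 * ((x (k + 1) - x k) / x (k + 1)))"
        using g by (intro ennreal_mult[symmetric]) auto
      also have "epowr (f k) p * \<dots> \<ge> epowr (f k) p * ennreal 1"
        using g by (intro mult_left_mono ennreal_leI) (auto simp: field_simps)
      finally show "epowr (f k) p \<le> 2 * (\<integral>\<^sup>+ u. ?c k * indicator {x k..<x (k + 1)} u \<partial>lebesgue)" by simp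
    qed
    also have "\<dots> = 2 * (\<integral>\<^sup>+ k. (\<integral>\<^sup>+ u. ?c k * indicator {x k..<x (k + 1)} u \<partial>lebesgue) \<partial>count_space S)"
      by (intro nn_integral_cmult) auto
    also have "(\<integral>\<^sup>+ k. (\<integral>\<^sup>+ u. ?c k * indicator {x k..<x (k + 1)} u \<partial>lebesgue) \<partial>count_space S)
      = (\<integral>\<^sup>+ u. (\<integral>\<^sup>+ k. ?c k * indicator {x k..<x (k + 1)} u \<partial>count_space S) \<partial>lebesgue)"
      by (intro nn_integral_count_space_nn_integral[symmetric] borel_measurable_times_ennreal borel_measurable_indicator) auto
    also have "\<dots> \<le> (\<integral>\<^sup>+ u. epowr (ennreal (u powr - rexp q) * F u) p * indicator I u \<partial>lebesgue)"
      by (intro nn_integral_mono pt)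
    also have "\<dots> = (\<integral>\<^sup>+ u. epowr (ennreal (u powr - rexp q) * F u) p \<partial>lebesgue_on I)"
      using I by (intro nn_integral_restrict_space[symmetric]) auto
    finally have "epowr (\<integral>\<^sup>+ k. epowr (f k) p \<partial>count_space S) (1/p)
      \<le> epowr (2 * (\<integral>\<^sup>+ u. epowr (ennreal (u powr - rexp q) * F u) p \<partial>lebesgue_on I)) (1/p)"
      using p by (intro epowr_mono) (simp_all add: mult_left_mono)
    then show "lq q S f \<le> epowr 2 (1/p) * log_norm q I F"
      using False p by (simp add: Lq_norm_def lq_def p_def[symmetric] epowr_mult)
  qed
qed

lemma Lq_norm_cong:
  assumes "I \<in> sets borel" "\<And>u. u \<in> I \<Longrightarrow> F u = G u"
  shows "Lq_norm q I F = Lq_norm q I G"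
proof -
  have "(AE u in lebesgue_on I. F u \<le> C) = (AE u in lebesgue_on I. G u \<le> C)" for C
    using assms by (intro AE_cong) auto
  moreover have "(\<integral>\<^sup>+ u. epowr (F u) p \<partial>lebesgue_on I) = (\<integral>\<^sup>+ u. epowr (G u) p \<partial>lebesgue_on I)" for p
    using assms by (intro nn_integral_cong) auto
  ultimately show ?thesis by (simp add: Lq_norm_def)
qed

text \<open>Growth and decay of at most power type with explicit constants.  The constants are parameters because
  the sampling bounds have to be uniform over all functions \<open>\<lambda>t. K(t, f)\<close>.\<close>

definition moderate :: "real \<Rightarrow> real \<Rightarrow> (real \<Rightarrow> real) \<Rightarrow> bool" where
  "moderate C c F \<longleftrightarrow> 0 < C \<and> 0 \<le> c \<and> (\<forall>t>0. 0 \<le> F t) \<and>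
     (\<forall>s>0. \<forall>t>0. F s \<le> C * exp (c * \<bar>ln s - ln t\<bar>) * F t)"

lemma moderateD:
  "moderate C c F \<Longrightarrow> 0 < s \<Longrightarrow> 0 < t \<Longrightarrow> F s \<le> C * exp (c * \<bar>ln s - ln t\<bar>) * F t"
  "moderate C c F \<Longrightarrow> 0 < t \<Longrightarrow> 0 \<le> F t"
  by (auto simp: moderate_def)

lemma moderate_mult:
  assumes "moderate C c F" "moderate D d G"
  shows "moderate (C * D) (c + d) (\<lambda>t. F t * G t)"
  unfolding moderate_def
proof (intro conjI allI impI)
  fix s t :: real assume st: "0 < s" "0 < t"
  have "F s * G s \<le> (C * exp (c * \<bar>ln s - ln t\<bar>) * F t) * (D * exp (d * \<bar>ln s - ln t\<bar>) * G t)"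
    using st assms moderateD[OF assms(1)] moderateD[OF assms(2)]
    by (intro mult_mono) (auto simp: moderate_def)
  also have "\<dots> = C * D * exp ((c + d) * \<bar>ln s - ln t\<bar>) * (F t * G t)"
    by (simp add: ring_distribs exp_add)
  finally show "F s * G s \<le> \<dots>" .
qed (use assms in \<open>auto simp: moderate_def\<close>)

lemma moderate_powr: "moderate 1 \<bar>\<alpha>\<bar> (\<lambda>t. t powr \<alpha>)"
  unfolding moderate_def
proof (intro conjI allI impI)
  fix s t :: real assume st: "0 < s" "0 < t"
  have "\<alpha> * (ln s - ln t) \<le> \<bar>\<alpha>\<bar> * \<bar>ln s - ln t\<bar>"
    by (metis abs_ge_self abs_mult)
  then have "exp (\<alpha> * ln s) \<le> exp (\<bar>\<alpha>\<bar> * \<bar>ln s - ln t\<bar> + \<alpha> * ln t)"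
    by (simp add: algebra_simps)
  then show "s powr \<alpha> \<le> 1 * exp (\<bar>\<alpha>\<bar> * \<bar>ln s - ln t\<bar>) * t powr \<alpha>"
    using st by (simp add: powr_def exp_add)
qed auto

lemma moderate_near:
  assumes "moderate C c F" "0 < s" "0 < t" "\<bar>ln s - ln t\<bar> \<le> d"
  shows "ennreal (F s) \<le> ennreal (C * exp (c * d)) * ennreal (F t)"
proof -
  have "F s \<le> C * exp (c * \<bar>ln s - ln t\<bar>) * F t" using moderateD(1)[OF assms(1-3)] .
  also have "\<dots> \<le> C * exp (c * d) * F t"
    using assms by (auto simp: moderate_def intro!: mult_right_mono mult_left_mono)
  finally have "ennreal (F s) \<le> ennreal (C * exp (c * d) * F t)" by (rule ennreal_leI)
  then show ?thesis using assms by (simp add: ennreal_mult' moderate_def)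
qed

section \<open>Hardy's inequality and Holmstedt's formula for sequences\<close>

lemma geo_mult: "geo a j k * geo b j k = geo (a + b) j k"
  by (simp add: geo_def ennreal_mult[symmetric] exp_add[symmetric] algebra_simps)

lemma geo_zero [simp]: "geo 0 j k = 1"
  by (simp add: geo_def)

lemma geo_cancel: "geo \<delta> j k * (geo (- \<delta>) j k * x) = x"
  by (simp add: mult.assoc[symmetric] geo_mult)

text \<open>If \<open>p\<close> grows towards \<open>k\<close> at a geometric rate, its \<open>l_q\<close> norm is comparable to its supremum against
  that rate.\<close>

lemma lq_le_geo:
  assumes "0 < \<delta>" "0 < q"
  shows "\<exists>C<top. \<forall>S p k M. (\<forall>j\<in>S. geo (- \<delta>) j k * p j \<le> M) \<longrightarrow> lq q S p \<le> C * M"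
proof -
  obtain C where C: "C < top" "\<And>k. lq q UNIV (\<lambda>j. geo \<delta> j k) \<le> C"
    using lq_geo[OF assms] by blast
  have "lq q S p \<le> C * M" if p: "\<forall>j\<in>S. geo (- \<delta>) j k * p j \<le> M" for S p k M
  proof -
    have "p j \<le> M * geo \<delta> j k" if "j \<in> S" for j
    proof -
      have "geo \<delta> j k * (geo (- \<delta>) j k * p j) \<le> geo \<delta> j k * M"
        using p that by (intro mult_left_mono) auto
      then show ?thesis unfolding geo_cancel by (subst mult.commute)
    qed
    then have "lq q S p \<le> M * lq q UNIV (\<lambda>j. geo \<delta> j k)"
      using assms by (intro lq_le) auto
    also have "\<dots> \<le> M * C" by (intro mult_left_mono C) auto
    finally show ?thesis by (simp add: mult.commute)
  qed
  then show ?thesis using C(1) by blast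
qed

text \<open>The general form: \<open>Q f k\<close> is at most a supremum of the sequence \<open>p f\<close> against the rate \<open>\<delta>/2\<close> over the indices
  related to \<open>k\<close>.  The weight gains the rate \<open>\<delta>\<close> in passing from \<open>k\<close> to \<open>j\<close>, and the remaining \<open>\<delta>/2\<close> feeds the
  convolution bound.\<close>

lemma hardy:
  assumes "0 < \<delta>" "0 < r" and C0: "C0 < top" and C1: "C1 < top"
    and c: "\<And>j k. S j k \<Longrightarrow> c k \<le> C0 * geo \<delta> j k * c j"
    and Q: "\<And>f k M. (\<forall>j. S j k \<longrightarrow> geo (- (\<delta>/2)) j k * p f j \<le> M) \<Longrightarrow> Q f k \<le> C1 * M"
  shows "\<exists>C<top. \<forall>f. lq r UNIV (\<lambda>k. c k * Q f k) \<le> C * lq r UNIV (\<lambda>k. c k * p f k)"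
proof -
  obtain C2 where C2: "C2 < top"
    "\<And>f g. (\<forall>k. f k \<le> (SUP j. geo (\<delta>/2) j k * g j)) \<Longrightarrow> lq r UNIV f \<le> C2 * lq r UNIV g"
    using lq_convolution[of "\<delta>/2" r] assms by auto
  show ?thesis
  proof (intro exI[of _ "C2 * (C1 * C0)"] conjI allI)
    show "C2 * (C1 * C0) < top" using C1 C2(1) C0 by (simp add: ennreal_mult_less_top)
    fix f
    have "lq r UNIV (\<lambda>k. c k * Q f k) \<le> C2 * lq r UNIV (\<lambda>j. C1 * C0 * (c j * p f j))"
    proof (intro C2(2) allI)
      fix k
      let ?M = "SUP j\<in>{j. S j k}. geo (- (\<delta>/2)) j k * p f j"
      have "Q f k \<le> C1 * ?M" by (intro Q) (auto intro: SUP_upper)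
      then have "c k * Q f k \<le> c k * (C1 * ?M)" by (intro mult_left_mono) auto
      also have "\<dots> = (SUP j\<in>{j. S j k}. c k * C1 * (geo (- (\<delta>/2)) j k * p f j))"
        by (simp add: SUP_mult_left_ennreal mult.assoc)
      also have "\<dots> \<le> (SUP j. geo (\<delta>/2) j k * (C1 * C0 * (c j * p f j)))"
      proof (intro SUP_mono bexI UNIV_I)
        fix j assume "j \<in> {j. S j k}"
        then have "c k * C1 * (geo (- (\<delta>/2)) j k * p f j) \<le> C0 * geo \<delta> j k * c j * C1 * (geo (- (\<delta>/2)) j k * p f j)"
          by (intro mult_right_mono c) auto
        also have "\<dots> = (geo \<delta> j k * geo (- (\<delta>/2)) j k) * (C1 * C0 * (c j * p f j))"
          by (simp only: mult_ac)
        also have "\<dots> = geo (\<delta>/2) j k * (C1 * C0 * (c j * p f j))"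
          by (simp add: geo_mult)
        finally show "c k * C1 * (geo (- (\<delta>/2)) j k * p f j) \<le> geo (\<delta>/2) j k * (C1 * C0 * (c j * p f j))" .
      qed
      finally show "c k * Q f k \<le> (SUP j. geo (\<delta>/2) j k * (C1 * C0 * (c j * p f j)))" .
    qed
    then show "lq r UNIV (\<lambda>k. c k * Q f k) \<le> C2 * (C1 * C0) * lq r UNIV (\<lambda>k. c k * p f k)"
      by (simp add: lq_cmult[OF assms(2)] mult.assoc)
  qed
qed

lemma hardy_left:
  assumes "0 < \<delta>" "0 < q" "0 < r" "C0 < top" "\<And>j k. j \<le> k \<Longrightarrow> c k \<le> C0 * geo \<delta> j k * c j"
  shows "\<exists>C<top. \<forall>p. lq r UNIV (\<lambda>k. c k * lq q {..k} p) \<le> C * lq r UNIV (\<lambda>k. c k * p k)"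
proof -
  obtain C1 where C1: "C1 < top"
    "\<And>S p k M. (\<forall>j\<in>S. geo (- (\<delta>/2)) j k * p j \<le> M) \<Longrightarrow> lq q S p \<le> C1 * M"
    using lq_le_geo[of "\<delta>/2" q] assms by auto
  show ?thesis
    by (rule hardy[where S="\<lambda>j k. j \<le> k" and Q="\<lambda>p k. lq q {..k} p" and p="\<lambda>p. p", OF assms(1,3,4) C1(1) assms(5)])
       (auto intro!: C1(2))
qed

text \<open>The data of the theorem on a geometric grid with points \<open>t k\<close>: \<open>w0\<close> samples \<open>t powr (- \<theta>0) * b0(t)\<close>, \<open>T\<close> samples
  \<open>1/t\<close>, and the other sequences sample the functions of the same name.  The assumptions on \<open>w0\<close> and \<open>\<rho>\<close> are the
  traces of \<open>0 < \<theta>0 < 1\<close>.\<close>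

locale discrete_reiteration =
  fixes r0 q1 r1 :: ennreal and w0 a1 b1 T \<rho> :: "int \<Rightarrow> ennreal" and \<delta> :: real
  assumes r0: "0 < r0" and q1: "0 < q1" and r1: "0 < r1" and \<delta>: "0 < \<delta>"
    and w0_decay: "\<exists>C<top. \<forall>j k. k \<le> j \<longrightarrow> w0 j \<le> C * geo \<delta> j k * w0 k"
    and rho_growth: "\<exists>C<top. \<forall>j k. k \<le> j \<longrightarrow> \<rho> k \<le> C * geo \<delta> j k * \<rho> j"
    and b1_slow: "\<And>\<epsilon>. 0 < \<epsilon> \<Longrightarrow> \<exists>C<top. \<forall>j k. b1 k \<le> C * geo (- \<epsilon>) j k * b1 j"
begin

definition "A k = lq q1 {..k} a1"
definition "B k = lq r1 {k..} b1"
definition "N k = lq r1 {..k} (\<lambda>m. b1 m * A m)"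
definition "chi_d k = N k + B k * A k"
definition "norm0 \<kappa> = lq r0 UNIV (\<lambda>j. w0 j * \<kappa> j)"
definition "norm1 \<kappa> = lq r1 UNIV (\<lambda>m. b1 m * lq q1 {..m} (\<lambda>j. a1 j * (T j * \<kappa> j)))"
definition "P \<kappa> k = lq r0 {..k} (\<lambda>j. w0 j * \<kappa> j)"
definition "R \<kappa> k = lq r1 {k..} (\<lambda>m. b1 m * lq q1 {k..m} (\<lambda>j. a1 j * (T j * \<kappa> j)))"

text \<open>A tail norm of a slowly varying sequence is compared with a later tail norm by shifting the summation
  index, which costs only a small exponential factor.\<close>

lemma B_slow:
  assumes "0 < \<epsilon>" shows "\<exists>C<top. \<forall>j k. k \<le> j \<longrightarrow> B k \<le> C * geo (- \<epsilon>) j k * B j"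
proof -
  obtain C where C: "C < top" "\<And>j k. b1 k \<le> C * geo (- \<epsilon>) j k * b1 j"
    using b1_slow[OF assms] by blast
  have "B k \<le> C * geo (- \<epsilon>) j k * B j" for j k
  proof -
    have "B k \<le> C * geo (- \<epsilon>) j k * lq r1 {k..} (\<lambda>m. b1 (m + (j - k)))"
      unfolding B_def
    proof (intro lq_le r1)
      fix m show "b1 m \<le> C * geo (- \<epsilon>) j k * b1 (m + (j - k))"
        using C(2)[of m "m + (j - k)"] by (simp add: geo_def)
    qed simp
    also have "lq r1 {k..} (\<lambda>m. b1 (m + (j - k))) = B j"
      using lq_shift_atLeast[of r1 k "j - k" b1] by (simp add: B_def)
    finally show ?thesis .
  qed
  then show ?thesis using C(1) by blast
qed

lemma B_a1_le_chi: "B j * a1 j \<le> chi_d j"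
  unfolding chi_d_def A_def using lq_ge_point[OF q1, of j "{..j}" a1]
  by (intro add_increasing) (auto intro: mult_left_mono)

text \<open>The factor \<open>b1\<close> of the outer norm produces \<open>B k\<close>.  Since \<open>B\<close> varies slowly, half of the rate \<open>\<epsilon>\<close> pays for
  replacing \<open>B k\<close> by \<open>B j\<close> inside the inner norm, where \<open>B j * a1 j\<close> is at most \<open>\<chi>\<close>; the other half makes the
  inner norm summable.\<close>

lemma R_le:
  assumes "0 < \<epsilon>"
  shows "\<exists>C<top. \<forall>\<kappa> k M. (\<forall>j\<ge>k. geo (- \<epsilon>) j k * (chi_d j * (T j * \<kappa> j)) \<le> M) \<longrightarrow> R \<kappa> k \<le> C * M"
proof -
  obtain C1 where C1: "C1 < top" "\<And>j k. k \<le> j \<Longrightarrow> B k \<le> C1 * geo (- (\<epsilon>/2)) j k * B j"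
    using B_slow[of "\<epsilon>/2"] assms by auto
  obtain C2 where C2: "C2 < top"
    "\<And>S p k M. (\<forall>j\<in>S. geo (- (\<epsilon>/2)) j k * p j \<le> M) \<Longrightarrow> lq q1 S p \<le> C2 * M"
    using lq_le_geo[of "\<epsilon>/2" q1] assms q1 by auto
  have "R \<kappa> k \<le> C2 * C1 * M" if M: "\<forall>j\<ge>k. geo (- \<epsilon>) j k * (chi_d j * (T j * \<kappa> j)) \<le> M" for \<kappa> k M
  proof -
    let ?w = "\<lambda>j. a1 j * (T j * \<kappa> j)"
    have "R \<kappa> k \<le> lq q1 {k..} ?w * lq r1 {k..} b1"
      unfolding R_def using q1 r1
      by (intro lq_le) (auto simp: mult.commute[of _ "b1 _"] intro!: mult_left_mono lq_mono)
    also have "\<dots> = lq q1 {k..} (\<lambda>j. B k * ?w j)"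
      by (simp add: lq_cmult[OF q1] B_def mult.commute)
    also have "\<dots> \<le> C2 * (C1 * M)"
    proof (intro C2(2) ballI)
      fix j assume "j \<in> {k..}"
      then have j: "k \<le> j" by simp
      have "geo (- (\<epsilon>/2)) j k * (B k * ?w j) \<le> geo (- (\<epsilon>/2)) j k * (C1 * geo (- (\<epsilon>/2)) j k * B j * ?w j)"
        by (intro mult_left_mono mult_right_mono C1 j) auto
      also have "\<dots> = C1 * ((geo (- (\<epsilon>/2)) j k * geo (- (\<epsilon>/2)) j k) * ((B j * a1 j) * (T j * \<kappa> j)))"
        by (simp only: mult_ac)
      also have "\<dots> \<le> C1 * (geo (- \<epsilon>) j k * (chi_d j * (T j * \<kappa> j)))"
        unfolding geo_mult by (intro mult_left_mono mult_mono B_a1_le_chi) auto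
      also have "\<dots> \<le> C1 * M" using M j by (intro mult_left_mono) auto
      finally show "geo (- (\<epsilon>/2)) j k * (B k * ?w j) \<le> C1 * M" .
    qed
    finally show ?thesis by (simp add: mult.assoc)
  qed
  then show ?thesis using C1(1) C2(1) by (intro exI[of _ "C2 * C1"]) (auto simp: ennreal_mult_less_top)
qed

text \<open>Since \<open>T * \<kappa>\<close> decreases, \<open>\<kappa>\<close> is at least linear with slope \<open>T j * \<kappa> j\<close> up to \<open>j\<close>, and \<open>\<chi>\<close> measures the contribution of
  a linear function.  Its two terms come from the outer variable before and after \<open>j\<close>.\<close>

lemma chi_le_norm1:
  assumes "antimono (\<lambda>j. T j * \<kappa> j)"
  shows "chi_d j * (T j * \<kappa> j) \<le> 2 * norm1 \<kappa>"
proof -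
  let ?w = "\<lambda>j. a1 j * (T j * \<kappa> j)"
  have le: "T j * \<kappa> j * a1 i \<le> ?w i" if "i \<le> j" for i
    using antimonoD[OF assms that] by (auto simp: mult.commute intro: mult_left_mono)
  have A: "T j * \<kappa> j * A m \<le> lq q1 {..m} ?w" if "m \<le> j" for m
    unfolding A_def lq_cmult[OF q1, symmetric] using that
    by (intro lq_mono q1) (auto intro!: le)
  have "T j * \<kappa> j * N j \<le> norm1 \<kappa>"
    unfolding N_def norm1_def lq_cmult[OF r1, symmetric]
    by (intro lq_mono r1) (auto simp: mult.left_commute[of _ "b1 _"] intro!: mult_left_mono A)
  moreover have "T j * \<kappa> j * A j * B j \<le> norm1 \<kappa>"
    unfolding B_def norm1_def lq_cmult[OF r1, symmetric]
  proof (intro lq_mono r1)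
    fix m assume "m \<in> {j..}"
    then have "T j * \<kappa> j * A j \<le> lq q1 {..m} ?w"
      by (intro order_trans[OF A[OF order_refl]] lq_mono q1) auto
    then show "T j * \<kappa> j * A j * b1 m \<le> b1 m * lq q1 {..m} ?w"
      by (subst mult.commute) (rule mult_left_mono, auto)
  qed simp
  ultimately have "T j * \<kappa> j * N j + T j * \<kappa> j * A j * B j \<le> norm1 \<kappa> + norm1 \<kappa>"
    by (rule add_mono)
  then show ?thesis by (simp add: chi_d_def mult_2 algebra_simps)
qed

end

text \<open>The identity \<open>\<rho>(t) \<chi>(t) / t = t powr (- \<theta>0) * b0(t)\<close>, which defines \<open>\<rho>\<close>, up to constants.\<close>

locale discrete_reiteration_balanced = discrete_reiteration +
  assumes balance: "\<exists>C<top. \<forall>k. w0 k \<le> C * (\<rho> k * (chi_d k * T k)) \<and> \<rho> k * (chi_d k * T k) \<le> C * w0 k"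
begin

text \<open>By \<open>R_le\<close> the iterated tail norm \<open>R\<close> is also at most a supremum against a geometric rate, so the general
  form applies with the weight \<open>c * \<rho>\<close>; the balance turns \<open>\<rho> \<chi> T\<close> into \<open>w0\<close>.\<close>

lemma hardy_R:
  assumes "0 < \<eta>" "0 < r" and C0: "C0 < top"
    and c: "\<And>j k. k \<le> j \<Longrightarrow> c k * \<rho> k \<le> C0 * geo \<eta> j k * (c j * \<rho> j)"
  shows "\<exists>C<top. \<forall>\<kappa>. lq r UNIV (\<lambda>k. c k * (\<rho> k * R \<kappa> k)) \<le> C * lq r UNIV (\<lambda>k. c k * (w0 k * \<kappa> k))"
proof -
  obtain C1 where C1: "C1 < top"
    "\<And>\<kappa> k M. (\<forall>j\<ge>k. geo (- (\<eta>/2)) j k * (chi_d j * (T j * \<kappa> j)) \<le> M) \<Longrightarrow> R \<kappa> k \<le> C1 * M"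
    using R_le[of "\<eta>/2"] assms by auto
  obtain C2 where C2: "C2 < top"
    "\<And>\<kappa>. lq r UNIV (\<lambda>k. c k * \<rho> k * R \<kappa> k) \<le> C2 * lq r UNIV (\<lambda>k. c k * \<rho> k * (chi_d k * (T k * \<kappa> k)))"
    using hardy[where S="\<lambda>j k. k \<le> j" and c="\<lambda>k. c k * \<rho> k" and Q=R and p="\<lambda>\<kappa> j. chi_d j * (T j * \<kappa> j)",
        OF assms(1,2) C0 C1(1) c C1(2)] by blast
  obtain C3 where C3: "C3 < top" "\<And>k. \<rho> k * (chi_d k * T k) \<le> C3 * w0 k"
    using balance by blast
  have "lq r UNIV (\<lambda>k. c k * (\<rho> k * R \<kappa> k)) \<le> C2 * C3 * lq r UNIV (\<lambda>k. c k * (w0 k * \<kappa> k))" for \<kappa>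
  proof -
    have "lq r UNIV (\<lambda>k. c k * \<rho> k * (chi_d k * (T k * \<kappa> k))) \<le> C3 * lq r UNIV (\<lambda>k. c k * (w0 k * \<kappa> k))"
    proof (intro lq_le assms(2))
      fix k
      have "c k * \<kappa> k * (\<rho> k * (chi_d k * T k)) \<le> c k * \<kappa> k * (C3 * w0 k)" by (intro mult_left_mono C3) auto
      then show "c k * \<rho> k * (chi_d k * (T k * \<kappa> k)) \<le> C3 * (c k * (w0 k * \<kappa> k))" by (simp add: mult_ac)
    qed simp
    then have "C2 * lq r UNIV (\<lambda>k. c k * \<rho> k * (chi_d k * (T k * \<kappa> k))) \<le> C2 * (C3 * lq r UNIV (\<lambda>k. c k * (w0 k * \<kappa> k)))"
      by (rule mult_left_mono) simp
    then show ?thesis using order_trans[OF C2(2)] by (simp add: mult.assoc)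
  qed
  then show ?thesis using C2(1) C3(1) by (intro exI[of _ "C2 * C3"]) (auto simp: ennreal_mult_less_top)
qed

text \<open>The cross term of the first summand, obtained from \<open>hardy_R\<close> with constant weight and exponent
  \<open>\<infinity>\<close>.\<close>

lemma rho_R_le_norm0: "\<exists>C<top. \<forall>\<kappa> k. \<rho> k * R \<kappa> k \<le> C * norm0 \<kappa>"
proof -
  obtain C0 where C0: "C0 < top" "\<And>j k. k \<le> j \<Longrightarrow> \<rho> k \<le> C0 * geo \<delta> j k * \<rho> j"
    using rho_growth by blast
  obtain C where C: "C < top"
    "\<And>\<kappa>. lq top UNIV (\<lambda>k. \<rho> k * R \<kappa> k) \<le> C * lq top UNIV (\<lambda>k. w0 k * \<kappa> k)"
    using hardy_R[OF \<delta>, of top C0 "\<lambda>_. 1"] C0 by auto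
  have "\<rho> k * R \<kappa> k \<le> C * norm0 \<kappa>" for \<kappa> k
  proof -
    have "\<rho> k * R \<kappa> k \<le> lq top UNIV (\<lambda>k. \<rho> k * R \<kappa> k)"
      by (rule lq_ge_point[where x="\<lambda>k. \<rho> k * R \<kappa> k"]) auto
    also have "\<dots> \<le> C * lq top UNIV (\<lambda>k. w0 k * \<kappa> k)" by (rule C)
    also have "lq top UNIV (\<lambda>k. w0 k * \<kappa> k) \<le> norm0 \<kappa>"
      unfolding norm0_def lq_def[of top]
      by (auto intro!: SUP_least lq_ge_point[where x="\<lambda>k. w0 k * \<kappa> k"] r0)
    finally show ?thesis by (simp add: mult_left_mono)
  qed
  then show ?thesis using C(1) by blast
qed

text \<open>The cross term of the second summand: \<open>w0 j * \<kappa> j\<close> is at most \<open>\<rho> j\<close> times the norm, and \<open>\<rho>\<close> grows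
  geometrically up to \<open>k\<close>.\<close>

lemma P_le_norm1:
  "\<exists>C<top. \<forall>\<kappa> k. antimono (\<lambda>j. T j * \<kappa> j) \<longrightarrow> P \<kappa> k \<le> C * (\<rho> k * norm1 \<kappa>)"
proof -
  obtain C0 where C0: "C0 < top" "\<And>j k. k \<le> j \<Longrightarrow> \<rho> k \<le> C0 * geo \<delta> j k * \<rho> j"
    using rho_growth by blast
  obtain C1 where C1: "C1 < top" "\<And>k. w0 k \<le> C1 * (\<rho> k * (chi_d k * T k))"
    using balance by blast
  obtain C2 where C2: "C2 < top"
    "\<And>S p k M. (\<forall>j\<in>S. geo (- \<delta>) j k * p j \<le> M) \<Longrightarrow> lq r0 S p \<le> C2 * M"
    using lq_le_geo[OF \<delta> r0] by blast
  let ?D = "C1 * C0 * 2"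
  have "P \<kappa> k \<le> C2 * ?D * (\<rho> k * norm1 \<kappa>)" if \<kappa>: "antimono (\<lambda>j. T j * \<kappa> j)" for \<kappa> k
  proof -
    have "P \<kappa> k \<le> C2 * (?D * (\<rho> k * norm1 \<kappa>))"
      unfolding P_def
    proof (intro C2(2) ballI)
      fix j assume "j \<in> {..k}"
      then have j: "j \<le> k" by simp
      have "geo (- \<delta>) j k * (w0 j * \<kappa> j) \<le> geo (- \<delta>) j k * (C1 * (\<rho> j * (chi_d j * T j)) * \<kappa> j)"
        by (intro mult_left_mono mult_right_mono C1) auto
      also have "\<dots> = geo (- \<delta>) j k * C1 * \<rho> j * (chi_d j * (T j * \<kappa> j))" by (simp only: mult_ac)
      also have "\<dots> \<le> geo (- \<delta>) j k * C1 * (C0 * geo \<delta> k j * \<rho> k) * (2 * norm1 \<kappa>)"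
        by (intro mult_mono chi_le_norm1 \<kappa> C0 j order_refl) auto
      also have "\<dots> = (geo (- \<delta>) j k * geo \<delta> j k) * (?D * (\<rho> k * norm1 \<kappa>))"
        by (simp only: mult_ac geo_sym[of \<delta> k j])
      also have "\<dots> = ?D * (\<rho> k * norm1 \<kappa>)" by (simp add: geo_mult)
      finally show "geo (- \<delta>) j k * (w0 j * \<kappa> j) \<le> ?D * (\<rho> k * norm1 \<kappa>)" .
    qed
    then show ?thesis by (simp add: mult.assoc)
  qed
  then show ?thesis using C0(1) C1(1) C2(1)
    by (intro exI[of _ "C2 * ?D"]) (auto simp: ennreal_mult_less_top)
qed

text \<open>The diagonal terms, \<open>P\<close> of the first summand and \<open>R\<close> of the second one, are parts of the two norms; the cross
  terms are bounded by \<open>rho_R_le_norm0\<close> and \<open>P_le_norm1\<close>.\<close>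

lemma holmstedt_lower:
  assumes M: "M < top"
  shows "\<exists>C<top. \<forall>\<kappa> \<kappa>0 \<kappa>1 k. (\<forall>j. \<kappa> j \<le> M * (\<kappa>0 j + \<kappa>1 j)) \<longrightarrow> antimono (\<lambda>j. T j * \<kappa>1 j) \<longrightarrow>
     P \<kappa> k + \<rho> k * R \<kappa> k \<le> C * (norm0 \<kappa>0 + \<rho> k * norm1 \<kappa>1)"
proof -
  obtain C1 where C1: "C1 < top" "\<And>\<kappa> k. \<rho> k * R \<kappa> k \<le> C1 * norm0 \<kappa>" using rho_R_le_norm0 by blast
  obtain C2 where C2: "C2 < top" "\<And>\<kappa> k. antimono (\<lambda>j. T j * \<kappa> j) \<Longrightarrow> P \<kappa> k \<le> C2 * (\<rho> k * norm1 \<kappa>)"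
    using P_le_norm1 by blast
  obtain D0 where D0: "D0 < top" "\<And>S x y. lq r0 S (\<lambda>k. x k + y k) \<le> D0 * (lq r0 S x + lq r0 S y)"
    using lq_add[OF r0] by blast
  obtain D1 where D1: "D1 < top" "\<And>S x y. lq r1 S (\<lambda>k. x k + y k) \<le> D1 * (lq r1 S x + lq r1 S y)"
    using lq_add[OF r1] by blast
  obtain E1 where E1: "E1 < top" "\<And>S x y. lq q1 S (\<lambda>k. x k + y k) \<le> E1 * (lq q1 S x + lq q1 S y)"
    using lq_add[OF q1] by blast
  let ?C = "M * D0 * (1 + C2) + M * E1 * D1 * (1 + C1)"
  have "P \<kappa> k + \<rho> k * R \<kappa> k \<le> ?C * (norm0 \<kappa>0 + \<rho> k * norm1 \<kappa>1)"
    if \<kappa>: "\<forall>j. \<kappa> j \<le> M * (\<kappa>0 j + \<kappa>1 j)" and anti: "antimono (\<lambda>j. T j * \<kappa>1 j)" for \<kappa> \<kappa>0 \<kappa>1 k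
  proof -
    let ?Z = "norm0 \<kappa>0 + \<rho> k * norm1 \<kappa>1"
    have "P \<kappa> k \<le> M * lq r0 {..k} (\<lambda>j. w0 j * \<kappa>0 j + w0 j * \<kappa>1 j)"
      unfolding P_def
    proof (intro lq_le r0)
      fix j show "w0 j * \<kappa> j \<le> M * (w0 j * \<kappa>0 j + w0 j * \<kappa>1 j)"
        using mult_left_mono[OF \<kappa>[rule_format, of j], of "w0 j"] by (simp add: algebra_simps)
    qed simp
    also have "\<dots> \<le> M * (D0 * (P \<kappa>0 k + P \<kappa>1 k))"
      unfolding P_def by (intro mult_left_mono D0) auto
    also have "P \<kappa>0 k \<le> norm0 \<kappa>0" unfolding P_def norm0_def by (intro lq_mono r0) auto
    also have "P \<kappa>1 k \<le> C2 * (\<rho> k * norm1 \<kappa>1)" by (rule C2(2)[OF anti])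
    also have "M * (D0 * (norm0 \<kappa>0 + C2 * (\<rho> k * norm1 \<kappa>1))) \<le> M * (D0 * ((1 + C2) * ?Z))"
      by (intro mult_left_mono) (auto simp: algebra_simps intro: add_increasing add_increasing2)
    finally have P: "P \<kappa> k \<le> M * D0 * (1 + C2) * ?Z"
      by (simp add: mult_left_mono add_mono mult.assoc)
    let ?v = "\<lambda>\<kappa> m. b1 m * lq q1 {k..m} (\<lambda>j. a1 j * (T j * \<kappa> j))"
    have "R \<kappa> k \<le> M * E1 * lq r1 {k..} (\<lambda>m. ?v \<kappa>0 m + ?v \<kappa>1 m)"
      unfolding R_def
    proof (intro lq_le r1)
      fix m
      have "lq q1 {k..m} (\<lambda>j. a1 j * (T j * \<kappa> j))
          \<le> M * lq q1 {k..m} (\<lambda>j. a1 j * (T j * \<kappa>0 j) + a1 j * (T j * \<kappa>1 j))"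
      proof (intro lq_le q1)
        fix j show "a1 j * (T j * \<kappa> j) \<le> M * (a1 j * (T j * \<kappa>0 j) + a1 j * (T j * \<kappa>1 j))"
          using mult_left_mono[OF \<kappa>[rule_format, of j], of "a1 j * T j"] by (simp add: algebra_simps)
      qed simp
      also have "\<dots> \<le> M * (E1 * (lq q1 {k..m} (\<lambda>j. a1 j * (T j * \<kappa>0 j)) + lq q1 {k..m} (\<lambda>j. a1 j * (T j * \<kappa>1 j))))"
        by (intro mult_left_mono E1) auto
      finally have "?v \<kappa> m \<le> b1 m * (M * (E1 * (lq q1 {k..m} (\<lambda>j. a1 j * (T j * \<kappa>0 j)) + lq q1 {k..m} (\<lambda>j. a1 j * (T j * \<kappa>1 j)))))"
        by (intro mult_left_mono) auto
      then show "?v \<kappa> m \<le> M * E1 * (?v \<kappa>0 m + ?v \<kappa>1 m)" by (simp add: algebra_simps)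
    qed simp
    also have "\<dots> \<le> M * E1 * (D1 * (R \<kappa>0 k + R \<kappa>1 k))"
      unfolding R_def by (intro mult_left_mono D1) auto
    also have "R \<kappa>1 k \<le> norm1 \<kappa>1"
      unfolding R_def norm1_def by (intro lq_mono r1 mult_left_mono q1) auto
    finally have "\<rho> k * R \<kappa> k \<le> \<rho> k * (M * E1 * (D1 * (R \<kappa>0 k + norm1 \<kappa>1)))"
      by (simp add: mult_left_mono add_left_mono)
    also have "\<dots> = M * E1 * D1 * (\<rho> k * R \<kappa>0 k + \<rho> k * norm1 \<kappa>1)" by (simp add: algebra_simps)
    also have "\<rho> k * R \<kappa>0 k \<le> C1 * norm0 \<kappa>0" by (rule C1)
    also have "M * E1 * D1 * (C1 * norm0 \<kappa>0 + \<rho> k * norm1 \<kappa>1) \<le> M * E1 * D1 * ((1 + C1) * ?Z)"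
      by (intro mult_left_mono) (auto simp: algebra_simps intro: add_increasing add_increasing2)
    finally have R: "\<rho> k * R \<kappa> k \<le> M * E1 * D1 * (1 + C1) * ?Z"
      by (simp add: mult_left_mono add_mono mult.assoc)
    show ?thesis using add_mono[OF P R] by (simp add: distrib_right)
  qed
  then show ?thesis using M C1(1) C2(1) D0(1) D1(1) E1(1)
    by (intro exI[of _ ?C]) (auto simp: ennreal_mult_less_top)
qed

text \<open>The hypotheses describe an almost optimal decomposition at \<open>k\<close>.  Both norms are split at \<open>k\<close>; the
  pieces that contain no values of \<open>\<kappa>\<close> beyond \<open>\<kappa> k\<close> are absorbed by the last term \<open>w0 k * \<kappa> k\<close> of \<open>P\<close>.\<close>

lemma holmstedt_upper:
  assumes M: "M < top"
  shows "\<exists>C<top. \<forall>\<kappa> \<kappa>0 \<kappa>1 k. (\<forall>j\<le>k. \<kappa>0 j \<le> M * \<kappa> j) \<longrightarrow> (\<forall>j\<ge>k. \<kappa>0 j \<le> M * \<kappa> k) \<longrightarrow>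
     (\<forall>j\<ge>k. \<kappa>1 j \<le> M * \<kappa> j) \<longrightarrow> (\<forall>j\<le>k. T j * \<kappa>1 j \<le> M * (T k * \<kappa> k)) \<longrightarrow>
     norm0 \<kappa>0 + \<rho> k * norm1 \<kappa>1 \<le> C * (P \<kappa> k + \<rho> k * R \<kappa> k)"
proof -
  obtain C0 where C0: "C0 < top" "\<And>j k. k \<le> j \<Longrightarrow> w0 j \<le> C0 * geo \<delta> j k * w0 k"
    using w0_decay by blast
  obtain C1 where C1: "C1 < top" "\<And>k. \<rho> k * (chi_d k * T k) \<le> C1 * w0 k"
    using balance by blast
  obtain G where G: "G < top" "\<And>S p k M. (\<forall>j\<in>S. geo (- \<delta>) j k * p j \<le> M) \<Longrightarrow> lq r0 S p \<le> G * M"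
    using lq_le_geo[OF \<delta> r0] by blast
  obtain U0 where U0: "U0 < top" "\<And>S T x. lq r0 (S \<union> T) x \<le> U0 * (lq r0 S x + lq r0 T x)"
    using lq_union[OF r0] by blast
  obtain U1 where U1: "U1 < top" "\<And>S T x. lq r1 (S \<union> T) x \<le> U1 * (lq r1 S x + lq r1 T x)"
    using lq_union[OF r1] by blast
  obtain V1 where V1: "V1 < top" "\<And>S T x. lq q1 (S \<union> T) x \<le> V1 * (lq q1 S x + lq q1 T x)"
    using lq_union[OF q1] by blast
  obtain D1 where D1: "D1 < top" "\<And>S x y. lq r1 S (\<lambda>k. x k + y k) \<le> D1 * (lq r1 S x + lq r1 S y)"
    using lq_add[OF r1] by blast
  let ?E = "U1 * (M + V1 * M * D1)"
  let ?C = "U0 * (M + G * (M * C0)) + ?E * (1 + C1)"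
  have "norm0 \<kappa>0 + \<rho> k * norm1 \<kappa>1 \<le> ?C * (P \<kappa> k + \<rho> k * R \<kappa> k)"
    if h: "\<forall>j\<le>k. \<kappa>0 j \<le> M * \<kappa> j" "\<forall>j\<ge>k. \<kappa>0 j \<le> M * \<kappa> k"
     "\<forall>j\<ge>k. \<kappa>1 j \<le> M * \<kappa> j" "\<forall>j\<le>k. T j * \<kappa>1 j \<le> M * (T k * \<kappa> k)" for \<kappa> \<kappa>0 \<kappa>1 k
  proof -
    let ?Z = "P \<kappa> k + \<rho> k * R \<kappa> k"
    have Uk: "(UNIV :: int set) = {..k} \<union> {k..}" by auto
    have pk: "w0 k * \<kappa> k \<le> P \<kappa> k"
      unfolding P_def by (rule lq_ge_point[where x="\<lambda>j. w0 j * \<kappa> j"]) (auto simp: r0)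
    have "norm0 \<kappa>0 \<le> U0 * (lq r0 {..k} (\<lambda>j. w0 j * \<kappa>0 j) + lq r0 {k..} (\<lambda>j. w0 j * \<kappa>0 j))"
      unfolding norm0_def Uk by (rule U0)
    also have "lq r0 {..k} (\<lambda>j. w0 j * \<kappa>0 j) \<le> M * P \<kappa> k"
      unfolding P_def
    proof (intro lq_le r0)
      fix j assume "j \<in> {..k}"
      then have "w0 j * \<kappa>0 j \<le> w0 j * (M * \<kappa> j)" using h(1) by (intro mult_left_mono) auto
      then show "w0 j * \<kappa>0 j \<le> M * (w0 j * \<kappa> j)" by (simp add: mult_ac)
    qed simp
    also have "lq r0 {k..} (\<lambda>j. w0 j * \<kappa>0 j) \<le> G * (M * C0 * (w0 k * \<kappa> k))"
    proof (intro G ballI)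
      fix j assume "j \<in> {k..}"
      then have "geo (- \<delta>) j k * (w0 j * \<kappa>0 j) \<le> geo (- \<delta>) j k * ((C0 * geo \<delta> j k * w0 k) * (M * \<kappa> k))"
        using h(2) by (intro mult_left_mono mult_mono C0) auto
      also have "\<dots> = (geo (- \<delta>) j k * geo \<delta> j k) * (M * C0 * (w0 k * \<kappa> k))" by (simp only: mult_ac)
      finally show "geo (- \<delta>) j k * (w0 j * \<kappa>0 j) \<le> M * C0 * (w0 k * \<kappa> k)" by (simp add: geo_mult)
    qed
    also have "G * (M * C0 * (w0 k * \<kappa> k)) \<le> G * (M * C0 * P \<kappa> k)"
      by (intro mult_left_mono pk) auto
    also have "U0 * (M * P \<kappa> k + G * (M * C0 * P \<kappa> k)) = U0 * (M + G * (M * C0)) * P \<kappa> k"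
      by (simp add: algebra_simps)
    also have "\<dots> \<le> U0 * (M + G * (M * C0)) * ?Z"
      by (intro mult_left_mono) (auto simp: add_increasing2)
    finally have n0: "norm0 \<kappa>0 \<le> U0 * (M + G * (M * C0)) * ?Z"
      by (simp add: mult_left_mono add_mono)

    let ?y = "T k * \<kappa> k"
    let ?w = "\<lambda>\<kappa> j. a1 j * (T j * \<kappa> j)"
    let ?v = "\<lambda>m. b1 m * lq q1 {..m} (?w \<kappa>1)"
    let ?X = "chi_d k * ?y + R \<kappa> k"
    have A: "lq q1 {..m} (?w \<kappa>1) \<le> M * ?y * A m" if "m \<le> k" for m
      unfolding A_def
    proof (intro lq_le q1)
      fix j assume "j \<in> {..m}"
      then have "a1 j * (T j * \<kappa>1 j) \<le> a1 j * (M * (T k * \<kappa> k))" using h(4) that by (intro mult_left_mono) auto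
      then show "a1 j * (T j * \<kappa>1 j) \<le> M * ?y * a1 j" by (simp add: mult_ac)
    qed simp
    have left: "lq r1 {..k} ?v \<le> M * ?X"
    proof -
      have "lq r1 {..k} ?v \<le> M * ?y * N k"
        unfolding N_def
      proof (intro lq_le r1)
        fix m assume "m \<in> {..k}"
        then have "?v m \<le> b1 m * (M * ?y * A m)" by (intro mult_left_mono A) auto
        then show "?v m \<le> M * ?y * (b1 m * A m)" by (simp add: mult_ac)
      qed simp
      also have "\<dots> = M * (N k * ?y)" by (simp add: mult_ac)
      also have "\<dots> \<le> M * ?X"
        by (intro mult_left_mono) (auto simp: chi_d_def algebra_simps intro: add_increasing2)
      finally show ?thesis .
    qed
    have right: "lq r1 {k..} ?v \<le> V1 * M * D1 * ?X"
    proof -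
      have "lq r1 {k..} ?v \<le> V1 * M * lq r1 {k..} (\<lambda>m. ?y * A k * b1 m + b1 m * lq q1 {k..m} (?w \<kappa>))"
      proof (intro lq_le r1)
        fix m assume m: "m \<in> {k..}"
        have "{..m} = {..k} \<union> {k..m}" using m by auto
        then have "lq q1 {..m} (?w \<kappa>1) \<le> V1 * (lq q1 {..k} (?w \<kappa>1) + lq q1 {k..m} (?w \<kappa>1))"
          using V1(2) by simp
        also have "\<dots> \<le> V1 * (M * ?y * A k + M * lq q1 {k..m} (?w \<kappa>))"
        proof (intro mult_left_mono add_mono A lq_le q1)
          fix j assume "j \<in> {k..m}"
          then have "a1 j * (T j * \<kappa>1 j) \<le> a1 j * (T j * (M * \<kappa> j))" using h(3) by (intro mult_left_mono) auto
          then show "a1 j * (T j * \<kappa>1 j) \<le> M * (a1 j * (T j * \<kappa> j))" by (simp add: mult_ac)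
        qed auto
        finally have "?v m \<le> b1 m * (V1 * (M * ?y * A k + M * lq q1 {k..m} (?w \<kappa>)))"
          by (intro mult_left_mono) auto
        then show "?v m \<le> V1 * M * (?y * A k * b1 m + b1 m * lq q1 {k..m} (?w \<kappa>))"
          by (simp add: algebra_simps)
      qed simp
      also have "\<dots> \<le> V1 * M * (D1 * (lq r1 {k..} (\<lambda>m. ?y * A k * b1 m) + R \<kappa> k))"
        unfolding R_def by (intro mult_left_mono D1) auto
      also have "lq r1 {k..} (\<lambda>m. ?y * A k * b1 m) = B k * A k * ?y"
        unfolding lq_cmult[OF r1] B_def by (simp add: mult_ac)
      also have "V1 * M * (D1 * (B k * A k * ?y + R \<kappa> k)) \<le> V1 * M * (D1 * ?X)"
        by (intro mult_left_mono) (auto simp: chi_d_def algebra_simps intro: add_increasing2)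
      finally show ?thesis by (simp add: mult.assoc)
    qed
    have "norm1 \<kappa>1 \<le> U1 * (lq r1 {..k} ?v + lq r1 {k..} ?v)"
      unfolding norm1_def Uk by (rule U1)
    also have "\<dots> \<le> U1 * (M * ?X + V1 * M * D1 * ?X)"
      by (intro mult_left_mono add_mono left right) auto
    also have "\<dots> = ?E * ?X" by (simp add: algebra_simps)
    finally have "\<rho> k * norm1 \<kappa>1 \<le> \<rho> k * (?E * ?X)" by (intro mult_left_mono) auto
    also have "\<dots> = ?E * (\<rho> k * (chi_d k * T k) * \<kappa> k + \<rho> k * R \<kappa> k)" by (simp add: algebra_simps)
    also have "\<dots> \<le> ?E * (C1 * w0 k * \<kappa> k + \<rho> k * R \<kappa> k)"
      by (intro mult_left_mono add_right_mono mult_right_mono C1) auto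
    also have "\<dots> \<le> ?E * (C1 * P \<kappa> k + \<rho> k * R \<kappa> k)"
      using pk by (intro mult_left_mono add_right_mono) (auto simp: mult.assoc intro: mult_left_mono)
    also have "\<dots> \<le> ?E * ((1 + C1) * ?Z)"
      by (intro mult_left_mono) (auto simp: algebra_simps intro: add_increasing add_increasing2)
    finally have n1: "\<rho> k * norm1 \<kappa>1 \<le> ?E * (1 + C1) * ?Z" by (simp add: mult.assoc)
    show ?thesis using add_mono[OF n0 n1] by (simp add: distrib_right)
  qed
  then show ?thesis using M C0(1) C1(1) G(1) U0(1) U1(1) V1(1) D1(1)
    by (intro exI[of _ ?C]) (auto simp: ennreal_mult_less_top)
qed

end

section \<open>Sampling iterated norms\<close>

abbreviation comparable :: "ennreal \<Rightarrow> ennreal \<Rightarrow> ennreal \<Rightarrow> bool" ("(_/ \<asymp>[_] _)" [51, 0, 51] 50) where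
  "u \<asymp>[D] v \<equiv> u \<le> D * v \<and> v \<le> D * u"

lemma grid_near:
  assumes x: "grid x M" and u: "x k \<le> u" "u < x (k + 1)" and i: "\<bar>i\<bar> \<le> 2"
  shows "\<bar>ln u - ln (x (k + i))\<bar> \<le> 3 * ln M" "0 < u"
proof -
  have s: "\<bar>ln (x (j + 1)) - ln (x j)\<bar> \<le> ln M" for j by (rule grid_ln(2)[OF x])
  have L: "0 \<le> ln M" using grid_ln(1)[OF x] by simp
  have n: "\<bar>ln (x (k + 1)) - ln (x k)\<bar> \<le> ln M" "\<bar>ln (x k) - ln (x (k - 1))\<bar> \<le> ln M"
    "\<bar>ln (x (k + 2)) - ln (x (k + 1))\<bar> \<le> ln M" "\<bar>ln (x (k - 1)) - ln (x (k - 2))\<bar> \<le> ln M"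
    using s[of k] s[of "k - 1"] s[of "k + 1"] s[of "k - 2"] by (simp_all add: add.assoc)
  consider "i = 0" | "i = 1" | "i = -1" | "i = 2" | "i = -2" using i by linarith
  then have "\<bar>ln (x (k + i)) - ln (x k)\<bar> \<le> 2 * ln M"
  proof cases
    case 1 then show ?thesis using L by simp
  next
    case 2 then show ?thesis using n L by simp
  next
    case 3 then show ?thesis using n L by (simp add: abs_minus_commute)
  next
    case 4
    then have e: "x (k + i) = x (k + 2)" by simp
    show ?thesis unfolding e using n by linarith
  next
    case 5
    then have e: "x (k + i) = x (k - 2)" by simp
    show ?thesis unfolding e using n by linarith
  qed
  then show "\<bar>ln u - ln (x (k + i))\<bar> \<le> 3 * ln M" using grid_ln(3)[OF x u] by linarith
  have "0 < x k" using x by (simp add: grid_def)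
  then show "0 < u" using u by linarith
qed

lemma moderate_cell:
  assumes x: "grid x M" and F: "moderate C c F" and u: "x k \<le> u" "u < x (k + 1)" and i: "\<bar>i\<bar> \<le> 2"
  shows "ennreal (F u) \<le> ennreal (C * exp (c * (3 * ln M))) * ennreal (F (x (k + i)))"
    "ennreal (F (x (k + i))) \<le> ennreal (C * exp (c * (3 * ln M))) * ennreal (F u)"
proof -
  have p: "0 < x (k + i)" using x by (simp add: grid_def)
  show "ennreal (F u) \<le> ennreal (C * exp (c * (3 * ln M))) * ennreal (F (x (k + i)))"
    using grid_near[OF x u i] p by (intro moderate_near[OF F]) auto
  show "ennreal (F (x (k + i))) \<le> ennreal (C * exp (c * (3 * ln M))) * ennreal (F u)"
    using grid_near[OF x u i] p by (intro moderate_near[OF F]) (auto simp: abs_minus_commute)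
qed

abbreviation cell :: "(int \<Rightarrow> real) \<Rightarrow> int \<Rightarrow> real set" where
  "cell x k \<equiv> {x k..<x (k + 1)}"

text \<open>The norms of the spaces are iterated, with an inner norm \<open>G\<close> that is itself known only through samples \<open>g\<close> up
  to the constant \<open>D\<close>.  One bound for products \<open>b * G\<close> therefore serves every level of the iteration.  The
  shift \<open>i\<close> compensates for the cells at the ends of \<open>I\<close>, which need not be contained in \<open>I\<close>: a sample there is
  comparable to the values on a nearby cell.  As a predicate in \<open>E\<close> the bound is uniform in \<open>b\<close>, hence in \<open>f\<close>.\<close>

definition weighted_sampling ::
  "ennreal \<Rightarrow> (int \<Rightarrow> real) \<Rightarrow> real \<Rightarrow> real \<Rightarrow> ennreal \<Rightarrow> ennreal \<Rightarrow> bool" where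
  "weighted_sampling q x C c D E \<longleftrightarrow> E < top \<and>
    (\<forall>b I S G g. moderate C c b \<longrightarrow> I \<in> sets borel \<longrightarrow> I \<subseteq> {0<..} \<longrightarrow>
      (\<forall>u\<in>I. \<forall>k. u \<in> cell x k \<longrightarrow> k \<in> S \<and> G u \<le> D * g k) \<longrightarrow>
      log_norm q I (\<lambda>u. ennreal (b u) * G u) \<le> E * lq q S (\<lambda>k. ennreal (b (x k)) * g k)) \<and>
    (\<forall>b I S G g i. moderate C c b \<longrightarrow> I \<in> sets borel \<longrightarrow> \<bar>i\<bar> \<le> 2 \<longrightarrow>
      (\<forall>k\<in>S. \<forall>u\<in>cell x k. u \<in> I \<and> g (k + i) \<le> D * G u) \<longrightarrow>
      lq q S (\<lambda>k. ennreal (b (x (k + i))) * g (k + i)) \<le> E * log_norm q I (\<lambda>u. ennreal (b u) * G u))"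

lemma weighted_sampling_exists:
  assumes x: "grid x M" and q: "0 < q" and D: "D < top"
  shows "\<exists>E. weighted_sampling q x C c D E"
proof -
  obtain U where U: "U < top" "\<And>I S F f. I \<in> sets borel \<Longrightarrow> I \<subseteq> {0<..} \<Longrightarrow>
    (\<forall>u\<in>I. \<exists>k\<in>S. x k \<le> u \<and> u < x (k + 1) \<and> F u \<le> f k) \<Longrightarrow> log_norm q I F \<le> U * lq q S f"
    using sample_upper[OF x q] by blast
  obtain L where L: "L < top" "\<And>I S F f. I \<in> sets borel \<Longrightarrow>
    (\<forall>k\<in>S. \<forall>u. x k \<le> u \<and> u < x (k + 1) \<longrightarrow> u \<in> I \<and> f k \<le> F u) \<Longrightarrow> lq q S f \<le> L * log_norm q I F"
    using sample_lower[OF x q] by blast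
  define B where "B = ennreal (C * exp (c * (3 * ln M)))"
  \<comment> \<open>The summand 1 makes \<open>K\<close> invertible also if \<open>B * D = 0\<close>.\<close>
  define K where "K = 1 + B * D"
  have K: "K < top" "B * D \<le> K" using D by (simp_all add: K_def B_def ennreal_mult_less_top)
  have inv: "K * inverse K = 1" using K(1) ennreal_divide_self[of K] by (simp add: K_def divide_ennreal_def)
  have up: "log_norm q I (\<lambda>u. ennreal (b u) * G u) \<le> U * K * lq q S (\<lambda>k. ennreal (b (x k)) * g k)"
    if b: "moderate C c b" and I: "I \<in> sets borel" "I \<subseteq> {0<..}"
      and G: "\<forall>u\<in>I. \<forall>k. u \<in> cell x k \<longrightarrow> k \<in> S \<and> G u \<le> D * g k" for b I S G g
  proof -
    have "log_norm q I (\<lambda>u. ennreal (b u) * G u) \<le> U * lq q S (\<lambda>k. K * (ennreal (b (x k)) * g k))"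
    proof (intro U I ballI)
      fix u assume u: "u \<in> I"
      then obtain k where k: "x k \<le> u" "u < x (k + 1)" using grid_cover[OF x, of u] I by auto
      then have S: "k \<in> S" "G u \<le> D * g k" using G u by auto
      have "ennreal (b u) * G u \<le> (B * ennreal (b (x k))) * (D * g k)"
        using moderate_cell(1)[OF x b k, of 0] S by (intro mult_mono) (auto simp: B_def)
      also have "\<dots> = B * D * (ennreal (b (x k)) * g k)" by (simp add: mult_ac)
      also have "\<dots> \<le> K * (ennreal (b (x k)) * g k)" by (intro mult_right_mono K) simp
      finally show "\<exists>k\<in>S. x k \<le> u \<and> u < x (k + 1) \<and> ennreal (b u) * G u \<le> K * (ennreal (b (x k)) * g k)"
        using k S by blast
    qed
    then show ?thesis by (simp add: lq_cmult[OF q] mult.assoc)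
  qed
  have lo: "lq q S (\<lambda>k. ennreal (b (x (k + i))) * g (k + i)) \<le> L * K * log_norm q I (\<lambda>u. ennreal (b u) * G u)"
    if b: "moderate C c b" and I: "I \<in> sets borel" and i: "\<bar>i\<bar> \<le> 2"
      and G: "\<forall>k\<in>S. \<forall>u\<in>cell x k. u \<in> I \<and> g (k + i) \<le> D * G u" for b I S G g i
  proof -
    have "lq q S (\<lambda>k. inverse K * (ennreal (b (x (k + i))) * g (k + i))) \<le> L * log_norm q I (\<lambda>u. ennreal (b u) * G u)"
    proof (intro L I ballI allI impI conjI)
      fix k u assume k: "k \<in> S" "x k \<le> u \<and> u < x (k + 1)"
      then have g: "u \<in> I" "g (k + i) \<le> D * G u" using G by auto
      then show "u \<in> I" by simp
      have "ennreal (b (x (k + i))) * g (k + i) \<le> (B * ennreal (b u)) * (D * G u)"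
        using moderate_cell(2)[OF x b, of k u i] k i g by (intro mult_mono) (auto simp: B_def)
      also have "\<dots> = B * D * (ennreal (b u) * G u)" by (simp add: mult_ac)
      also have "\<dots> \<le> K * (ennreal (b u) * G u)" by (intro mult_right_mono K) simp
      finally have "inverse K * (ennreal (b (x (k + i))) * g (k + i)) \<le> inverse K * (K * (ennreal (b u) * G u))"
        by (rule mult_left_mono) simp
      then show "inverse K * (ennreal (b (x (k + i))) * g (k + i)) \<le> ennreal (b u) * G u"
        using inv by (simp only: mult.assoc[symmetric] mult.commute[of "inverse K"]) simp
    qed
    then have "K * (inverse K * lq q S (\<lambda>k. ennreal (b (x (k + i))) * g (k + i)))
        \<le> K * (L * log_norm q I (\<lambda>u. ennreal (b u) * G u))"
      unfolding lq_cmult[OF q] by (rule mult_left_mono) simp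
    then show ?thesis by (simp only: mult.assoc[symmetric] inv mult.commute[of K L] mult_1_left)
  qed
  have "weighted_sampling q x C c D (U * K + L * K)"
    unfolding weighted_sampling_def
  proof (intro conjI allI impI)
    show "U * K + L * K < top" using U(1) L(1) K(1) by (simp add: ennreal_mult_less_top)
  qed (rule order_trans[OF up], assumption+, rule mult_right_mono, simp, simp,
      rule order_trans[OF lo], assumption+, rule mult_right_mono, simp, simp)
  then show ?thesis ..
qed

lemma weighted_upper:
  assumes "weighted_sampling q x C c D E" "moderate C c b" "I \<in> sets borel" "I \<subseteq> {0<..}"
    "\<And>u k. u \<in> I \<Longrightarrow> u \<in> cell x k \<Longrightarrow> k \<in> S \<and> G u \<le> D * g k"
  shows "log_norm q I (\<lambda>u. ennreal (b u) * G u) \<le> E * lq q S (\<lambda>k. ennreal (b (x k)) * g k)"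
  by (rule assms(1)[unfolded weighted_sampling_def, THEN conjunct2, THEN conjunct1, rule_format, OF assms(2-4)])
     (rule assms(5))

lemma weighted_lower:
  assumes "weighted_sampling q x C c D E" "moderate C c b" "I \<in> sets borel" "\<bar>i\<bar> \<le> 2"
    "\<And>k u. k \<in> S \<Longrightarrow> u \<in> cell x k \<Longrightarrow> u \<in> I \<and> g (k + i) \<le> D * G u"
  shows "lq q S (\<lambda>k. ennreal (b (x (k + i))) * g (k + i)) \<le> E * log_norm q I (\<lambda>u. ennreal (b u) * G u)"
  by (rule assms(1)[unfolded weighted_sampling_def, THEN conjunct2, THEN conjunct2, rule_format, OF assms(2-4)])
     (rule assms(5))

lemma weighted_finite: "weighted_sampling q x C c D E \<Longrightarrow> E < top"
  by (simp add: weighted_sampling_def)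

lemma plain_upper:
  assumes "weighted_sampling q x C c 1 E" "moderate C c F" "I \<in> sets borel" "I \<subseteq> {0<..}"
    "\<And>u k. u \<in> I \<Longrightarrow> u \<in> cell x k \<Longrightarrow> k \<in> S"
  shows "log_norm q I (\<lambda>u. ennreal (F u)) \<le> E * lq q S (\<lambda>k. ennreal (F (x k)))"
  using weighted_upper[OF assms(1-4), of S "\<lambda>_. 1" "\<lambda>_. 1"] assms(5) by simp

lemma plain_lower:
  assumes "weighted_sampling q x C c 1 E" "moderate C c F" "I \<in> sets borel" "\<bar>i\<bar> \<le> 2"
    "\<And>k u. k \<in> S \<Longrightarrow> u \<in> cell x k \<Longrightarrow> u \<in> I"
  shows "lq q S (\<lambda>k. ennreal (F (x (k + i)))) \<le> E * log_norm q I (\<lambda>u. ennreal (F u))"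
  using weighted_lower[OF assms(1-4), of S "\<lambda>_. 1" "\<lambda>_. 1"] assms(5) by simp

text \<open>The upper limit \<open>k + 1\<close> in the second bound leaves room for one more shift in iterated norms.\<close>

lemma sampled_left:
  assumes x: "grid x M" and q: "0 < q"
  shows "\<exists>D<top. \<forall>F k t. moderate C c F \<longrightarrow> x k \<le> t \<longrightarrow> t < x (k + 1) \<longrightarrow>
    log_norm q {0<..<t} (\<lambda>u. ennreal (F u)) \<le> D * lq q {..k} (\<lambda>j. ennreal (F (x j))) \<and>
    lq q {..k + 1} (\<lambda>j. ennreal (F (x j))) \<le> D * log_norm q {0<..<t} (\<lambda>u. ennreal (F u))"
proof -
  obtain E where E: "weighted_sampling q x C c 1 E" using weighted_sampling_exists[OF x q, of 1] by auto
  show ?thesis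
  proof (intro exI[of _ E] conjI allI impI weighted_finite[OF E])
    fix F k t assume F: "moderate C c F" and t: "x k \<le> t" "t < x (k + 1)"
    show "log_norm q {0<..<t} (\<lambda>u. ennreal (F u)) \<le> E * lq q {..k} (\<lambda>j. ennreal (F (x j)))"
      by (rule plain_upper[OF E F]) (use grid_index_less[OF x, of _ _ k] t in force)+
    have "lq q {..k - 1} (\<lambda>j. ennreal (F (x (j + 2)))) \<le> E * log_norm q {0<..<t} (\<lambda>u. ennreal (F u))"
    proof (rule plain_lower[OF E F])
      fix j u assume "j \<in> {..k - 1}" "u \<in> cell x j"
      then show "u \<in> {0<..<t}" using grid_mono[OF x, of "j + 1" k] grid_near(2)[OF x, of j u 0] t by auto
    qed auto
    then show "lq q {..k + 1} (\<lambda>j. ennreal (F (x j))) \<le> E * log_norm q {0<..<t} (\<lambda>u. ennreal (F u))"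
      using lq_shift_atMost[of q "k - 1" 2] by (simp add: algebra_simps)
  qed
qed

lemma sampled_right:
  assumes x: "grid x M" and q: "0 < q"
  shows "\<exists>D<top. \<forall>F k t. moderate C c F \<longrightarrow> x k \<le> t \<longrightarrow> t < x (k + 1) \<longrightarrow>
    log_norm q {t<..} (\<lambda>u. ennreal (F u))
      \<asymp>[D] lq q {k..} (\<lambda>j. ennreal (F (x j)))"
proof -
  obtain E where E: "weighted_sampling q x C c 1 E" using weighted_sampling_exists[OF x q, of 1] by auto
  show ?thesis
  proof (intro exI[of _ E] conjI allI impI weighted_finite[OF E])
    fix F k t assume F: "moderate C c F" and t: "x k \<le> t" "t < x (k + 1)"
    have t0: "0 < t" using grid_near(2)[OF x t, of 0] by simp
    show "log_norm q {t<..} (\<lambda>u. ennreal (F u)) \<le> E * lq q {k..} (\<lambda>j. ennreal (F (x j)))"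
      by (rule plain_upper[OF E F]) (use grid_index_less[OF x, of k] t t0 in force)+
    have "lq q {k + 1..} (\<lambda>j. ennreal (F (x (j + -1)))) \<le> E * log_norm q {t<..} (\<lambda>u. ennreal (F u))"
    proof (rule plain_lower[OF E F])
      fix j u assume "j \<in> {k + 1..}" "u \<in> cell x j"
      then show "u \<in> {t<..}" using grid_mono[OF x, of "k + 1" j] t by auto
    qed auto
    then show "lq q {k..} (\<lambda>j. ennreal (F (x j))) \<le> E * log_norm q {t<..} (\<lambda>u. ennreal (F u))"
      using lq_shift_atLeast[of q "k + 1" "-1"] by simp
  qed
qed

lemma sampled_full:
  assumes x: "grid x M" and q: "0 < q"
  shows "\<exists>D<top. \<forall>F. moderate C c F \<longrightarrow>
    log_norm q {0<..} (\<lambda>u. ennreal (F u))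
      \<asymp>[D] lq q UNIV (\<lambda>j. ennreal (F (x j)))"
proof -
  obtain E where E: "weighted_sampling q x C c 1 E" using weighted_sampling_exists[OF x q, of 1] by auto
  show ?thesis
    using plain_upper[OF E, of _ "{0<..}" UNIV] plain_lower[OF E, of _ "{0<..}" 0 UNIV] grid_near(2)[OF x, of _ _ 0]
    by (intro exI[of _ E] conjI allI impI weighted_finite[OF E]) auto
qed

text \<open>If \<open>t\<close> and \<open>s\<close> lie in neighbouring cells, no cell need fit between them; hence the lower bound loses
  two indices.  They are recovered by a shift in the outer norm.\<close>

lemma sampled_middle:
  assumes x: "grid x M" and q: "0 < q"
  shows "\<exists>D<top. \<forall>F k m t s. moderate C c F \<longrightarrow> t \<in> cell x k \<longrightarrow> s \<in> cell x m \<longrightarrow>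
    log_norm q {t<..<s} (\<lambda>u. ennreal (F u)) \<le> D * lq q {k..m} (\<lambda>j. ennreal (F (x j))) \<and>
    lq q {k..m - 2} (\<lambda>j. ennreal (F (x j))) \<le> D * log_norm q {t<..<s} (\<lambda>u. ennreal (F u))"
proof -
  obtain E where E: "weighted_sampling q x C c 1 E" using weighted_sampling_exists[OF x q, of 1] by auto
  show ?thesis
  proof (intro exI[of _ E] conjI allI impI weighted_finite[OF E])
    fix F k m t s assume F: "moderate C c F" and t: "t \<in> cell x k" and s: "s \<in> cell x m"
    have t0: "0 < t" using grid_near(2)[OF x, of k t 0] t by simp
    show "log_norm q {t<..<s} (\<lambda>u. ennreal (F u)) \<le> E * lq q {k..m} (\<lambda>j. ennreal (F (x j)))"
    proof (rule plain_upper[OF E F])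
      fix u j assume "u \<in> {t<..<s}" "u \<in> cell x j"
      then have "x k \<le> u" "u < x (j + 1)" "x j \<le> u" "u < x (m + 1)" using t s by auto
      then show "j \<in> {k..m}" using grid_index_less[OF x] by auto
    qed (use t0 in auto)
    have "lq q {k + 1..m - 1} (\<lambda>j. ennreal (F (x (j + -1)))) \<le> E * log_norm q {t<..<s} (\<lambda>u. ennreal (F u))"
    proof (rule plain_lower[OF E F])
      fix j u assume "j \<in> {k + 1..m - 1}" "u \<in> cell x j"
      then show "u \<in> {t<..<s}" using grid_mono[OF x, of "k + 1" j] grid_mono[OF x, of "j + 1" m] t s by auto
    qed auto
    then show "lq q {k..m - 2} (\<lambda>j. ennreal (F (x j))) \<le> E * log_norm q {t<..<s} (\<lambda>u. ennreal (F u))"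
      using lq_shift_Icc[of q "k + 1" "-1" "m - 1"] by simp
  qed
qed

text \<open>The shift \<open>i = 1\<close> in the lower bound serves integration over \<open>(0, t)\<close>, whose last cell is incomplete.\<close>

lemma sampled_nested_left:
  assumes x: "grid x M" and q: "0 < q" and r: "0 < r" and b: "moderate C' c' b"
  shows "\<exists>D<top. \<forall>F. moderate C c F \<longrightarrow>
    (\<forall>I S. I \<in> sets borel \<longrightarrow> I \<subseteq> {0<..} \<longrightarrow> (\<forall>u\<in>I. \<forall>k. u \<in> cell x k \<longrightarrow> k \<in> S) \<longrightarrow>
      log_norm r I (\<lambda>t. ennreal (b t) * log_norm q {0<..<t} (\<lambda>u. ennreal (F u)))
      \<le> D * lq r S (\<lambda>m. ennreal (b (x m)) * lq q {..m} (\<lambda>j. ennreal (F (x j))))) \<and>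
    (\<forall>I S i. I \<in> sets borel \<longrightarrow> i \<in> {0, 1} \<longrightarrow> (\<forall>k\<in>S. cell x k \<subseteq> I) \<longrightarrow>
      lq r S (\<lambda>m. ennreal (b (x (m + i))) * lq q {..m + i} (\<lambda>j. ennreal (F (x j))))
      \<le> D * log_norm r I (\<lambda>t. ennreal (b t) * log_norm q {0<..<t} (\<lambda>u. ennreal (F u))))"
proof -
  obtain D where D: "D < top" "\<And>F k t. moderate C c F \<Longrightarrow> x k \<le> t \<Longrightarrow> t < x (k + 1) \<Longrightarrow>
    log_norm q {0<..<t} (\<lambda>u. ennreal (F u)) \<le> D * lq q {..k} (\<lambda>j. ennreal (F (x j))) \<and>
    lq q {..k + 1} (\<lambda>j. ennreal (F (x j))) \<le> D * log_norm q {0<..<t} (\<lambda>u. ennreal (F u))"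
    using sampled_left[OF x q, of C c] by blast
  obtain E where E: "weighted_sampling r x C' c' D E" using weighted_sampling_exists[OF x r D(1)] by auto
  show ?thesis
  proof (intro exI[of _ E] conjI allI impI weighted_finite[OF E])
    fix F I S and i :: int assume F: "moderate C c F" and I: "I \<in> sets borel" and i: "i \<in> {0, 1}" and S: "\<forall>k\<in>S. cell x k \<subseteq> I"
    let ?g = "\<lambda>m. lq q {..m} (\<lambda>j. ennreal (F (x j)))"
    show "lq r S (\<lambda>m. ennreal (b (x (m + i))) * ?g (m + i))
      \<le> E * log_norm r I (\<lambda>t. ennreal (b t) * log_norm q {0<..<t} (\<lambda>u. ennreal (F u)))"
    proof (rule weighted_lower[OF E b I, where g="?g"])
      fix k t assume k: "k \<in> S" "t \<in> cell x k"
      have "?g (k + i) \<le> ?g (k + 1)" using i by (intro lq_mono q) auto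
      also have "\<dots> \<le> D * log_norm q {0<..<t} (\<lambda>u. ennreal (F u))" using k D(2)[OF F, of k t] by auto
      finally show "t \<in> I \<and> ?g (k + i) \<le> D * log_norm q {0<..<t} (\<lambda>u. ennreal (F u))" using k S by blast
    qed (use i in auto)
  next
    fix F I S assume F: "moderate C c F" and "I \<in> sets borel" "I \<subseteq> {0<..}" "\<forall>u\<in>I. \<forall>k. u \<in> cell x k \<longrightarrow> k \<in> S"
    then show "log_norm r I (\<lambda>t. ennreal (b t) * log_norm q {0<..<t} (\<lambda>u. ennreal (F u)))
      \<le> E * lq r S (\<lambda>m. ennreal (b (x m)) * lq q {..m} (\<lambda>j. ennreal (F (x j))))"
      using D(2)[OF F] by (intro weighted_upper[OF E b]) auto
  qed
qed

lemma sampled_nested_right: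
  assumes x: "grid x M" and q: "0 < q" and r: "0 < r" and b: "moderate C' c' b"
  shows "\<exists>D<top. \<forall>F k t. moderate C c F \<longrightarrow> t \<in> cell x k \<longrightarrow>
    log_norm r {t<..} (\<lambda>u. ennreal (b u) * log_norm q {t<..<u} (\<lambda>v. ennreal (F v)))
      \<asymp>[D] lq r {k..} (\<lambda>m. ennreal (b (x m)) * lq q {k..m} (\<lambda>j. ennreal (F (x j))))"
proof -
  obtain D where D: "D < top" "\<And>F k m t s. moderate C c F \<Longrightarrow> t \<in> cell x k \<Longrightarrow> s \<in> cell x m \<Longrightarrow>
    log_norm q {t<..<s} (\<lambda>u. ennreal (F u)) \<le> D * lq q {k..m} (\<lambda>j. ennreal (F (x j))) \<and>
    lq q {k..m - 2} (\<lambda>j. ennreal (F (x j))) \<le> D * log_norm q {t<..<s} (\<lambda>u. ennreal (F u))"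
    using sampled_middle[OF x q, of C c] by blast
  obtain E where E: "weighted_sampling r x C' c' D E" using weighted_sampling_exists[OF x r D(1)] by auto
  show ?thesis
  proof (intro exI[of _ E] conjI allI impI weighted_finite[OF E])
    fix F k t assume F: "moderate C c F" and t: "t \<in> cell x k"
    let ?g = "\<lambda>m. lq q {k..m} (\<lambda>j. ennreal (F (x j)))" and ?G = "\<lambda>u. log_norm q {t<..<u} (\<lambda>v. ennreal (F v))"
    have t0: "0 < t" using grid_near(2)[OF x, of k t 0] t by simp
    show "log_norm r {t<..} (\<lambda>u. ennreal (b u) * ?G u) \<le> E * lq r {k..} (\<lambda>m. ennreal (b (x m)) * ?g m)"
    proof (rule weighted_upper[OF E b])
      fix u m assume u: "u \<in> {t<..}" "u \<in> cell x m"
      then show "m \<in> {k..} \<and> ?G u \<le> D * ?g m" using grid_index_less[OF x, of k u m] D(2)[OF F t u(2)] t by auto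
    qed (use t0 in auto)
    have "lq r {k + 2..} (\<lambda>m. ennreal (b (x (m + -2))) * ?g (m + -2)) \<le> E * log_norm r {t<..} (\<lambda>u. ennreal (b u) * ?G u)"
    proof (rule weighted_lower[OF E b, where g="?g"])
      fix m u assume m: "m \<in> {k + 2..}" "u \<in> cell x m"
      then have "x (k + 1) \<le> x m" by (intro grid_mono[OF x]) auto
      then show "u \<in> {t<..} \<and> ?g (m + -2) \<le> D * ?G u" using D(2)[OF F t m(2)] m t by auto
    qed auto
    then show "lq r {k..} (\<lambda>m. ennreal (b (x m)) * ?g m) \<le> E * log_norm r {t<..} (\<lambda>u. ennreal (b u) * ?G u)"
      using lq_shift_atLeast[of r "k + 2" "-2" "\<lambda>m. ennreal (b (x m)) * ?g m"] by simp
  qed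
qed

lemma sampled_nested_LR:
  assumes x: "grid x M" and q: "0 < q" and r: "0 < r" and p: "0 < p"
    and b: "moderate C' c' b" and d: "moderate C'' c'' d"
  shows "\<exists>D<top. \<forall>F. moderate C c F \<longrightarrow>
    log_norm p {0<..} (\<lambda>t. ennreal (d t) * log_norm r {t<..} (\<lambda>u. ennreal (b u) * log_norm q {t<..<u} (\<lambda>v. ennreal (F v))))
      \<asymp>[D] lq p UNIV (\<lambda>k. ennreal (d (x k)) * lq r {k..} (\<lambda>m. ennreal (b (x m)) * lq q {k..m} (\<lambda>j. ennreal (F (x j)))))"
proof -
  let ?H = "\<lambda>F t. log_norm r {t<..} (\<lambda>u. ennreal (b u) * log_norm q {t<..<u} (\<lambda>v. ennreal (F v)))"
  let ?h = "\<lambda>F k. lq r {k..} (\<lambda>m. ennreal (b (x m)) * lq q {k..m} (\<lambda>j. ennreal (F (x j))))"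
  obtain D where D: "D < top" "\<And>F k t. moderate C c F \<Longrightarrow> t \<in> cell x k \<Longrightarrow> ?H F t \<asymp>[D] ?h F k"
    using sampled_nested_right[OF x q r b, of C c] by blast
  obtain E where E: "weighted_sampling p x C'' c'' D E" using weighted_sampling_exists[OF x p D(1)] by auto
  show ?thesis
  proof (intro exI[of _ E] conjI allI impI weighted_finite[OF E])
    fix F assume F: "moderate C c F"
    show "log_norm p {0<..} (\<lambda>t. ennreal (d t) * ?H F t) \<le> E * lq p UNIV (\<lambda>k. ennreal (d (x k)) * ?h F k)"
      using D(2)[OF F] by (intro weighted_upper[OF E d]) auto
    show "lq p UNIV (\<lambda>k. ennreal (d (x k)) * ?h F k) \<le> E * log_norm p {0<..} (\<lambda>t. ennreal (d t) * ?H F t)"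
      using weighted_lower[OF E d, of "{0<..}" 0 UNIV "?h F" "?H F"] D(2)[OF F] grid_near(2)[OF x, of _ _ 0] by auto
  qed
qed

section \<open>Slowly varying functions\<close>

text \<open>Slow variation in logarithmic form, a Potter bound.  In this form closure under products, powers and
  composition is closure under addition, scaling and substitution.\<close>

definition slow :: "(real \<Rightarrow> real) \<Rightarrow> bool" where
  "slow b \<longleftrightarrow> (\<forall>t>0. 0 < b t) \<and>
     (\<forall>\<epsilon>>0. \<exists>L. \<forall>s>0. \<forall>t>0. \<bar>ln (b s) - ln (b t)\<bar> \<le> L + \<epsilon> * \<bar>ln s - ln t\<bar>)"

lemma slow_pos: "slow b \<Longrightarrow> 0 < t \<Longrightarrow> 0 < b t"
  by (auto simp: slow_def)

lemma slowD:
  assumes "slow b" "0 < \<epsilon>"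
  obtains L where "0 \<le> L" "\<And>s t. 0 < s \<Longrightarrow> 0 < t \<Longrightarrow> \<bar>ln (b s) - ln (b t)\<bar> \<le> L + \<epsilon> * \<bar>ln s - ln t\<bar>"
proof -
  have "\<exists>L. \<forall>s>0. \<forall>t>0. \<bar>ln (b s) - ln (b t)\<bar> \<le> L + \<epsilon> * \<bar>ln s - ln t\<bar>"
    using assms by (simp add: slow_def)
  then obtain L where L: "\<forall>s>0. \<forall>t>0. \<bar>ln (b s) - ln (b t)\<bar> \<le> L + \<epsilon> * \<bar>ln s - ln t\<bar>"
    by blast
  have "0 \<le> L" using L[rule_format, of 1 1] by simp
  then show thesis using L by (intro that[of L]) auto
qed

lemma moderate_of_slow:
  assumes "slow b" "0 < \<epsilon>"
  obtains C where "moderate C \<epsilon> b"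
proof -
  obtain L where L: "\<And>s t. 0 < s \<Longrightarrow> 0 < t \<Longrightarrow> \<bar>ln (b s) - ln (b t)\<bar> \<le> L + \<epsilon> * \<bar>ln s - ln t\<bar>"
    using slowD[OF assms] by blast
  have "b s \<le> exp L * exp (\<epsilon> * \<bar>ln s - ln t\<bar>) * b t" if "0 < s" "0 < t" for s t
  proof -
    have "exp (ln (b s)) \<le> exp (L + \<epsilon> * \<bar>ln s - ln t\<bar> + ln (b t))"
      using L[OF that] by simp
    then show ?thesis using that slow_pos[OF assms(1)] by (simp add: exp_add)
  qed
  then have "moderate (exp L) \<epsilon> b"
    using slow_pos[OF assms(1)] assms(2) by (auto simp: moderate_def less_imp_le)
  then show thesis by (rule that)
qed

lemma slow_of_moderate:
  assumes pos: "\<And>t. 0 < t \<Longrightarrow> 0 < b t" and m: "\<And>\<epsilon>. 0 < \<epsilon> \<Longrightarrow> \<exists>C. moderate C \<epsilon> b"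
  shows "slow b"
  unfolding slow_def
proof (intro conjI allI impI pos)
  fix \<epsilon> :: real assume "0 < \<epsilon>"
  then obtain C where C: "moderate C \<epsilon> b" using m by blast
  have *: "ln (b s) - ln (b t) \<le> ln C + \<epsilon> * \<bar>ln s - ln t\<bar>" if "0 < s" "0 < t" for s t
  proof -
    have "0 < C" using C by (simp add: moderate_def)
    have "ln (b s) \<le> ln (C * exp (\<epsilon> * \<bar>ln s - ln t\<bar>) * b t)"
      using moderateD(1)[OF C that] pos that by (intro ln_mono) auto
    then show ?thesis using \<open>0 < C\<close> pos[OF that(2)] by (simp add: ln_mult)
  qed
  show "\<exists>L. \<forall>s>0. \<forall>t>0. \<bar>ln (b s) - ln (b t)\<bar> \<le> L + \<epsilon> * \<bar>ln s - ln t\<bar>"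
    using * by (intro exI[of _ "ln C"]) (smt (verit) abs_minus_commute)
qed

text \<open>Two points are compared through the increasing function equivalent to \<open>t powr \<epsilon> * b t\<close> in one direction,
  and through the decreasing one in the other.\<close>

lemma SV_slow:
  assumes "b \<in> SV" shows "slow b"
proof (rule slow_of_moderate)
  show pos: "0 < b t" if "0 < t" for t using assms that by (simp add: SV_def)
  fix \<epsilon> :: real assume \<epsilon>: "0 < \<epsilon>"
  obtain g where g: "mono_on {0<..} g" "equivalent_on_pos (\<lambda>t. t powr \<epsilon> * b t) g"
    using assms \<epsilon> by (auto simp: SV_def)
  obtain h where h: "antimono_on {0<..} h" "equivalent_on_pos (\<lambda>t. t powr - \<epsilon> * b t) h"
    using assms \<epsilon> by (auto simp: SV_def)
  obtain C where C: "0 < C" "\<And>t. 0 < t \<Longrightarrow> inverse C * g t \<le> t powr \<epsilon> * b t \<and> t powr \<epsilon> * b t \<le> C * g t"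
    using g(2) by (auto simp: equivalent_on_pos_def)
  obtain D where D: "0 < D" "\<And>t. 0 < t \<Longrightarrow> inverse D * h t \<le> t powr - \<epsilon> * b t \<and> t powr - \<epsilon> * b t \<le> D * h t"
    using h(2) by (auto simp: equivalent_on_pos_def)
  have up: "b t \<le> C * C * exp (\<epsilon> * (ln s - ln t)) * b s" if "0 < t" "t \<le> s" for s t
  proof -
    have s: "0 < s" using that by simp
    have "t powr \<epsilon> * b t \<le> C * g t" using C that by blast
    also have "\<dots> \<le> C * g s" using monotone_onD[OF g(1)] that s C(1) by (intro mult_left_mono) auto
    also have "g s \<le> C * (s powr \<epsilon> * b s)" using C(1) C(2)[OF s] by (simp add: field_simps)
    finally have "t powr \<epsilon> * b t \<le> C * (C * (s powr \<epsilon> * b s))" using C(1) by simp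
    then show ?thesis using that s
      by (simp add: powr_def right_diff_distrib exp_diff field_simps)
  qed
  have down: "b s \<le> D * D * exp (\<epsilon> * (ln s - ln t)) * b t" if "0 < t" "t \<le> s" for s t
  proof -
    have s: "0 < s" using that by simp
    have "s powr - \<epsilon> * b s \<le> D * h s" using D s by blast
    also have "\<dots> \<le> D * h t" using monotone_onD[OF h(1)] that s D(1) by (intro mult_left_mono) auto
    also have "h t \<le> D * (t powr - \<epsilon> * b t)" using D(1) D(2)[OF that(1)] by (simp add: field_simps)
    finally have "s powr - \<epsilon> * b s \<le> D * (D * (t powr - \<epsilon> * b t))" using D(1) by simp
    then show ?thesis using that s
      by (simp add: powr_def right_diff_distrib exp_diff exp_minus field_simps)
  qed
  have "b s \<le> (C * C + D * D) * exp (\<epsilon> * \<bar>ln s - ln t\<bar>) * b t" if "0 < s" "0 < t" for s t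
  proof (cases "t \<le> s")
    case True
    have "b s \<le> D * D * exp (\<epsilon> * (ln s - ln t)) * b t" by (rule down[OF that(2) True])
    also have "\<dots> \<le> (C * C + D * D) * exp (\<epsilon> * (ln s - ln t)) * b t"
      using pos[OF that(2)] by (intro mult_right_mono) auto
    also have "ln s - ln t = \<bar>ln s - ln t\<bar>" using True that by simp
    finally show ?thesis .
  next
    case False
    have "b s \<le> C * C * exp (\<epsilon> * (ln t - ln s)) * b t" using False by (intro up that) auto
    also have "\<dots> \<le> (C * C + D * D) * exp (\<epsilon> * (ln t - ln s)) * b t"
      using pos[OF that(2)] by (intro mult_right_mono) auto
    also have "ln t - ln s = \<bar>ln s - ln t\<bar>" using False that by simp
    finally show ?thesis .
  qed
  then show "\<exists>C. moderate C \<epsilon> b"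
    using pos \<epsilon> C(1) D(1) by (intro exI[of _ "C * C + D * D"]) (auto simp: moderate_def less_imp_le add_pos_pos)
qed

lemma slow_mult:
  assumes "slow a" "slow b" shows "slow (\<lambda>t. a t * b t)"
  unfolding slow_def
proof (intro conjI allI impI)
  fix t :: real assume "0 < t" then show "0 < a t * b t" using assms slow_pos by simp
next
  fix \<epsilon> :: real assume "0 < \<epsilon>"
  then have e: "0 < \<epsilon> / 2" by simp
  obtain L L' where "\<And>s t. 0 < s \<Longrightarrow> 0 < t \<Longrightarrow> \<bar>ln (a s) - ln (a t)\<bar> \<le> L + \<epsilon>/2 * \<bar>ln s - ln t\<bar>"
    "\<And>s t. 0 < s \<Longrightarrow> 0 < t \<Longrightarrow> \<bar>ln (b s) - ln (b t)\<bar> \<le> L' + \<epsilon>/2 * \<bar>ln s - ln t\<bar>"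
    using slowD[OF assms(1) e] slowD[OF assms(2) e] by metis
  then have "\<bar>ln (a s * b s) - ln (a t * b t)\<bar> \<le> (L + L') + \<epsilon> * \<bar>ln s - ln t\<bar>" if "0 < s" "0 < t" for s t
    using that slow_pos[OF assms(1)] slow_pos[OF assms(2)] by (simp add: ln_mult) (smt (verit) field_sum_of_halves)
  then show "\<exists>L. \<forall>s>0. \<forall>t>0. \<bar>ln (a s * b s) - ln (a t * b t)\<bar> \<le> L + \<epsilon> * \<bar>ln s - ln t\<bar>"
    by blast
qed

lemma slow_powr:
  assumes "slow b" shows "slow (\<lambda>t. b t powr \<alpha>)"
  unfolding slow_def
proof (intro conjI allI impI)
  fix t :: real assume "0 < t" then show "0 < b t powr \<alpha>" using slow_pos[OF assms, of t] by simp
next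
  fix \<epsilon> :: real assume \<epsilon>: "0 < \<epsilon>"
  define e where "e = \<epsilon> / (\<bar>\<alpha>\<bar> + 1)"
  have e: "0 < e" "\<bar>\<alpha>\<bar> * e \<le> \<epsilon>" using \<epsilon> by (auto simp: e_def field_simps)
  obtain L where L: "\<And>s t. 0 < s \<Longrightarrow> 0 < t \<Longrightarrow> \<bar>ln (b s) - ln (b t)\<bar> \<le> L + e * \<bar>ln s - ln t\<bar>"
    using slowD[OF assms e(1)] by metis
  have "\<bar>ln (b s powr \<alpha>) - ln (b t powr \<alpha>)\<bar> \<le> \<bar>\<alpha>\<bar> * L + \<epsilon> * \<bar>ln s - ln t\<bar>" if "0 < s" "0 < t" for s t
  proof -
    have "\<bar>ln (b s powr \<alpha>) - ln (b t powr \<alpha>)\<bar> = \<bar>\<alpha>\<bar> * \<bar>ln (b s) - ln (b t)\<bar>"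
      using that slow_pos[OF assms] by (simp add: ln_powr abs_mult[symmetric] right_diff_distrib)
    also have "\<dots> \<le> \<bar>\<alpha>\<bar> * (L + e * \<bar>ln s - ln t\<bar>)" using L[OF that] by (intro mult_left_mono) auto
    also have "\<dots> = \<bar>\<alpha>\<bar> * L + (\<bar>\<alpha>\<bar> * e) * \<bar>ln s - ln t\<bar>" by (simp add: algebra_simps)
    also have "\<dots> \<le> \<bar>\<alpha>\<bar> * L + \<epsilon> * \<bar>ln s - ln t\<bar>" using e(2) by (intro add_left_mono mult_right_mono) auto
    finally show ?thesis .
  qed
  then show "\<exists>L. \<forall>s>0. \<forall>t>0. \<bar>ln (b s powr \<alpha>) - ln (b t powr \<alpha>)\<bar> \<le> L + \<epsilon> * \<bar>ln s - ln t\<bar>"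
    by blast
qed

lemma slow_cong:
  assumes "slow a" "\<And>t. 0 < t \<Longrightarrow> b t = a t" shows "slow b"
  using assms by (simp add: slow_def)

lemma slow_divide:
  assumes "slow a" "slow b" shows "slow (\<lambda>t. a t / b t)"
proof -
  have s: "slow (\<lambda>t. a t * b t powr - 1)" by (intro slow_mult slow_powr assms)
  show ?thesis
  proof (rule slow_cong[OF s])
    fix t :: real assume "0 < t"
    then show "a t / b t = a t * b t powr - 1"
      using slow_pos[OF assms(2), of t] by (simp add: powr_minus_divide)
  qed
qed

text \<open>The logarithm of a quasi-power is Lipschitz up to an additive constant in \<open>ln t\<close>.\<close>

lemma slow_comp:
  assumes a: "slow a" and b: "slow b"
  shows "slow (a \<circ> (\<lambda>t. t powr \<alpha> * b t))"
  unfolding slow_def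
proof (intro conjI allI impI)
  let ?\<phi> = "\<lambda>t. t powr \<alpha> * b t"
  have pos: "0 < ?\<phi> t" if "0 < t" for t using slow_pos[OF b that] that by simp
  show "0 < (a \<circ> ?\<phi>) t" if "0 < t" for t using slow_pos[OF a pos[OF that]] by simp
  fix \<epsilon> :: real assume \<epsilon>: "0 < \<epsilon>"
  define e where "e = \<epsilon> / (\<bar>\<alpha>\<bar> + 1)"
  have e: "0 < e" "(\<bar>\<alpha>\<bar> + 1) * e = \<epsilon>" using \<epsilon> by (auto simp: e_def)
  obtain L where L: "\<And>s t. 0 < s \<Longrightarrow> 0 < t \<Longrightarrow> \<bar>ln (a s) - ln (a t)\<bar> \<le> L + e * \<bar>ln s - ln t\<bar>"
    using slowD[OF a e(1)] by metis
  obtain L' where L': "\<And>s t. 0 < s \<Longrightarrow> 0 < t \<Longrightarrow> \<bar>ln (b s) - ln (b t)\<bar> \<le> L' + 1 * \<bar>ln s - ln t\<bar>"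
    using slowD[OF b, of 1] by (metis zero_less_one)
  have "\<bar>ln ((a \<circ> ?\<phi>) s) - ln ((a \<circ> ?\<phi>) t)\<bar> \<le> (L + e * L') + \<epsilon> * \<bar>ln s - ln t\<bar>" if st: "0 < s" "0 < t" for s t
  proof -
    have "\<bar>ln (?\<phi> s) - ln (?\<phi> t)\<bar> = \<bar>\<alpha> * (ln s - ln t) + (ln (b s) - ln (b t))\<bar>"
      using st slow_pos[OF b st(1)] slow_pos[OF b st(2)] by (simp add: ln_mult ln_powr algebra_simps)
    also have "\<dots> \<le> \<bar>\<alpha>\<bar> * \<bar>ln s - ln t\<bar> + \<bar>ln (b s) - ln (b t)\<bar>"
      by (metis abs_mult abs_triangle_ineq)
    also have "\<dots> \<le> L' + (\<bar>\<alpha>\<bar> + 1) * \<bar>ln s - ln t\<bar>" using L'[OF st] by (simp add: algebra_simps)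
    finally have d: "e * \<bar>ln (?\<phi> s) - ln (?\<phi> t)\<bar> \<le> e * (L' + (\<bar>\<alpha>\<bar> + 1) * \<bar>ln s - ln t\<bar>)"
      using e(1) by (intro mult_left_mono) auto
    have "\<bar>ln (a (?\<phi> s)) - ln (a (?\<phi> t))\<bar> \<le> L + e * \<bar>ln (?\<phi> s) - ln (?\<phi> t)\<bar>"
      by (intro L pos st)
    also have "\<dots> \<le> L + e * L' + ((\<bar>\<alpha>\<bar> + 1) * e) * \<bar>ln s - ln t\<bar>" using d by (simp add: algebra_simps)
    finally show ?thesis unfolding e(2) by simp
  qed
  then show "\<exists>L. \<forall>s>0. \<forall>t>0. \<bar>ln ((a \<circ> ?\<phi>) s) - ln ((a \<circ> ?\<phi>) t)\<bar> \<le> L + \<epsilon> * \<bar>ln s - ln t\<bar>"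
    by blast
qed

lemma slow_samples:
  assumes "slow b" "0 < h" "0 < \<epsilon>"
  shows "\<exists>C<top. \<forall>j k. ennreal (b (exp (h * real_of_int k))) \<le> C * geo (- \<epsilon>) j k * ennreal (b (exp (h * real_of_int j)))"
proof -
  obtain C where C: "moderate C (\<epsilon> / h) b" using moderate_of_slow[OF assms(1), of "\<epsilon> / h"] assms by auto
  show ?thesis
  proof (intro exI[of _ "ennreal C"] conjI allI)
    fix j k :: int
    let ?s = "exp (h * real_of_int k)" and ?t = "exp (h * real_of_int j)"
    have e: "\<bar>ln ?s - ln ?t\<bar> = h * \<bar>real_of_int (j - k)\<bar>"
      using assms(2) by (simp add: right_diff_distrib[symmetric] abs_mult abs_minus_commute)
    have "ennreal (b ?s) \<le> ennreal (C * exp (\<epsilon> / h * (h * \<bar>real_of_int (j - k)\<bar>))) * ennreal (b ?t)"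
      using e by (intro moderate_near[OF C]) auto
    also have "ennreal (C * exp (\<epsilon> / h * (h * \<bar>real_of_int (j - k)\<bar>))) = ennreal C * geo (- \<epsilon>) j k"
      using C assms(2) by (simp add: geo_def ennreal_mult moderate_def)
    finally show "ennreal (b ?s) \<le> ennreal C * geo (- \<epsilon>) j k * ennreal (b ?t)" .
  qed simp
qed

section \<open>The function chi\<close>

text \<open>The function \<open>\<chi>\<close> before its conversion to a real number.\<close>

definition chi_ennreal where
  "chi_ennreal r b q a t = nested_sv_norm r b q a t + sv_norm r b {t<..} * sv_norm q a {0<..<t}"

text \<open>The sequence counterpart of \<open>\<chi>\<close>, for samples \<open>b\<close> and \<open>a\<close>.\<close>

definition chi_seq where
  "chi_seq r b q a k = lq r {..k} (\<lambda>m. b m * lq q {..m} a) + lq r {k..} b * lq q {..k} a"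

lemma sv_norm_eq: "I \<in> sets borel \<Longrightarrow> sv_norm q a I = log_norm q I (\<lambda>u. ennreal (a u))"
  unfolding sv_norm_def by (intro Lq_norm_cong) (auto simp: ennreal_mult')

lemma nested_sv_norm_eq:
  "nested_sv_norm r b q a t = log_norm r {0<..<t} (\<lambda>s. ennreal (b s) * log_norm q {0<..<s} (\<lambda>u. ennreal (a u)))"
  unfolding nested_sv_norm_def by (intro Lq_norm_cong) (auto simp: ennreal_mult' sv_norm_eq mult.assoc)

lemma chi_sampled:
  assumes x: "grid x M" and q: "0 < q" and r: "0 < r" and a: "slow a" and b: "slow b"
  shows "\<exists>D<top. \<forall>k t. x k \<le> t \<longrightarrow> t < x (k + 1) \<longrightarrow> chi_ennreal r b q a t
      \<asymp>[D] chi_seq r (\<lambda>m. ennreal (b (x m))) q (\<lambda>m. ennreal (a (x m))) k \<and>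
    lq r {..k} (\<lambda>m. ennreal (b (x m)) * lq q {..m} (\<lambda>m. ennreal (a (x m)))) \<le> D * nested_sv_norm r b q a t \<and>
    lq r {k..} (\<lambda>m. ennreal (b (x m))) \<le> D * sv_norm r b {t<..}"
proof -
  obtain Ca Cb where C: "moderate Ca 1 a" "moderate Cb 1 b"
    using moderate_of_slow[OF a, of 1] moderate_of_slow[OF b, of 1] by (metis zero_less_one)
  obtain DA where DA: "DA < top" "\<And>F k t. moderate Ca 1 F \<Longrightarrow> x k \<le> t \<Longrightarrow> t < x (k + 1) \<Longrightarrow>
    log_norm q {0<..<t} (\<lambda>u. ennreal (F u)) \<le> DA * lq q {..k} (\<lambda>j. ennreal (F (x j))) \<and>
    lq q {..k + 1} (\<lambda>j. ennreal (F (x j))) \<le> DA * log_norm q {0<..<t} (\<lambda>u. ennreal (F u))"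
    using sampled_left[OF x q] by blast
  obtain DB where DB: "DB < top" "\<And>F k t. moderate Cb 1 F \<Longrightarrow> x k \<le> t \<Longrightarrow> t < x (k + 1) \<Longrightarrow> log_norm r {t<..} (\<lambda>u. ennreal (F u))
      \<asymp>[DB] lq r {k..} (\<lambda>j. ennreal (F (x j)))"
    using sampled_right[OF x r] by blast
  obtain DN where DN: "DN < top" "\<forall>F. moderate Ca 1 F \<longrightarrow>
    (\<forall>I S. I \<in> sets borel \<longrightarrow> I \<subseteq> {0<..} \<longrightarrow> (\<forall>u\<in>I. \<forall>k. u \<in> cell x k \<longrightarrow> k \<in> S) \<longrightarrow>
      log_norm r I (\<lambda>t. ennreal (b t) * log_norm q {0<..<t} (\<lambda>u. ennreal (F u)))
      \<le> DN * lq r S (\<lambda>m. ennreal (b (x m)) * lq q {..m} (\<lambda>j. ennreal (F (x j))))) \<and>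
    (\<forall>I S i. I \<in> sets borel \<longrightarrow> i \<in> {0, 1} \<longrightarrow> (\<forall>k\<in>S. cell x k \<subseteq> I) \<longrightarrow>
      lq r S (\<lambda>m. ennreal (b (x (m + i))) * lq q {..m + i} (\<lambda>j. ennreal (F (x j))))
      \<le> DN * log_norm r I (\<lambda>t. ennreal (b t) * log_norm q {0<..<t} (\<lambda>u. ennreal (F u))))"
    by (rule exE[OF sampled_nested_left[OF x q r C(2), of Ca 1]], elim conjE, rule that)
  let ?A = "\<lambda>k. lq q {..k} (\<lambda>m. ennreal (a (x m)))"
  let ?B = "\<lambda>k. lq r {k..} (\<lambda>m. ennreal (b (x m)))"
  let ?N = "\<lambda>k. lq r {..k} (\<lambda>m. ennreal (b (x m)) * ?A m)"
  let ?D = "DN + DB + DB * DA"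
  have "(chi_ennreal r b q a t \<le> ?D * (?N k + ?B k * ?A k) \<and> ?N k + ?B k * ?A k \<le> ?D * chi_ennreal r b q a t) \<and>
     ?N k \<le> ?D * nested_sv_norm r b q a t \<and> ?B k \<le> ?D * sv_norm r b {t<..}"
    if t: "x k \<le> t" "t < x (k + 1)" for k t
  proof -
    let ?a = "sv_norm q a {0<..<t}" and ?b = "sv_norm r b {t<..}" and ?n = "nested_sv_norm r b q a t"
    have A1: "?a \<le> DA * ?A k" using DA(2)[OF C(1) t] by (simp add: sv_norm_eq)
    have "?A k \<le> lq q {..k + 1} (\<lambda>m. ennreal (a (x m)))" by (intro lq_mono q) auto
    also have "\<dots> \<le> DA * ?a" using DA(2)[OF C(1) t] by (simp add: sv_norm_eq)
    finally have A2: "?A k \<le> DA * ?a" .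
    have B1: "?b \<le> DB * ?B k" and B2: "?B k \<le> DB * ?b" using DB(2)[OF C(2) t] by (simp_all add: sv_norm_eq)
    have N1: "?n \<le> DN * ?N k"
      unfolding nested_sv_norm_eq using t grid_index_less[OF x, of _ _ k]
      by (intro DN(2)[THEN spec, THEN mp, OF C(1), THEN conjunct1, rule_format]) force+
    have "?N k = lq r {..k - 1} (\<lambda>m. ennreal (b (x (m + 1))) * ?A (m + 1))"
      using lq_shift_atMost[of r "k - 1" 1 "\<lambda>m. ennreal (b (x m)) * ?A m"] by simp
    also have "\<dots> \<le> DN * ?n"
      unfolding nested_sv_norm_eq
    proof (intro DN(2)[THEN spec, THEN mp, OF C(1), THEN conjunct2, rule_format])
      fix m assume m: "m \<in> {..k - 1}"
      show "cell x m \<subseteq> {0<..<t}"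
        using m t grid_mono[OF x, of "m + 1" k] grid_near(2)[OF x, of m _ 0] by force
    qed auto
    finally have N2: "?N k \<le> DN * ?n" .
    have "chi_ennreal r b q a t \<le> DN * ?N k + (DB * ?B k) * (DA * ?A k)"
      unfolding chi_ennreal_def by (intro add_mono mult_mono A1 B1 N1) auto
    also have "\<dots> = DN * ?N k + (DB * DA) * (?B k * ?A k)" by (simp add: mult_ac)
    also have "\<dots> \<le> ?D * ?N k + ?D * (?B k * ?A k)"
      by (intro add_mono mult_right_mono) (auto simp: add_increasing add_increasing2 add.assoc)
    finally have 1: "chi_ennreal r b q a t \<le> ?D * (?N k + ?B k * ?A k)" by (simp add: distrib_left)
    have "?N k + ?B k * ?A k \<le> DN * ?n + (DB * ?b) * (DA * ?a)"
      by (intro add_mono mult_mono A2 B2 N2) auto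
    also have "\<dots> = DN * ?n + (DB * DA) * (?b * ?a)" by (simp add: mult_ac)
    also have "\<dots> \<le> ?D * ?n + ?D * (?b * ?a)"
      by (intro add_mono mult_right_mono) (auto simp: add_increasing add_increasing2 add.assoc)
    finally have 2: "?N k + ?B k * ?A k \<le> ?D * chi_ennreal r b q a t" by (simp add: distrib_left chi_ennreal_def)
    have 3: "?N k \<le> ?D * ?n"
      by (rule order_trans[OF N2]) (intro mult_right_mono, auto simp: add_increasing2 add.assoc)
    have 4: "?B k \<le> ?D * ?b"
      by (rule order_trans[OF B2]) (intro mult_right_mono, auto simp: add_increasing add_increasing2 add.assoc)
    show ?thesis using 1 2 3 4 by blast
  qed
  then show ?thesis using DA(1) DB(1) DN(1)
    by (intro exI[of _ ?D]) (auto simp: ennreal_mult_less_top chi_seq_def)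
qed

lemma grid_exp:
  assumes "1 \<le> h" shows "grid (\<lambda>k. exp (h * real_of_int k)) (exp h)"
proof -
  have "(2::real) \<le> exp h" using exp_ge_add_one_self[of h] assms by linarith
  then show ?thesis by (auto simp: grid_def distrib_left exp_add)
qed

text \<open>Shifting the grid acts on all three norms in \<open>\<chi>\<close> in the same way, so growth bounds for \<open>a\<close> and \<open>b\<close> pass to
  \<open>\<chi>\<close>.\<close>

lemma chi_seq_shift:
  assumes q: "0 < q" and r: "0 < r"
    and a: "\<And>i. ((\<lambda>j. a (j + i)) :: int \<Rightarrow> ennreal) \<le> (\<lambda>j. G i * a j)"
    and b: "\<And>i. ((\<lambda>j. b (j + i)) :: int \<Rightarrow> ennreal) \<le> (\<lambda>j. G i * b j)"
  shows "chi_seq r b q a (k + i) \<le> G i * G i * chi_seq r b q a k"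
proof -
  have A: "lq q {..m + i} a \<le> G i * lq q {..m} a" for m
    unfolding lq_shift_atMost using a[of i] by (intro lq_le q) (auto simp: le_fun_def)
  have B: "lq r {k + i..} b \<le> G i * lq r {k..} b"
    unfolding lq_shift_atLeast using b[of i] by (intro lq_le r) (auto simp: le_fun_def)
  have N: "lq r {..k + i} (\<lambda>m. b m * lq q {..m} a) \<le> G i * G i * lq r {..k} (\<lambda>m. b m * lq q {..m} a)"
    unfolding lq_shift_atMost[of r]
  proof (intro lq_le r)
    fix m
    have "b (m + i) * lq q {..m + i} a \<le> (G i * b m) * (G i * lq q {..m} a)"
      using b[of i] by (intro mult_mono A) (auto simp: le_fun_def)
    then show "b (m + i) * lq q {..m + i} a \<le> G i * G i * (b m * lq q {..m} a)" by (simp add: mult_ac)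
  qed simp
  have "chi_seq r b q a (k + i) \<le> G i * G i * lq r {..k} (\<lambda>m. b m * lq q {..m} a)
      + (G i * lq r {k..} b) * (G i * lq q {..k} a)"
    unfolding chi_seq_def by (intro add_mono mult_mono N A B) auto
  then show ?thesis by (simp add: chi_seq_def algebra_simps)
qed

text \<open>The two finiteness conditions at 1 propagate to all points of the grid because a slowly varying
  sequence that is finite somewhere is finite everywhere.\<close>

lemma chi_slow:
  assumes q: "0 < q" and r: "0 < r" and a: "slow a" and b: "slow b"
    and fin: "sv_norm r b {1<..} < top" "nested_sv_norm r b q a 1 < top"
  shows "slow (chi r b q a)" "\<And>t. 0 < t \<Longrightarrow> ennreal (chi r b q a t) = chi_ennreal r b q a t"
proof -
  let ?x = "\<lambda>k::int. exp (1 * real_of_int k)"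
  let ?a = "\<lambda>m. ennreal (a (?x m))" and ?b = "\<lambda>m. ennreal (b (?x m))"
  let ?X = "chi_seq r ?b q ?a"
  have x: "grid ?x (exp 1)" by (rule grid_exp) simp
  obtain D where D: "D < top" "\<And>k t. ?x k \<le> t \<Longrightarrow> t < ?x (k + 1) \<Longrightarrow> chi_ennreal r b q a t
      \<asymp>[D] ?X k \<and>
    lq r {..k} (\<lambda>m. ?b m * lq q {..m} ?a) \<le> D * nested_sv_norm r b q a t \<and>
    lq r {k..} ?b \<le> D * sv_norm r b {t<..}"
    using chi_sampled[OF x q r a b] by auto
  have one: "?x 0 \<le> 1" "1 < ?x (0 + 1)" by auto
  have N0: "lq r {..0} (\<lambda>m. ?b m * lq q {..m} ?a) < top"
    using D(2)[OF one] fin(2) D(1) by (auto simp: ennreal_mult_less_top intro: le_less_trans)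
  have B0: "lq r {0..} ?b < top"
    using D(2)[OF one] fin(1) D(1) by (auto simp: ennreal_mult_less_top intro: le_less_trans)
  have pos: "0 < ?a m" "0 < ?b m" for m using slow_pos[OF a] slow_pos[OF b] by simp_all
  have "?b 0 * lq q {..0} ?a \<le> lq r {..0} (\<lambda>m. ?b m * lq q {..m} ?a)"
    by (rule lq_ge_point[where x="\<lambda>m. ?b m * lq q {..m} ?a"]) (auto simp: r)
  then have A0: "lq q {..0} ?a < top"
    using N0 pos(2)[of 0] by (auto simp: ennreal_mult_less_top dest!: le_less_trans)
  have X0: "?X 0 < top" using N0 B0 A0 by (simp add: chi_seq_def ennreal_mult_less_top)
  have Xpos: "0 < ?X k" for k
  proof -
    have "0 < ?b k * ?a k" using pos[of k] by (simp add: ennreal_zero_less_mult_iff)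
    also have "\<dots> \<le> lq r {k..} ?b * lq q {..k} ?a"
      by (intro mult_mono lq_ge_point[where x="?b"] lq_ge_point[where x="?a"] q r) auto
    also have "\<dots> \<le> ?X k" by (simp add: chi_seq_def)
    finally show ?thesis .
  qed
  have shift: "\<exists>C<top. \<forall>k j. ?X j \<le> C * geo (- \<epsilon>) j k * ?X k" if \<epsilon>: "0 < \<epsilon>" for \<epsilon>
  proof -
    obtain C where C: "C < top" "\<And>j k. ?a k \<le> C * geo (- (\<epsilon>/2)) j k * ?a j"
      using slow_samples[OF a, of 1 "\<epsilon>/2"] \<epsilon> by auto
    obtain C' where C': "C' < top" "\<And>j k. ?b k \<le> C' * geo (- (\<epsilon>/2)) j k * ?b j"
      using slow_samples[OF b, of 1 "\<epsilon>/2"] \<epsilon> by auto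
    let ?G = "\<lambda>i. (C + C') * geo (- (\<epsilon>/2)) i 0"
    have g: "geo (- (\<epsilon>/2)) j (j + i) = geo (- (\<epsilon>/2)) i 0" for i j by (simp add: geo_def)
    have "?X j \<le> (C + C') * (C + C') * geo (- \<epsilon>) j k * ?X k" for k j
    proof -
      have "?X (k + (j - k)) \<le> ?G (j - k) * ?G (j - k) * ?X k"
      proof (intro chi_seq_shift q r; rule le_funI)
        fix i m
        have "C * geo (- (\<epsilon>/2)) i 0 * ?a m \<le> ?G i * ?a m" by (intro mult_right_mono) auto
        then show "?a (m + i) \<le> ?G i * ?a m" using C(2)[of "m + i" m] g by (auto intro: order_trans)
        have "C' * geo (- (\<epsilon>/2)) i 0 * ?b m \<le> ?G i * ?b m" by (intro mult_right_mono) auto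
        then show "?b (m + i) \<le> ?G i * ?b m" using C'(2)[of "m + i" m] g by (auto intro: order_trans)
      qed
      also have "?G (j - k) * ?G (j - k) = (C + C') * (C + C') * (geo (- (\<epsilon>/2)) (j - k) 0 * geo (- (\<epsilon>/2)) (j - k) 0)"
        by (simp only: mult_ac)
      also have "\<dots> = (C + C') * (C + C') * geo (- \<epsilon>) j k"
        unfolding geo_mult by (simp add: geo_def)
      finally show ?thesis by simp
    qed
    then show ?thesis using C(1) C'(1)
      by (intro exI[of _ "(C + C') * (C + C')"]) (auto simp: ennreal_mult_less_top)
  qed
  have Xfin: "?X j < top" for j
  proof -
    obtain C where C: "C < top" "\<And>k j. ?X j \<le> C * geo (- 1) j k * ?X k" using shift[of 1] by auto
    then show ?thesis using X0 le_less_trans[OF C(2)[of j 0]] by (simp add: ennreal_mult_less_top geo_def)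
  qed
  have cell: "\<exists>k. ?x k \<le> t \<and> t < ?x (k + 1)" if "0 < t" for t
    using grid_cover[OF x that] by metis
  have chi_pos: "0 < chi_ennreal r b q a t" "chi_ennreal r b q a t < top" if t: "0 < t" for t
  proof -
    obtain k where k: "?x k \<le> t" "t < ?x (k + 1)" using cell[OF t] by blast
    show "chi_ennreal r b q a t < top"
      using D(2)[OF k] Xfin[of k] D(1) by (auto simp: ennreal_mult_less_top intro: le_less_trans)
    have "0 < D * chi_ennreal r b q a t" using D(2)[OF k] Xpos[of k] by (auto intro: less_le_trans)
    then show "0 < chi_ennreal r b q a t" by (simp add: ennreal_zero_less_mult_iff)
  qed
  show eq: "ennreal (chi r b q a t) = chi_ennreal r b q a t" if "0 < t" for t
    using chi_pos(2)[OF that] by (simp add: chi_def chi_ennreal_def)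
  show "slow (chi r b q a)"
  proof (rule slow_of_moderate)
    show p: "0 < chi r b q a t" if "0 < t" for t
      using chi_pos(1)[OF that] unfolding eq[OF that, symmetric] by simp
    fix \<epsilon> :: real assume \<epsilon>: "0 < \<epsilon>"
    obtain C where C: "C < top" "\<And>k j. ?X j \<le> C * geo (- \<epsilon>) j k * ?X k" using shift[OF \<epsilon>] by auto
    define E where "E = enn2real (D * C * D)"
    have E: "D * C * D = ennreal E" using C(1) D(1) by (simp add: E_def ennreal_mult_less_top)
    have "chi r b q a s \<le> ((E + 1) * exp (2 * \<epsilon>)) * exp (\<epsilon> * \<bar>ln s - ln t\<bar>) * chi r b q a t"
      if st: "0 < s" "0 < t" for s t
    proof -
      obtain j where j: "?x j \<le> s" "s < ?x (j + 1)" using cell[OF st(1)] by blast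
      obtain k where k: "?x k \<le> t" "t < ?x (k + 1)" using cell[OF st(2)] by blast
      have "\<bar>ln s - real_of_int j\<bar> \<le> 1" "\<bar>ln t - real_of_int k\<bar> \<le> 1"
        using grid_ln(3)[OF x j] grid_ln(3)[OF x k] by auto
      then have d: "\<bar>real_of_int (j - k)\<bar> \<le> \<bar>ln s - ln t\<bar> + 2" by simp
      have "chi_ennreal r b q a s \<le> D * ?X j" using D(2)[OF j] by blast
      also have "\<dots> \<le> D * (C * geo (- \<epsilon>) j k * ?X k)" by (intro mult_left_mono C) auto
      also have "\<dots> \<le> D * (C * geo (- \<epsilon>) j k * (D * chi_ennreal r b q a t))"
        using D(2)[OF k] by (intro mult_left_mono) auto
      also have "\<dots> = (D * C * D) * geo (- \<epsilon>) j k * chi_ennreal r b q a t" by (simp only: mult_ac)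
      also have "\<dots> = ennreal (E * exp (\<epsilon> * \<bar>real_of_int (j - k)\<bar>) * chi r b q a t)"
        unfolding E eq[OF st(2), symmetric] using p[OF st(2)]
        by (simp add: geo_def E_def ennreal_mult' ennreal_mult'' less_imp_le)
      finally have "chi r b q a s \<le> E * exp (\<epsilon> * \<bar>real_of_int (j - k)\<bar>) * chi r b q a t"
        unfolding eq[OF st(1), symmetric] using p[OF st(2)] by (subst (asm) ennreal_le_iff) (auto simp: E_def)
      also have "\<dots> \<le> (E + 1) * exp (\<epsilon> * (\<bar>ln s - ln t\<bar> + 2)) * chi r b q a t"
        using d \<epsilon> p[OF st(2)] by (intro mult_right_mono mult_mono) (auto simp: E_def)
      also have "\<dots> = ((E + 1) * exp (2 * \<epsilon>)) * exp (\<epsilon> * \<bar>ln s - ln t\<bar>) * chi r b q a t"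
        by (simp add: distrib_left exp_add mult_ac)
      finally show ?thesis .
    qed
    moreover have "0 < (E + 1) * exp (2 * \<epsilon>)" by (simp add: E_def add_nonneg_pos)
    ultimately show "\<exists>C. moderate C \<epsilon> (chi r b q a)"
      using p \<epsilon> unfolding moderate_def by (intro exI[of _ "(E + 1) * exp (2 * \<epsilon>)"]) (auto simp: less_imp_le)
  qed
qed

section \<open>The K-functional\<close>

definition nonneg_norm :: "'v::real_vector qspace \<Rightarrow> bool" where
  "nonneg_norm X \<longleftrightarrow> (\<forall>f\<in>pts X. 0 \<le> qnorm X f)"

lemma quasi_normed_nonneg: "quasi_normed X \<Longrightarrow> nonneg_norm X"
  by (simp add: quasi_normed_def nonneg_norm_def)

context
  fixes X0 X1 :: "'v::real_vector qspace"
  assumes X0: "nonneg_norm X0" and X1: "nonneg_norm X1"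
begin

lemma K_fun_le:
  assumes "f0 \<in> pts X0" "f1 \<in> pts X1" "0 \<le> t"
  shows "K_fun X0 X1 t (f0 + f1) \<le> qnorm X0 f0 + t * qnorm X1 f1"
  unfolding K_fun_def
proof (rule cInf_lower)
  show "bdd_below {qnorm X0 g0 + t * qnorm X1 g1 |g0 g1. g0 \<in> pts X0 \<and> g1 \<in> pts X1 \<and> f0 + f1 = g0 + g1}"
    using X0 X1 assms(3) by (intro bdd_belowI[of _ 0]) (auto simp: nonneg_norm_def)
qed (use assms in blast)

lemma K_fun_ge:
  assumes "f \<in> sum_pts X0 X1"
    "\<And>f0 f1. f0 \<in> pts X0 \<Longrightarrow> f1 \<in> pts X1 \<Longrightarrow> f = f0 + f1 \<Longrightarrow> c \<le> qnorm X0 f0 + t * qnorm X1 f1"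
  shows "c \<le> K_fun X0 X1 t f"
  unfolding K_fun_def
proof (rule cInf_greatest)
  show "{qnorm X0 g0 + t * qnorm X1 g1 |g0 g1. g0 \<in> pts X0 \<and> g1 \<in> pts X1 \<and> f = g0 + g1} \<noteq> {}"
    using assms(1) by (auto simp: sum_pts_def)
qed (use assms(2) in blast)

lemma K_fun_nonneg:
  assumes "f \<in> sum_pts X0 X1" "0 \<le> t" shows "0 \<le> K_fun X0 X1 t f"
  using X0 X1 assms by (intro K_fun_ge) (auto simp: nonneg_norm_def)

lemma K_fun_near:
  assumes "f \<in> sum_pts X0 X1" "K_fun X0 X1 t f < c"
  obtains f0 f1 where "f0 \<in> pts X0" "f1 \<in> pts X1" "f = f0 + f1" "qnorm X0 f0 + t * qnorm X1 f1 < c"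
proof (rule ccontr)
  assume "\<not> thesis"
  then have "c \<le> K_fun X0 X1 t f" using that by (intro K_fun_ge assms) force
  then show False using assms(2) by simp
qed

lemma K_fun_mono:
  assumes "f \<in> sum_pts X0 X1" "0 \<le> s" "s \<le> t" shows "K_fun X0 X1 s f \<le> K_fun X0 X1 t f"
proof (rule K_fun_ge[OF assms(1)])
  fix f0 f1 assume h: "f0 \<in> pts X0" "f1 \<in> pts X1" "f = f0 + f1"
  have "K_fun X0 X1 s f \<le> qnorm X0 f0 + s * qnorm X1 f1" using K_fun_le h assms by simp
  also have "\<dots> \<le> qnorm X0 f0 + t * qnorm X1 f1"
    using X1 h assms by (intro add_left_mono mult_right_mono) (auto simp: nonneg_norm_def)
  finally show "K_fun X0 X1 s f \<le> qnorm X0 f0 + t * qnorm X1 f1" .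
qed

lemma K_fun_concave:
  assumes "f \<in> sum_pts X0 X1" "0 < s" "s \<le> t" shows "K_fun X0 X1 t f \<le> t / s * K_fun X0 X1 s f"
proof -
  have "s / t * K_fun X0 X1 t f \<le> K_fun X0 X1 s f"
  proof (rule K_fun_ge[OF assms(1)])
    fix f0 f1 assume h: "f0 \<in> pts X0" "f1 \<in> pts X1" "f = f0 + f1"
    have "s / t * K_fun X0 X1 t f \<le> s / t * (qnorm X0 f0 + t * qnorm X1 f1)"
      using K_fun_le[OF h(1,2), of t] h assms by (intro mult_left_mono) auto
    also have "\<dots> = s / t * qnorm X0 f0 + s * qnorm X1 f1" using assms by (simp add: field_simps)
    also have "\<dots> \<le> 1 * qnorm X0 f0 + s * qnorm X1 f1"
      using X0 h assms by (intro add_right_mono mult_right_mono) (auto simp: nonneg_norm_def)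
    finally show "s / t * K_fun X0 X1 t f \<le> qnorm X0 f0 + s * qnorm X1 f1" by simp
  qed
  then show ?thesis using assms by (simp add: field_simps)
qed

lemma moderate_K:
  assumes f: "f \<in> sum_pts X0 X1" shows "moderate 1 1 (\<lambda>t. K_fun X0 X1 t f)"
  unfolding moderate_def
proof (intro conjI allI impI)
  show "0 \<le> K_fun X0 X1 t f" if "0 < t" for t using K_fun_nonneg[OF f] that by simp
  fix s t :: real assume st: "0 < s" "0 < t"
  have K: "0 \<le> K_fun X0 X1 t f" using K_fun_nonneg[OF f] st by simp
  show "K_fun X0 X1 s f \<le> 1 * exp (1 * \<bar>ln s - ln t\<bar>) * K_fun X0 X1 t f"
  proof (cases "s \<le> t")
    case True
    have "K_fun X0 X1 s f \<le> K_fun X0 X1 t f" using K_fun_mono[OF f] st True by simp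
    also have "1 * K_fun X0 X1 t f \<le> exp (1 * \<bar>ln s - ln t\<bar>) * K_fun X0 X1 t f"
      using K by (intro mult_right_mono) auto
    finally show ?thesis by simp
  next
    case False
    then have "exp \<bar>ln s - ln t\<bar> = s / t" using st by (simp add: exp_diff)
    then show ?thesis using K_fun_concave[OF f st(2), of s] False by simp
  qed
qed simp_all

end

lemma K_fun_quasi_triangle:
  assumes A: "quasi_normed A0" "quasi_normed A1"
  shows "\<exists>M\<ge>1. \<forall>f\<in>sum_pts A0 A1. \<forall>g\<in>sum_pts A0 A1. \<forall>c. \<forall>t>0. \<bar>c\<bar> = 1 \<longrightarrow>
    K_fun A0 A1 t (f + c *\<^sub>R g) \<le> M * (K_fun A0 A1 t f + K_fun A0 A1 t g)"
proof -
  note n = A[THEN quasi_normed_nonneg]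
  obtain M0 where M0: "\<And>x y. x \<in> pts A0 \<Longrightarrow> y \<in> pts A0 \<Longrightarrow> qnorm A0 (x + y) \<le> M0 * (qnorm A0 x + qnorm A0 y)"
  proof -
    have "\<exists>M. \<forall>x\<in>pts A0. \<forall>y\<in>pts A0. qnorm A0 (x + y) \<le> M * (qnorm A0 x + qnorm A0 y)"
      using A(1) by (simp add: quasi_normed_def)
    then show ?thesis using that by blast
  qed
  obtain M1 where M1: "\<And>x y. x \<in> pts A1 \<Longrightarrow> y \<in> pts A1 \<Longrightarrow> qnorm A1 (x + y) \<le> M1 * (qnorm A1 x + qnorm A1 y)"
  proof -
    have "\<exists>M. \<forall>x\<in>pts A1. \<forall>y\<in>pts A1. qnorm A1 (x + y) \<le> M * (qnorm A1 x + qnorm A1 y)"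
      using A(2) by (simp add: quasi_normed_def)
    then show ?thesis using that by blast
  qed
  define M where "M = max 1 (max M0 M1)"
  have M: "1 \<le> M" "M0 \<le> M" "M1 \<le> M" by (auto simp: M_def)
  have "K_fun A0 A1 t (f + c *\<^sub>R g) \<le> M * (K_fun A0 A1 t f + K_fun A0 A1 t g)"
    if f: "f \<in> sum_pts A0 A1" and g: "g \<in> sum_pts A0 A1" and c: "\<bar>c\<bar> = 1" and t: "0 < t" for f g c t
  proof -
    have *: "K_fun A0 A1 t (f + c *\<^sub>R g) / M \<le> (qnorm A0 f0 + t * qnorm A1 f1) + (qnorm A0 g0 + t * qnorm A1 g1)"
      if h: "f0 \<in> pts A0" "f1 \<in> pts A1" "f = f0 + f1" "g0 \<in> pts A0" "g1 \<in> pts A1" "g = g0 + g1" for f0 f1 g0 g1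
    proof -
      have m: "c *\<^sub>R g0 \<in> pts A0" "c *\<^sub>R g1 \<in> pts A1" "f0 + c *\<^sub>R g0 \<in> pts A0" "f1 + c *\<^sub>R g1 \<in> pts A1"
        using A h by (auto simp: quasi_normed_def subspace_def)
      have s: "qnorm A0 (c *\<^sub>R g0) = qnorm A0 g0" "qnorm A1 (c *\<^sub>R g1) = qnorm A1 g1"
        using A h c by (auto simp: quasi_normed_def)
      have p: "0 \<le> qnorm A0 f0" "0 \<le> qnorm A0 g0" "0 \<le> qnorm A1 f1" "0 \<le> qnorm A1 g1"
        using n h by (auto simp: nonneg_norm_def)
      have "qnorm A0 (f0 + c *\<^sub>R g0) \<le> M0 * (qnorm A0 f0 + qnorm A0 g0)" using M0[OF h(1) m(1)] s by simp
      also have "\<dots> \<le> M * (qnorm A0 f0 + qnorm A0 g0)" using M p by (intro mult_right_mono) auto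
      finally have q0: "qnorm A0 (f0 + c *\<^sub>R g0) \<le> M * (qnorm A0 f0 + qnorm A0 g0)" .
      have "qnorm A1 (f1 + c *\<^sub>R g1) \<le> M1 * (qnorm A1 f1 + qnorm A1 g1)" using M1[OF h(2) m(2)] s by simp
      also have "\<dots> \<le> M * (qnorm A1 f1 + qnorm A1 g1)" using M p by (intro mult_right_mono) auto
      finally have q1: "t * qnorm A1 (f1 + c *\<^sub>R g1) \<le> t * (M * (qnorm A1 f1 + qnorm A1 g1))"
        using t by (intro mult_left_mono) auto
      have "f + c *\<^sub>R g = (f0 + c *\<^sub>R g0) + (f1 + c *\<^sub>R g1)" using h by (simp add: algebra_simps)
      then have "K_fun A0 A1 t (f + c *\<^sub>R g) \<le> qnorm A0 (f0 + c *\<^sub>R g0) + t * qnorm A1 (f1 + c *\<^sub>R g1)"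
        using K_fun_le[OF n m(3,4), of t] t by simp
      also have "\<dots> \<le> M * ((qnorm A0 f0 + t * qnorm A1 f1) + (qnorm A0 g0 + t * qnorm A1 g1))"
        using q0 q1 by (simp add: algebra_simps)
      finally show ?thesis using M by (simp add: field_simps)
    qed
    have "K_fun A0 A1 t (f + c *\<^sub>R g) / M - K_fun A0 A1 t g \<le> K_fun A0 A1 t f"
    proof (rule K_fun_ge[OF n f])
      fix f0 f1 assume h: "f0 \<in> pts A0" "f1 \<in> pts A1" "f = f0 + f1"
      have "K_fun A0 A1 t (f + c *\<^sub>R g) / M - (qnorm A0 f0 + t * qnorm A1 f1) \<le> K_fun A0 A1 t g"
        using *[OF h] by (intro K_fun_ge[OF n g]) force
      then show "K_fun A0 A1 t (f + c *\<^sub>R g) / M - K_fun A0 A1 t g \<le> qnorm A0 f0 + t * qnorm A1 f1" by simp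
    qed
    then show ?thesis using M by (simp add: field_simps)
  qed
  then show ?thesis using M(1) by blast
qed

text \<open>If \<open>K\<close> vanishes, \<open>f\<close> is a sum of two elements that are arbitrarily small in \<open>A0\<close> and in \<open>A1\<close>, hence lies in
  every neighbourhood of 0.\<close>

lemma K_fun_zero:
  assumes A: "quasi_banach_couple A0 A1" and f: "f \<in> sum_pts A0 A1" and t: "0 < t" and K: "K_fun A0 A1 t f = 0"
  shows "f = 0"
proof (rule ccontr)
  assume f0: "f \<noteq> 0"
  obtain T where T: "hausdorff_tvs T" "continuously_in A0 T" "continuously_in A1 T"
    using A unfolding quasi_banach_couple_def by blast
  have q: "quasi_normed A0" "quasi_normed A1"
    using A unfolding quasi_banach_couple_def quasi_banach_def by blast+
  note n = q[THEN quasi_normed_nonneg]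
  have top: "topspace T = UNIV" "Hausdorff_space T"
    and cont: "continuous_map (prod_topology T T) T (\<lambda>(x, y). x + y)"
    using T(1) by (auto simp: hausdorff_tvs_def)
  obtain V where V: "openin T V" "0 \<in> V" "f \<notin> V"
    using top f0 unfolding Hausdorff_space_def by (metis UNIV_I disjnt_iff)
  have op: "openin (prod_topology T T) {z. (\<lambda>(x, y). x + y) z \<in> V}"
    using cont V(1) top by (simp add: continuous_map_def topspace_prod_topology)
  obtain W0 W1 where W: "openin T W0" "openin T W1" "0 \<in> W0" "0 \<in> W1"
    "W0 \<times> W1 \<subseteq> {z. (\<lambda>(x, y). x + y) z \<in> V}"
    using op[unfolded openin_prod_topology_alt, rule_format, of 0 0] V(2) by auto
  have z: "0 \<in> pts A0" "0 \<in> pts A1" using q by (auto simp: quasi_normed_def subspace_def)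
  obtain d0 where d0: "0 < d0" "\<And>y. y \<in> pts A0 \<Longrightarrow> qnorm A0 (y - 0) < d0 \<Longrightarrow> y \<in> W0"
    using T(2)[unfolded continuously_in_def, THEN bspec, OF z(1), THEN spec, of W0] W(1,3) by blast
  obtain d1 where d1: "0 < d1" "\<And>y. y \<in> pts A1 \<Longrightarrow> qnorm A1 (y - 0) < d1 \<Longrightarrow> y \<in> W1"
    using T(3)[unfolded continuously_in_def, THEN bspec, OF z(2), THEN spec, of W1] W(2,4) by blast
  have "K_fun A0 A1 t f < min d0 (t * d1)" using K d0 d1 t by simp
  then obtain g0 g1 where g: "g0 \<in> pts A0" "g1 \<in> pts A1" "f = g0 + g1" "qnorm A0 g0 + t * qnorm A1 g1 < min d0 (t * d1)"
    using K_fun_near[OF n f] by blast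
  have p: "0 \<le> qnorm A0 g0" "0 \<le> t * qnorm A1 g1" using n g t by (auto simp: nonneg_norm_def)
  have "qnorm A0 g0 < d0" "t * qnorm A1 g1 < t * d1" using g(4) p by linarith+
  then have "g0 \<in> W0" "g1 \<in> W1" using d0(2) d1(2) g t by auto
  then have "f \<in> V" using W(5) g(3) by auto
  then show False using V(3) by blast
qed

text \<open>A decomposition that is optimal at \<open>t\<close> up to a factor 2.  The summand \<open>f0\<close> is bounded by \<open>K(t, f)\<close> and \<open>f1\<close> is
  linearly bounded; the remaining two bounds follow from \<open>f0 = f - f1\<close> and \<open>f1 = f - f0\<close>, and from the
  monotonicity of \<open>K\<close> and of \<open>K(u)/u\<close>.\<close>

lemma good_decomposition:
  assumes A: "quasi_banach_couple A0 A1"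
  shows "\<exists>M\<ge>1. \<forall>f\<in>sum_pts A0 A1. \<forall>t>0. \<exists>f0 f1. f0 \<in> pts A0 \<and> f1 \<in> pts A1 \<and> f = f0 + f1 \<and>
    (\<forall>u>0. K_fun A0 A1 u f0 \<le> M * K_fun A0 A1 t f \<and> K_fun A0 A1 u f1 \<le> M * (u / t * K_fun A0 A1 t f) \<and>
       (u \<le> t \<longrightarrow> K_fun A0 A1 u f0 \<le> M * K_fun A0 A1 u f) \<and> (t \<le> u \<longrightarrow> K_fun A0 A1 u f1 \<le> M * K_fun A0 A1 u f))"
proof -
  have q: "quasi_normed A0" "quasi_normed A1"
    using A unfolding quasi_banach_couple_def quasi_banach_def by blast+
  note n = q[THEN quasi_normed_nonneg]
  have z: "0 \<in> pts A0" "0 \<in> pts A1" "qnorm A0 0 = 0" "qnorm A1 0 = 0"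
    using q by (auto simp: quasi_normed_def subspace_def)
  obtain M where M: "1 \<le> M" and tri: "\<And>f g c t. f \<in> sum_pts A0 A1 \<Longrightarrow> g \<in> sum_pts A0 A1 \<Longrightarrow> 0 < t \<Longrightarrow> \<bar>c\<bar> = 1 \<Longrightarrow>
    K_fun A0 A1 t (f + c *\<^sub>R g) \<le> M * (K_fun A0 A1 t f + K_fun A0 A1 t g)"
    using K_fun_quasi_triangle[OF q] by meson
  have in0: "K_fun A0 A1 u g \<le> qnorm A0 g" "g \<in> sum_pts A0 A1" if "g \<in> pts A0" "0 < u" for g u
    using K_fun_le[OF n that(1) z(2), of u] that z by (auto simp: sum_pts_def intro: exI[of _ g] exI[of _ 0])
  have in1: "K_fun A0 A1 u g \<le> u * qnorm A1 g" "g \<in> sum_pts A0 A1" if "g \<in> pts A1" "0 < u" for g u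
    using K_fun_le[OF n z(1) that(1), of u] that z by (auto simp: sum_pts_def intro: exI[of _ g] exI[of _ 0])
  have "\<exists>f0 f1. f0 \<in> pts A0 \<and> f1 \<in> pts A1 \<and> f = f0 + f1 \<and>
    (\<forall>u>0. K_fun A0 A1 u f0 \<le> (3 * M) * K_fun A0 A1 t f \<and> K_fun A0 A1 u f1 \<le> (3 * M) * (u / t * K_fun A0 A1 t f) \<and>
       (u \<le> t \<longrightarrow> K_fun A0 A1 u f0 \<le> (3 * M) * K_fun A0 A1 u f) \<and> (t \<le> u \<longrightarrow> K_fun A0 A1 u f1 \<le> (3 * M) * K_fun A0 A1 u f))"
    if f: "f \<in> sum_pts A0 A1" and t: "0 < t" for f t
  proof -
    have K0: "0 \<le> K_fun A0 A1 u f" if "0 < u" for u using K_fun_nonneg[OF n f] that by simp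
    \<comment> \<open>The infimum need not be attained, so a zero infimum is treated separately.\<close>
    have "\<exists>f0 f1. f0 \<in> pts A0 \<and> f1 \<in> pts A1 \<and> f = f0 + f1 \<and> qnorm A0 f0 + t * qnorm A1 f1 \<le> 2 * K_fun A0 A1 t f"
    proof (cases "K_fun A0 A1 t f = 0")
      case True
      then have "f = 0" using K_fun_zero[OF A f t] by simp
      then show ?thesis using z K0[OF t] by (intro exI[of _ 0]) auto
    next
      case False
      then have "K_fun A0 A1 t f < 2 * K_fun A0 A1 t f" using K0[OF t] by simp
      then obtain f0 f1 where "f0 \<in> pts A0" "f1 \<in> pts A1" "f = f0 + f1"
        "qnorm A0 f0 + t * qnorm A1 f1 < 2 * K_fun A0 A1 t f"
        using K_fun_near[OF n f] by blast
      then show ?thesis by (intro exI[of _ f0] exI[of _ f1]) simp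
    qed
    then obtain f0 f1 where h: "f0 \<in> pts A0" "f1 \<in> pts A1" "f = f0 + f1"
      "qnorm A0 f0 + t * qnorm A1 f1 \<le> 2 * K_fun A0 A1 t f" by blast
    have p: "0 \<le> qnorm A0 f0" "0 \<le> qnorm A1 f1" using n h by (auto simp: nonneg_norm_def)
    have pt: "0 \<le> t * qnorm A1 f1" using p t by simp
    have b0: "qnorm A0 f0 \<le> 2 * K_fun A0 A1 t f" using h(4) pt by linarith
    have b1: "qnorm A1 f1 \<le> 2 * K_fun A0 A1 t f / t" using h(4) p t by (simp add: field_simps)
    have k0: "K_fun A0 A1 u f0 \<le> 2 * K_fun A0 A1 t f" if "0 < u" for u
      using in0(1)[OF h(1) that] b0 by linarith
    have k1: "K_fun A0 A1 u f1 \<le> 2 * (u / t * K_fun A0 A1 t f)" if "0 < u" for u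
    proof -
      have "u * qnorm A1 f1 \<le> u * (2 * K_fun A0 A1 t f / t)" using b1 that by (intro mult_left_mono) auto
      then show ?thesis using in1(1)[OF h(2) that] by (simp add: mult_ac)
    qed
    have up: "2 * x \<le> 3 * M * x" if "0 \<le> x" for x
      using M that by (intro mult_right_mono) auto
    have e: "f + (-1) *\<^sub>R f1 = f0" "f + (-1) *\<^sub>R f0 = f1" using h(3) by auto
    have s: "K_fun A0 A1 u f0 \<le> 3 * M * K_fun A0 A1 u f" if u: "0 < u" "u \<le> t" for u
    proof -
      have "u / t * K_fun A0 A1 t f \<le> K_fun A0 A1 u f"
        using K_fun_concave[OF n f u] u t by (simp add: field_simps)
      then have "M * (K_fun A0 A1 u f + K_fun A0 A1 u f1) \<le> M * (K_fun A0 A1 u f + 2 * K_fun A0 A1 u f)"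
        using k1[OF u(1)] M by (intro mult_left_mono) auto
      then show ?thesis using tri[OF f in1(2)[OF h(2) u(1)] u(1), of "-1"] e by simp
    qed
    have l: "K_fun A0 A1 u f1 \<le> 3 * M * K_fun A0 A1 u f" if u: "0 < u" "t \<le> u" for u
    proof -
      have "K_fun A0 A1 t f \<le> K_fun A0 A1 u f" using K_fun_mono[OF n f _ u(2)] t by simp
      then have "M * (K_fun A0 A1 u f + K_fun A0 A1 u f0) \<le> M * (K_fun A0 A1 u f + 2 * K_fun A0 A1 u f)"
        using k0[OF u(1)] M by (intro mult_left_mono) auto
      then show ?thesis using tri[OF f in0(2)[OF h(1) u(1)] u(1), of "-1"] e by simp
    qed
    show ?thesis
    proof (rule exI[of _ f0], rule exI[of _ f1], intro conjI allI impI h(1-3))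
      fix u :: real assume u: "0 < u"
      show "K_fun A0 A1 u f0 \<le> 3 * M * K_fun A0 A1 t f" using k0[OF u] up[OF K0[OF t]] by linarith
      have "0 \<le> u / t * K_fun A0 A1 t f" using K0[OF t] u t by simp
      then show "K_fun A0 A1 u f1 \<le> 3 * M * (u / t * K_fun A0 A1 t f)" using k1[OF u] up by (meson order_trans)
    qed (fact s l)+
  qed
  then show ?thesis using M by (intro exI[of _ "3 * M"]) auto
qed

section \<open>Norms of interpolation spaces on samples\<close>

text \<open>The extended quasi-norms of the three kinds of spaces, separated from the set of elements where
  they are finite.\<close>

definition interp_norm where
  "interp_norm \<theta> q b X0 X1 f = Lq_norm q {0<..} (\<lambda>u. ennreal (u powr (- \<theta> - rexp q) * b u * K_fun X0 X1 u f))"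

definition interp_L_norm where
  "interp_L_norm \<theta> r b q a X0 X1 f = Lq_norm r {0<..} (\<lambda>t. ennreal (t powr (- rexp r) * b t) *
       Lq_norm q {0<..<t} (\<lambda>u. ennreal (u powr (- \<theta> - rexp q) * a u * K_fun X0 X1 u f)))"

definition interp_LR_norm where
  "interp_LR_norm \<theta> p c r b q a X0 X1 f = Lq_norm p {0<..} (\<lambda>t. ennreal (t powr (- rexp p) * c t) *
       Lq_norm r {t<..} (\<lambda>u. ennreal (u powr (- rexp r) * b u) *
         Lq_norm q {t<..<u} (\<lambda>v. ennreal (v powr (- \<theta> - rexp q) * a v * K_fun X0 X1 v f))))"

lemma weight_split:
  "ennreal (u powr (- \<theta> - rexp q) * b * k) = ennreal (u powr - rexp q) * ennreal (u powr - \<theta> * b * k)"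
proof -
  have "u powr (- \<theta> - rexp q) = u powr - rexp q * u powr - \<theta>"
    by (simp add: powr_add[symmetric] minus_diff_commute)
  then show ?thesis by (simp add: ennreal_mult'[symmetric] mult.assoc)
qed

lemma moderate_kernel:
  assumes "nonneg_norm X0" "nonneg_norm X1" "f \<in> sum_pts X0 X1" "moderate C c b"
  shows "moderate C (\<bar>\<theta>\<bar> + c + 1) (\<lambda>u. u powr - \<theta> * b u * K_fun X0 X1 u f)"
  using moderate_mult[OF moderate_mult[OF moderate_powr[of "- \<theta>"] assms(4)] moderate_K[OF assms(1-3)]] by simp

lemma interp_sampled:
  assumes n: "nonneg_norm X0" "nonneg_norm X1" and x: "grid x M" and q: "0 < q" and b: "slow b"
  shows "\<exists>D<top. \<forall>f\<in>sum_pts X0 X1.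
    interp_norm \<theta> q b X0 X1 f
      \<asymp>[D] lq q UNIV (\<lambda>k. ennreal (x k powr - \<theta> * b (x k) * K_fun X0 X1 (x k) f))"
proof -
  obtain C where C: "moderate C 1 b" using moderate_of_slow[OF b, of 1] by (metis zero_less_one)
  note F = moderate_kernel[OF n _ C, of _ \<theta>]
  obtain D where D: "D < top" "\<forall>F. moderate C (\<bar>\<theta>\<bar> + 1 + 1) F \<longrightarrow>
    log_norm q {0<..} (\<lambda>u. ennreal (F u))
      \<asymp>[D] lq q UNIV (\<lambda>j. ennreal (F (x j)))"
    using sampled_full[OF x q] by blast
  have "interp_norm \<theta> q b X0 X1 f = log_norm q {0<..} (\<lambda>u. ennreal (u powr - \<theta> * b u * K_fun X0 X1 u f))" for f
    unfolding interp_norm_def weight_split ..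
  then show ?thesis using D(1) D(2)[THEN spec, THEN mp, OF F] by (intro exI[of _ D]) auto
qed

lemma interp_L_sampled:
  assumes n: "nonneg_norm X0" "nonneg_norm X1" and x: "grid x M" and q: "0 < q" and r: "0 < r"
    and a: "slow a" and b: "slow b"
  shows "\<exists>D<top. \<forall>f\<in>sum_pts X0 X1.
    interp_L_norm \<theta> r b q a X0 X1 f
      \<asymp>[D] lq r UNIV (\<lambda>k. ennreal (b (x k)) * lq q {..k} (\<lambda>j. ennreal (x j powr - \<theta> * a (x j) * K_fun X0 X1 (x j) f)))"
proof -
  obtain C where C: "moderate C 1 a" using moderate_of_slow[OF a, of 1] by (metis zero_less_one)
  obtain C' where C': "moderate C' 1 b" using moderate_of_slow[OF b, of 1] by (metis zero_less_one)
  note F = moderate_kernel[OF n _ C, of _ \<theta>]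
  obtain D where D: "D < top" "\<forall>F. moderate C (\<bar>\<theta>\<bar> + 1 + 1) F \<longrightarrow>
    (\<forall>I S. I \<in> sets borel \<longrightarrow> I \<subseteq> {0<..} \<longrightarrow> (\<forall>u\<in>I. \<forall>k. u \<in> cell x k \<longrightarrow> k \<in> S) \<longrightarrow>
      log_norm r I (\<lambda>t. ennreal (b t) * log_norm q {0<..<t} (\<lambda>u. ennreal (F u)))
      \<le> D * lq r S (\<lambda>m. ennreal (b (x m)) * lq q {..m} (\<lambda>j. ennreal (F (x j))))) \<and>
    (\<forall>I S i. I \<in> sets borel \<longrightarrow> i \<in> {0, 1} \<longrightarrow> (\<forall>k\<in>S. cell x k \<subseteq> I) \<longrightarrow>
      lq r S (\<lambda>m. ennreal (b (x (m + i))) * lq q {..m + i} (\<lambda>j. ennreal (F (x j))))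
      \<le> D * log_norm r I (\<lambda>t. ennreal (b t) * log_norm q {0<..<t} (\<lambda>u. ennreal (F u))))"
    by (rule exE[OF sampled_nested_left[OF x q r C', of C "\<bar>\<theta>\<bar> + 1 + 1"]], elim conjE, rule that)
  have eq: "interp_L_norm \<theta> r b q a X0 X1 f = log_norm r {0<..} (\<lambda>t. ennreal (b t) *
      log_norm q {0<..<t} (\<lambda>u. ennreal (u powr - \<theta> * a u * K_fun X0 X1 u f)))" for f
    unfolding interp_L_norm_def weight_split by (simp add: ennreal_mult' mult.assoc)
  show ?thesis
  proof (intro exI[of _ D] conjI D(1) ballI)
    fix f assume f: "f \<in> sum_pts X0 X1"
    note DF = D(2)[THEN spec, THEN mp, OF F[OF f]]
    show "interp_L_norm \<theta> r b q a X0 X1 f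
      \<le> D * lq r UNIV (\<lambda>k. ennreal (b (x k)) * lq q {..k} (\<lambda>j. ennreal (x j powr - \<theta> * a (x j) * K_fun X0 X1 (x j) f)))"
      unfolding eq by (rule DF[THEN conjunct1, rule_format]) auto
    have "lq r UNIV (\<lambda>k. ennreal (b (x (k + 0))) * lq q {..k + 0} (\<lambda>j. ennreal (x j powr - \<theta> * a (x j) * K_fun X0 X1 (x j) f)))
      \<le> D * interp_L_norm \<theta> r b q a X0 X1 f"
      unfolding eq using grid_near(2)[OF x, of _ _ 0] by (intro DF[THEN conjunct2, rule_format]) auto
    then show "lq r UNIV (\<lambda>k. ennreal (b (x k)) * lq q {..k} (\<lambda>j. ennreal (x j powr - \<theta> * a (x j) * K_fun X0 X1 (x j) f)))
      \<le> D * interp_L_norm \<theta> r b q a X0 X1 f" by simp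
  qed
qed

lemma interp_LR_sampled:
  assumes n: "nonneg_norm X0" "nonneg_norm X1" and x: "grid x M" and q: "0 < q" and r: "0 < r" and p: "0 < p"
    and a: "slow a" and b: "slow b" and c: "slow c"
  shows "\<exists>D<top. \<forall>f\<in>sum_pts X0 X1.
    interp_LR_norm \<theta> p c r b q a X0 X1 f
      \<asymp>[D] lq p UNIV (\<lambda>k. ennreal (c (x k)) * lq r {k..} (\<lambda>m. ennreal (b (x m)) * lq q {k..m} (\<lambda>j. ennreal (x j powr - \<theta> * a (x j) * K_fun X0 X1 (x j) f))))"
proof -
  obtain C where C: "moderate C 1 a" using moderate_of_slow[OF a, of 1] by (metis zero_less_one)
  obtain C' where C': "moderate C' 1 b" using moderate_of_slow[OF b, of 1] by (metis zero_less_one)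
  obtain C'' where C'': "moderate C'' 1 c" using moderate_of_slow[OF c, of 1] by (metis zero_less_one)
  note F = moderate_kernel[OF n _ C, of _ \<theta>]
  obtain D where D: "D < top" "\<forall>F. moderate C (\<bar>\<theta>\<bar> + 1 + 1) F \<longrightarrow>
    log_norm p {0<..} (\<lambda>t. ennreal (c t) * log_norm r {t<..} (\<lambda>u. ennreal (b u) * log_norm q {t<..<u} (\<lambda>v. ennreal (F v))))
      \<asymp>[D] lq p UNIV (\<lambda>k. ennreal (c (x k)) * lq r {k..} (\<lambda>m. ennreal (b (x m)) * lq q {k..m} (\<lambda>j. ennreal (F (x j)))))"
    by (rule exE[OF sampled_nested_LR[OF x q r p C' C'', of C "\<bar>\<theta>\<bar> + 1 + 1"]], elim conjE, rule that)
  have eq: "interp_LR_norm \<theta> p c r b q a X0 X1 f = log_norm p {0<..} (\<lambda>t. ennreal (c t) * log_norm r {t<..} (\<lambda>u. ennreal (b u) *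
      log_norm q {t<..<u} (\<lambda>v. ennreal (v powr - \<theta> * a v * K_fun X0 X1 v f))))" for f
    unfolding interp_LR_norm_def weight_split by (simp add: ennreal_mult' mult.assoc)
  show ?thesis unfolding eq
    by (intro exI[of _ D] conjI D(1) ballI D(2)[THEN spec, THEN mp, OF F, THEN conjunct1]
        D(2)[THEN spec, THEN mp, OF F, THEN conjunct2])
qed

section \<open>Quasi-powers on a geometric grid\<close>

lemma geo_antimono: "\<delta> \<le> \<delta>' \<Longrightarrow> geo \<delta>' j k \<le> geo \<delta> j k"
  by (auto simp: geo_def intro!: ennreal_leI mult_right_mono)

lemma quasi_power_samples:
  assumes b: "slow b" and h: "0 < h" and \<alpha>: "\<alpha> \<noteq> 0"
  shows "\<exists>C<top. \<forall>j k. \<alpha> * real_of_int (k - j) \<le> 0 \<longrightarrow>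
    ennreal (exp (h * real_of_int k) powr \<alpha> * b (exp (h * real_of_int k)))
    \<le> C * geo (h * \<bar>\<alpha>\<bar> / 2) j k * ennreal (exp (h * real_of_int j) powr \<alpha> * b (exp (h * real_of_int j)))"
proof -
  obtain L where L: "0 \<le> L" "\<And>s t. 0 < s \<Longrightarrow> 0 < t \<Longrightarrow> \<bar>ln (b s) - ln (b t)\<bar> \<le> L + \<bar>\<alpha>\<bar>/2 * \<bar>ln s - ln t\<bar>"
    using slowD[OF b, of "\<bar>\<alpha>\<bar>/2"] \<alpha> by auto
  show ?thesis
  proof (intro exI[of _ "ennreal (exp L)"] conjI allI impI)
    fix j k :: int assume neg: "\<alpha> * real_of_int (k - j) \<le> 0"
    let ?s = "exp (h * real_of_int k)" and ?t = "exp (h * real_of_int j)"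
    let ?d = "\<bar>real_of_int (j - k)\<bar>"
    have e: "\<bar>ln ?s - ln ?t\<bar> = h * ?d"
      using h by (simp add: right_diff_distrib[symmetric] abs_mult abs_minus_commute)
    have "\<alpha> * real_of_int (k - j) = - \<bar>\<alpha> * real_of_int (k - j)\<bar>" using neg by linarith
    also have "\<dots> = - (\<bar>\<alpha>\<bar> * ?d)" by (simp add: abs_mult abs_minus_commute)
    finally have a0: "\<alpha> * real_of_int (k - j) = - (\<bar>\<alpha>\<bar> * ?d)" .
    have "\<alpha> * (h * real_of_int k) - \<alpha> * (h * real_of_int j) = h * (\<alpha> * real_of_int (k - j))"
      by (simp add: algebra_simps)
    then have a: "\<alpha> * (h * real_of_int k) - \<alpha> * (h * real_of_int j) = - (h * \<bar>\<alpha>\<bar> * ?d)"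
      unfolding a0 by simp
    have "ln (b ?s) - ln (b ?t) \<le> L + \<bar>\<alpha>\<bar>/2 * (h * ?d)" using L(2)[of ?s ?t] unfolding e by simp
    then have "\<alpha> * (h * real_of_int k) + ln (b ?s) \<le> L + - (h * \<bar>\<alpha>\<bar> / 2) * ?d + (\<alpha> * (h * real_of_int j) + ln (b ?t))"
      using a by (simp add: field_simps)
    then have "exp (\<alpha> * (h * real_of_int k) + ln (b ?s)) \<le> exp (L + - (h * \<bar>\<alpha>\<bar> / 2) * ?d + (\<alpha> * (h * real_of_int j) + ln (b ?t)))"
      by simp
    then have "?s powr \<alpha> * b ?s \<le> exp L * exp (- (h * \<bar>\<alpha>\<bar> / 2) * ?d) * (?t powr \<alpha> * b ?t)"
      unfolding exp_add using slow_pos[OF b, of ?s] slow_pos[OF b, of ?t] by (simp add: powr_def)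
    then have "ennreal (?s powr \<alpha> * b ?s) \<le> ennreal (exp L * exp (- (h * \<bar>\<alpha>\<bar> / 2) * ?d) * (?t powr \<alpha> * b ?t))"
      by (rule ennreal_leI)
    then show "ennreal (?s powr \<alpha> * b ?s) \<le> ennreal (exp L) * geo (h * \<bar>\<alpha>\<bar> / 2) j k * ennreal (?t powr \<alpha> * b ?t)"
      by (simp add: geo_def ennreal_mult')
  qed simp
qed

text \<open>A large step \<open>h\<close> makes the samples of a quasi-power grow at least by the factor 2, although the
  function itself need not be increasing.\<close>

lemma quasi_power_grid:
  assumes b: "slow b" and \<alpha>: "0 < \<alpha>"
  obtains h M where "1 \<le> h" "grid (\<lambda>k. exp (h * real_of_int k) powr \<alpha> * b (exp (h * real_of_int k))) M"
proof -
  obtain L where L: "0 \<le> L" "\<And>s t. 0 < s \<Longrightarrow> 0 < t \<Longrightarrow> \<bar>ln (b s) - ln (b t)\<bar> \<le> L + \<alpha>/2 * \<bar>ln s - ln t\<bar>"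
    using slowD[OF b, of "\<alpha>/2"] \<alpha> by auto
  \<comment> \<open>The drift \<open>\<alpha> h\<close> has to beat the oscillation \<open>L + \<alpha>/2 h\<close> of \<open>ln b\<close> by at least 1.\<close>
  define h where "h = max 1 (2 * (L + 1) / \<alpha>)"
  have h: "1 \<le> h" "L + 1 \<le> h * \<alpha> / 2"
  proof -
    have "2 * (L + 1) / \<alpha> \<le> h" by (simp add: h_def)
    then show "L + 1 \<le> h * \<alpha> / 2" using \<alpha> by (simp add: field_simps)
  qed (simp add: h_def)
  let ?f = "\<lambda>k::int. exp (h * real_of_int k) powr \<alpha> * b (exp (h * real_of_int k))"
  have "0 < ?f k \<and> 2 * ?f k \<le> ?f (k + 1) \<and> ?f (k + 1) \<le> exp (\<alpha> * h + (L + \<alpha>/2 * h)) * ?f k" for k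
  proof -
    let ?s = "exp (h * real_of_int (k + 1))" and ?t = "exp (h * real_of_int k)"
    have p: "0 < b ?s" "0 < b ?t" using slow_pos[OF b] by auto
    have l: "ln ?s - ln ?t = h" by (simp add: algebra_simps)
    have d: "\<bar>ln (b ?s) - ln (b ?t)\<bar> \<le> L + \<alpha>/2 * h"
      using L(2)[of ?s ?t] l h(1) by simp
    have f: "?f k = exp (\<alpha> * (h * real_of_int k) + ln (b ?t))" "?f (k + 1) = exp (\<alpha> * (h * real_of_int k) + \<alpha> * h + ln (b ?s))"
    proof -
      have "?t powr \<alpha> = exp (\<alpha> * (h * real_of_int k))" "?s powr \<alpha> = exp (\<alpha> * (h * real_of_int (k + 1)))"
        by (simp_all add: powr_def del: of_int_add)
      moreover have "exp (\<alpha> * (h * real_of_int (k + 1))) = exp (\<alpha> * (h * real_of_int k) + \<alpha> * h)"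
        by (simp add: algebra_simps)
      ultimately show "?f k = exp (\<alpha> * (h * real_of_int k) + ln (b ?t))" "?f (k + 1) = exp (\<alpha> * (h * real_of_int k) + \<alpha> * h + ln (b ?s))"
        using p by (simp_all only: exp_add exp_ln)
    qed
    have "2 * ?f k \<le> exp 1 * ?f k"
      using exp_ge_add_one_self[of 1] p by (intro mult_right_mono) auto
    also have "\<dots> = exp (1 + (\<alpha> * (h * real_of_int k) + ln (b ?t)))" unfolding f exp_add[symmetric] ..
    also have "\<dots> \<le> ?f (k + 1)" unfolding f(2) using d h(2) by (simp add: abs_le_iff mult.commute)
    finally have 1: "2 * ?f k \<le> ?f (k + 1)" .
    have "?f (k + 1) \<le> exp (\<alpha> * h + (L + \<alpha>/2 * h) + (\<alpha> * (h * real_of_int k) + ln (b ?t)))"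
      unfolding f(2) using d by (simp add: abs_le_iff)
    also have "\<dots> = exp (\<alpha> * h + (L + \<alpha>/2 * h)) * ?f k" unfolding f exp_add[symmetric] ..
    finally show ?thesis using 1 p by simp
  qed
  then have "grid ?f (exp (\<alpha> * h + (L + \<alpha>/2 * h)))" unfolding grid_def by blast
  then show thesis using h(1) that by blast
qed

section \<open>Holmstedt's formula for the interpolated couple\<close>

text \<open>The step \<open>h\<close> is so large that both \<open>exp (h k)\<close> and its image under \<open>\<rho>\<close> are grids; \<open>\<xi>\<close> stands for \<open>\<chi>\<close>.\<close>

locale reiteration =
  fixes A0 A1 :: "'v::real_vector qspace" and q1 r1 r0 :: ennreal
    and a1 b1 b0 \<xi> :: "real \<Rightarrow> real" and \<theta>0 h M :: real
  assumes couple: "quasi_banach_couple A0 A1"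
    and q1: "0 < q1" and r1: "0 < r1" and r0: "0 < r0"
    and a1: "slow a1" and b1: "slow b1" and b0: "slow b0" and \<xi>: "slow \<xi>"
    and \<theta>0: "0 < \<theta>0" "\<theta>0 < 1" and h: "1 \<le> h"
    and grid_rho: "grid (\<lambda>k. rho \<theta>0 b0 \<xi> (exp (h * real_of_int k))) M"
    and chi_sampled: "\<exists>D<top. \<forall>k. ennreal (\<xi> (exp (h * real_of_int k)))
      \<asymp>[D] chi_seq r1 (\<lambda>m. ennreal (b1 (exp (h * real_of_int m)))) q1 (\<lambda>m. ennreal (a1 (exp (h * real_of_int m)))) k"
begin

text \<open>The data of the discrete locales.  The rate \<open>\<delta>\<close> is half of the smaller one of the exponents \<open>\<theta>0\<close> and
  \<open>1 - \<theta>0\<close>, the other half being lost to the slowly varying factors; \<open>\<kappa> f\<close> samples the K-functional of \<open>f\<close>.\<close>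

definition "x k = exp (h * real_of_int k)"
definition "\<rho> = rho \<theta>0 b0 \<xi>"
definition "w k = ennreal (x k powr - \<theta>0 * b0 (x k))"
definition "T k = ennreal (x k powr - 1)"
definition "\<rho>x k = ennreal (\<rho> (x k))"
definition "\<kappa> f k = ennreal (K_fun A0 A1 (x k) f)"
definition "\<delta> = h * min \<theta>0 (1 - \<theta>0) / 2"
definition "X0 = interp \<theta>0 r0 b0 A0 A1"
definition "X1 = interp_L 1 r1 b1 q1 a1 A0 A1"

lemma x_pos [simp]: "0 < x k" "0 \<le> x k" "\<bar>x k\<bar> = x k" by (simp_all add: x_def)

lemma rho_eq: "\<rho> = (\<lambda>t. t powr (1 - \<theta>0) * (b0 t / \<xi> t))"
  by (simp add: \<rho>_def rho_def fun_eq_iff)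

lemma slow_ratio: "slow (\<lambda>t. b0 t / \<xi> t)" by (intro slow_divide b0 \<xi>)

lemma rho_pos: "0 < t \<Longrightarrow> 0 < \<rho> t"
  using mult_pos_pos[OF _ slow_pos[OF slow_ratio, of t], of "t powr (1 - \<theta>0)"] by (simp add: rho_eq)

lemma slow_comp_rho: "slow a \<Longrightarrow> slow (a \<circ> \<rho>)"
  unfolding rho_eq by (rule slow_comp[OF _ slow_ratio])

lemma grid_x: "grid x (exp h)"
  using grid_exp[OF h] by (simp add: x_def[abs_def])

lemma grid_rho_x: "grid (\<lambda>k. \<rho> (x k)) M"
  using grid_rho by (simp add: \<rho>_def x_def)

sublocale D: discrete_reiteration r0 q1 r1 w "\<lambda>k. ennreal (a1 (x k))" "\<lambda>k. ennreal (b1 (x k))" T \<rho>x \<delta>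
proof
  show "0 < r0" "0 < q1" "0 < r1" by (fact r0 q1 r1)+
  show "0 < \<delta>" using \<theta>0 h by (simp add: \<delta>_def)
  have h0: "0 < h" using h by simp
  obtain C where C: "C < top" "\<And>j k. - \<theta>0 * real_of_int (k - j) \<le> 0 \<Longrightarrow> w k \<le> C * geo (h * \<bar>- \<theta>0\<bar> / 2) j k * w j"
    using quasi_power_samples[OF b0 h0, of "- \<theta>0"] \<theta>0 unfolding w_def x_def by auto
  have "w j \<le> C * geo \<delta> j k * w k" if "k \<le> j" for j k
  proof -
    have "w j \<le> C * geo (h * \<bar>- \<theta>0\<bar> / 2) k j * w k" using that \<theta>0 by (intro C) simp
    also have "\<dots> \<le> C * geo \<delta> k j * w k"
      using \<theta>0 h by (intro mult_right_mono mult_left_mono geo_antimono) (auto simp: \<delta>_def)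
    finally show ?thesis by (simp add: geo_sym)
  qed
  then show "\<exists>C<top. \<forall>j k. k \<le> j \<longrightarrow> w j \<le> C * geo \<delta> j k * w k" using C(1) by blast
  obtain C where C: "C < top" "\<And>j k. (1 - \<theta>0) * real_of_int (k - j) \<le> 0 \<Longrightarrow> \<rho>x k \<le> C * geo (h * \<bar>1 - \<theta>0\<bar> / 2) j k * \<rho>x j"
    using quasi_power_samples[OF slow_ratio h0, of "1 - \<theta>0"] \<theta>0 unfolding \<rho>x_def rho_eq x_def by auto
  have "\<rho>x k \<le> C * geo \<delta> j k * \<rho>x j" if "k \<le> j" for j k
  proof -
    have "\<rho>x k \<le> C * geo (h * \<bar>1 - \<theta>0\<bar> / 2) j k * \<rho>x j" using that \<theta>0 by (intro C mult_nonneg_nonpos) auto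
    also have "\<dots> \<le> C * geo \<delta> j k * \<rho>x j"
      using \<theta>0 h by (intro mult_right_mono mult_left_mono geo_antimono) (auto simp: \<delta>_def)
    finally show ?thesis .
  qed
  then show "\<exists>C<top. \<forall>j k. k \<le> j \<longrightarrow> \<rho>x k \<le> C * geo \<delta> j k * \<rho>x j" using C(1) by blast
  show "\<exists>C<top. \<forall>j k. ennreal (b1 (x k)) \<le> C * geo (- \<epsilon>) j k * ennreal (b1 (x j))" if "0 < \<epsilon>" for \<epsilon>
    using slow_samples[OF b1 h0 that] by (simp add: x_def)
qed

lemma balance_eq: "w k = \<rho>x k * (ennreal (\<xi> (x k)) * T k)"
proof -
  have c: "0 < \<xi> (x k)" using slow_pos[OF \<xi>] by simp
  have "x k powr - \<theta>0 = x k powr (1 - \<theta>0) * x k powr - 1" by (simp only: powr_add[symmetric]) simp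
  then have "x k powr - \<theta>0 * b0 (x k) = \<rho> (x k) * (\<xi> (x k) * x k powr - 1)"
    using c by (simp add: rho_eq)
  then show ?thesis using c rho_pos[of "x k"]
    by (simp add: w_def \<rho>x_def T_def ennreal_mult'[symmetric])
qed

lemma chi_d_eq: "D.chi_d k = chi_seq r1 (\<lambda>m. ennreal (b1 (x m))) q1 (\<lambda>m. ennreal (a1 (x m))) k"
  by (simp add: D.chi_d_def D.N_def D.A_def D.B_def chi_seq_def)

sublocale D: discrete_reiteration_balanced r0 q1 r1 w "\<lambda>k. ennreal (a1 (x k))" "\<lambda>k. ennreal (b1 (x k))" T \<rho>x \<delta>
proof
  obtain D where D: "D < top" "\<And>k. ennreal (\<xi> (x k)) \<le> D * D.chi_d k" "\<And>k. D.chi_d k \<le> D * ennreal (\<xi> (x k))"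
    using chi_sampled unfolding x_def[symmetric] chi_d_eq by blast
  show "\<exists>C<top. \<forall>k. w k \<le> C * (\<rho>x k * (D.chi_d k * T k)) \<and> \<rho>x k * (D.chi_d k * T k) \<le> C * w k"
  proof (intro exI[of _ D] conjI D(1) allI)
    fix k
    have "\<rho>x k * (ennreal (\<xi> (x k)) * T k) \<le> \<rho>x k * (D * D.chi_d k * T k)" by (intro mult_left_mono mult_right_mono D) auto
    then show "w k \<le> D * (\<rho>x k * (D.chi_d k * T k))" unfolding balance_eq by (simp add: mult_ac)
    have "\<rho>x k * (D.chi_d k * T k) \<le> \<rho>x k * (D * ennreal (\<xi> (x k)) * T k)" by (intro mult_left_mono mult_right_mono D) auto
    then show "\<rho>x k * (D.chi_d k * T k) \<le> D * w k" unfolding balance_eq by (simp add: mult_ac)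
  qed
qed

lemma quasi_normed_A: "quasi_normed A0" "quasi_normed A1"
  using couple unfolding quasi_banach_couple_def quasi_banach_def by blast+

lemmas nonneg_A = quasi_normed_A[THEN quasi_normed_nonneg]

lemma X0_eq: "pts X0 = {f \<in> sum_pts A0 A1. interp_norm \<theta>0 r0 b0 A0 A1 f < top}"
    "qnorm X0 f = enn2real (interp_norm \<theta>0 r0 b0 A0 A1 f)"
  by (simp_all add: X0_def interp_def finite_space_def interp_norm_def)

lemma X1_eq: "pts X1 = {f \<in> sum_pts A0 A1. interp_L_norm 1 r1 b1 q1 a1 A0 A1 f < top}"
    "qnorm X1 f = enn2real (interp_L_norm 1 r1 b1 q1 a1 A0 A1 f)"
  by (simp_all add: X1_def interp_L_def finite_space_def interp_L_norm_def)

lemma nonneg_X: "nonneg_norm X0" "nonneg_norm X1"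
  by (simp_all add: nonneg_norm_def X0_eq X1_eq)

lemma sum_X_subset: "sum_pts X0 X1 \<subseteq> sum_pts A0 A1"
proof
  fix f assume "f \<in> sum_pts X0 X1"
  then obtain f0 f1 where "f = f0 + f1" "f0 \<in> sum_pts A0 A1" "f1 \<in> sum_pts A0 A1"
    by (auto simp: sum_pts_def[of X0 X1] X0_eq X1_eq)
  then obtain g0 g1 h0 h1 where g: "f = (g0 + g1) + (h0 + h1)" "g0 \<in> pts A0" "h0 \<in> pts A0" "g1 \<in> pts A1" "h1 \<in> pts A1"
    by (auto simp: sum_pts_def)
  then have "f = (g0 + h0) + (g1 + h1)" "g0 + h0 \<in> pts A0" "g1 + h1 \<in> pts A1"
    using quasi_normed_A by (auto simp: quasi_normed_def subspace_def)
  then show "f \<in> sum_pts A0 A1" unfolding sum_pts_def by blast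
qed

lemma kernel_sample: "0 \<le> c \<Longrightarrow> ennreal (c * K_fun A0 A1 (x k) f) = ennreal c * \<kappa> f k"
  by (simp add: \<kappa>_def ennreal_mult')

lemma weight_nonneg: "0 \<le> x k powr - \<theta>0 * b0 (x k)" "0 \<le> x k powr - 1 * a1 (x k)"
  by (intro mult_nonneg_nonneg powr_ge_zero less_imp_le[OF slow_pos[OF b0]] less_imp_le[OF slow_pos[OF a1]] x_pos(1))+

lemma norm0_sampled:
  "\<exists>C<top. \<forall>f\<in>sum_pts A0 A1. interp_norm \<theta>0 r0 b0 A0 A1 f \<asymp>[C] D.norm0 (\<kappa> f)"
  using interp_sampled[OF nonneg_A grid_x r0 b0, of \<theta>0]
  by (simp only: kernel_sample weight_nonneg w_def[symmetric] D.norm0_def[symmetric])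

lemma a1_kernel: "ennreal (x j powr - 1 * a1 (x j) * K_fun A0 A1 (x j) f) = ennreal (a1 (x j)) * (T j * \<kappa> f j)"
proof -
  have "ennreal (a1 (x j) * x j powr - 1) = ennreal (a1 (x j)) * T j"
    unfolding T_def using slow_pos[OF a1, of "x j"] by (intro ennreal_mult') simp
  then show ?thesis
    unfolding kernel_sample[OF weight_nonneg(2)] by (simp only: mult.commute[of "a1 (x j)"] mult.assoc)
qed

lemma norm1_sampled:
  "\<exists>C<top. \<forall>f\<in>sum_pts A0 A1. interp_L_norm 1 r1 b1 q1 a1 A0 A1 f \<asymp>[C] D.norm1 (\<kappa> f)"
  using interp_L_sampled[OF nonneg_A grid_x q1 r1 a1 b1, of 1]
  by (simp only: a1_kernel D.norm1_def[symmetric])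

lemma kappa_le: "K_fun A0 A1 (x j) f \<le> c * K_fun A0 A1 (x k) g \<Longrightarrow> 0 \<le> c \<Longrightarrow> \<kappa> f j \<le> ennreal c * \<kappa> g k"
  by (simp add: \<kappa>_def ennreal_mult'[symmetric] ennreal_leI)

lemma T_kappa: "T j * \<kappa> f j = ennreal (K_fun A0 A1 (x j) f / x j)"
  by (simp add: T_def \<kappa>_def powr_minus_divide ennreal_mult'[symmetric])

lemma T_kappa_antimono:
  assumes f: "f \<in> sum_pts A0 A1" shows "antimono (\<lambda>j. T j * \<kappa> f j)"
proof (rule antimonoI)
  fix i j :: int assume "i \<le> j"
  then have "K_fun A0 A1 (x j) f \<le> x j / x i * K_fun A0 A1 (x i) f"
    by (intro K_fun_concave[OF nonneg_A f] x_pos(1) grid_mono[OF grid_x])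
  then show "T j * \<kappa> f j \<le> T i * \<kappa> f i"
    using x_pos[of i] x_pos[of j] unfolding T_kappa by (intro ennreal_leI) (simp add: field_simps)
qed

text \<open>The right-hand side of Holmstedt's formula at the \<open>k\<close>-th grid point.\<close>

definition "PR f k = D.P (\<kappa> f) k + \<rho>x k * D.R (\<kappa> f) k"

text \<open>Each of \<open>P\<close> and \<open>R\<close> is quasi-subadditive, so the bound holds for every decomposition and passes to the
  infimum.\<close>

lemma K_lower: "\<exists>C<top. \<forall>f\<in>sum_pts X0 X1. \<forall>k. PR f k \<le> C * ennreal (K_fun X0 X1 (\<rho> (x k)) f)"
proof -
  obtain M' where M': "1 \<le> M'" and tri: "\<forall>f\<in>sum_pts A0 A1. \<forall>g\<in>sum_pts A0 A1. \<forall>c. \<forall>t>0. \<bar>c\<bar> = 1 \<longrightarrow>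
    K_fun A0 A1 t (f + c *\<^sub>R g) \<le> M' * (K_fun A0 A1 t f + K_fun A0 A1 t g)"
    using K_fun_quasi_triangle[OF quasi_normed_A] by blast
  obtain C1 where C1: "C1 < top" "\<forall>f f0 f1 k. (\<forall>j. f j \<le> ennreal M' * (f0 j + f1 j)) \<longrightarrow> antimono (\<lambda>j. T j * f1 j) \<longrightarrow>
     D.P f k + \<rho>x k * D.R f k \<le> C1 * (D.norm0 f0 + \<rho>x k * D.norm1 f1)"
    using D.holmstedt_lower[of "ennreal M'", OF ennreal_less_top] by blast
  obtain E0 where E0: "E0 < top" "\<And>f. f \<in> sum_pts A0 A1 \<Longrightarrow> D.norm0 (\<kappa> f) \<le> E0 * interp_norm \<theta>0 r0 b0 A0 A1 f"
    using norm0_sampled by blast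
  obtain E1 where E1: "E1 < top" "\<And>f. f \<in> sum_pts A0 A1 \<Longrightarrow> D.norm1 (\<kappa> f) \<le> E1 * interp_L_norm 1 r1 b1 q1 a1 A0 A1 f"
    using norm1_sampled by blast
  define c where "c = enn2real (C1 * (E0 + E1)) + 1"
  have c: "0 < c" "C1 * (E0 + E1) \<le> ennreal c"
  proof -
    have "C1 * (E0 + E1) < top" using C1(1) E0(1) E1(1) by (simp add: ennreal_mult_less_top)
    then have "C1 * (E0 + E1) = ennreal (enn2real (C1 * (E0 + E1)))" by simp
    also have "\<dots> \<le> ennreal c" by (intro ennreal_leI) (simp add: c_def)
    finally show "C1 * (E0 + E1) \<le> ennreal c" .
    show "0 < c" by (simp add: c_def add_nonneg_pos)
  qed
  have dec: "PR f k \<le> ennreal (c * (qnorm X0 f0 + \<rho> (x k) * qnorm X1 f1))"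
    if f: "f0 \<in> pts X0" "f1 \<in> pts X1" "f = f0 + f1" for f f0 f1 k
  proof -
    have s: "f0 \<in> sum_pts A0 A1" "f1 \<in> sum_pts A0 A1"
      and fin: "interp_norm \<theta>0 r0 b0 A0 A1 f0 < top" "interp_L_norm 1 r1 b1 q1 a1 A0 A1 f1 < top"
      using f by (auto simp: X0_eq X1_eq)
    have "\<kappa> f j \<le> ennreal M' * (\<kappa> f0 j + \<kappa> f1 j)" for j
    proof -
      have "K_fun A0 A1 (x j) f \<le> M' * (K_fun A0 A1 (x j) f0 + K_fun A0 A1 (x j) f1)"
        using tri[rule_format, OF s x_pos(1)[of j], of 1] f(3) by simp
      then show ?thesis using M' K_fun_nonneg[OF nonneg_A s(1), of "x j"] K_fun_nonneg[OF nonneg_A s(2), of "x j"]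
        by (simp add: \<kappa>_def ennreal_mult'[symmetric] ennreal_plus[symmetric] ennreal_leI less_imp_le del: ennreal_plus)
    qed
    then have "PR f k \<le> C1 * (D.norm0 (\<kappa> f0) + \<rho>x k * D.norm1 (\<kappa> f1))"
      unfolding PR_def by (intro C1(2)[rule_format] T_kappa_antimono s) auto
    also have "\<dots> \<le> C1 * (E0 * interp_norm \<theta>0 r0 b0 A0 A1 f0 + \<rho>x k * (E1 * interp_L_norm 1 r1 b1 q1 a1 A0 A1 f1))"
      by (intro mult_left_mono add_mono E0 E1 s) auto
    also have "\<dots> = C1 * (E0 * ennreal (qnorm X0 f0) + E1 * (\<rho>x k * ennreal (qnorm X1 f1)))"
      using fin by (simp add: X0_eq X1_eq mult.left_commute)
    also have "\<dots> \<le> C1 * ((E0 + E1) * (ennreal (qnorm X0 f0) + \<rho>x k * ennreal (qnorm X1 f1)))"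
      by (intro mult_left_mono) (auto simp: distrib_left distrib_right add.assoc intro!: add_mono add_increasing)
    also have "\<dots> \<le> ennreal c * (ennreal (qnorm X0 f0) + \<rho>x k * ennreal (qnorm X1 f1))"
      unfolding mult.assoc[symmetric] by (intro mult_right_mono c) auto
    also have "\<dots> = ennreal (c * (qnorm X0 f0 + \<rho> (x k) * qnorm X1 f1))"
      using c rho_pos[of "x k"]
      by (simp add: \<rho>x_def ennreal_mult' X0_eq X1_eq ennreal_plus)
    finally show ?thesis .
  qed
  have "PR f k \<le> ennreal c * ennreal (K_fun X0 X1 (\<rho> (x k)) f)" if f: "f \<in> sum_pts X0 X1" for f k
  proof -
    obtain f0 f1 where "f0 \<in> pts X0" "f1 \<in> pts X1" "f = f0 + f1" using f by (auto simp: sum_pts_def)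
    then have fin: "PR f k < top" using dec le_less_trans ennreal_less_top by blast
    have "enn2real (PR f k) / c \<le> K_fun X0 X1 (\<rho> (x k)) f"
    proof (rule K_fun_ge[OF nonneg_X f])
      fix f0 f1 assume d: "f0 \<in> pts X0" "f1 \<in> pts X1" "f = f0 + f1"
      have n: "0 \<le> c * (qnorm X0 f0 + \<rho> (x k) * qnorm X1 f1)"
        using c rho_pos[of "x k"] by (simp add: X0_eq X1_eq)
      have "enn2real (PR f k) \<le> enn2real (ennreal (c * (qnorm X0 f0 + \<rho> (x k) * qnorm X1 f1)))"
        by (intro enn2real_mono dec[OF d]) simp
      then show "enn2real (PR f k) / c \<le> qnorm X0 f0 + \<rho> (x k) * qnorm X1 f1"
        using n c by (simp add: field_simps)
    qed
    then have "enn2real (PR f k) \<le> c * K_fun X0 X1 (\<rho> (x k)) f" using c by (simp add: field_simps)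
    then have "ennreal (enn2real (PR f k)) \<le> ennreal (c * K_fun X0 X1 (\<rho> (x k)) f)" by (rule ennreal_leI)
    then show ?thesis using fin c by (simp add: ennreal_mult')
  qed
  then show ?thesis by (intro exI[of _ "ennreal c"]) auto
qed

text \<open>Finiteness of the right-hand side at one point already puts \<open>f\<close> into \<open>X0 + X1\<close>; this yields the inclusions
  of the spaces on the right of the theorem.\<close>

lemma K_upper:
  "\<exists>C<top. \<forall>f\<in>sum_pts A0 A1. \<forall>k. PR f k < top \<longrightarrow>
     f \<in> sum_pts X0 X1 \<and> ennreal (K_fun X0 X1 (\<rho> (x k)) f) \<le> C * PR f k"
proof -
  obtain M' where M': "1 \<le> M'" and good: "\<forall>f\<in>sum_pts A0 A1. \<forall>t>0. \<exists>f0 f1. f0 \<in> pts A0 \<and> f1 \<in> pts A1 \<and> f = f0 + f1 \<and>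
    (\<forall>u>0. K_fun A0 A1 u f0 \<le> M' * K_fun A0 A1 t f \<and> K_fun A0 A1 u f1 \<le> M' * (u / t * K_fun A0 A1 t f) \<and>
       (u \<le> t \<longrightarrow> K_fun A0 A1 u f0 \<le> M' * K_fun A0 A1 u f) \<and> (t \<le> u \<longrightarrow> K_fun A0 A1 u f1 \<le> M' * K_fun A0 A1 u f))"
    using good_decomposition[OF couple] by blast
  obtain C1 where C1: "C1 < top" "\<forall>f f0 f1 k. (\<forall>j\<le>k. f0 j \<le> ennreal M' * f j) \<longrightarrow> (\<forall>j\<ge>k. f0 j \<le> ennreal M' * f k) \<longrightarrow>
     (\<forall>j\<ge>k. f1 j \<le> ennreal M' * f j) \<longrightarrow> (\<forall>j\<le>k. T j * f1 j \<le> ennreal M' * (T k * f k)) \<longrightarrow>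
     D.norm0 f0 + \<rho>x k * D.norm1 f1 \<le> C1 * (D.P f k + \<rho>x k * D.R f k)"
    using D.holmstedt_upper[of "ennreal M'", OF ennreal_less_top] by blast
  obtain E0 where E0: "E0 < top" "\<And>f. f \<in> sum_pts A0 A1 \<Longrightarrow> interp_norm \<theta>0 r0 b0 A0 A1 f \<le> E0 * D.norm0 (\<kappa> f)"
    using norm0_sampled by blast
  obtain E1 where E1: "E1 < top" "\<And>f. f \<in> sum_pts A0 A1 \<Longrightarrow> interp_L_norm 1 r1 b1 q1 a1 A0 A1 f \<le> E1 * D.norm1 (\<kappa> f)"
    using norm1_sampled by blast
  have z: "0 \<in> pts A0" "0 \<in> pts A1" using quasi_normed_A by (auto simp: quasi_normed_def subspace_def)
  let ?C = "(E0 + E1) * C1"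
  have "f \<in> sum_pts X0 X1 \<and> ennreal (K_fun X0 X1 (\<rho> (x k)) f) \<le> ?C * PR f k"
    if f: "f \<in> sum_pts A0 A1" and fin: "PR f k < top" for f k
  proof -
    obtain f0 f1 where d: "f0 \<in> pts A0" "f1 \<in> pts A1" "f = f0 + f1"
      and g: "\<And>u. 0 < u \<Longrightarrow> K_fun A0 A1 u f0 \<le> M' * K_fun A0 A1 (x k) f \<and> K_fun A0 A1 u f1 \<le> M' * (u / x k * K_fun A0 A1 (x k) f) \<and>
       (u \<le> x k \<longrightarrow> K_fun A0 A1 u f0 \<le> M' * K_fun A0 A1 u f) \<and> (x k \<le> u \<longrightarrow> K_fun A0 A1 u f1 \<le> M' * K_fun A0 A1 u f)"
      using good[THEN bspec, OF f, THEN spec, THEN mp, OF x_pos(1)[of k]] by blast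
    have s: "f0 \<in> sum_pts A0 A1" "f1 \<in> sum_pts A0 A1"
      using d z unfolding sum_pts_def by (force intro: exI[of _ 0])+
    have M0: "0 \<le> M'" using M' by simp
    have n1: "D.norm0 (\<kappa> f0) + \<rho>x k * D.norm1 (\<kappa> f1) \<le> C1 * PR f k"
      unfolding PR_def
    proof (intro C1(2)[rule_format])
      fix j :: int assume j: "j \<le> k"
      then show "\<kappa> f0 j \<le> ennreal M' * \<kappa> f j" using g[of "x j"] grid_mono[OF grid_x j] M0 by (intro kappa_le) auto
      have "K_fun A0 A1 (x j) f1 / x j \<le> M' * (K_fun A0 A1 (x k) f / x k)"
        using g[of "x j"] x_pos[of j] x_pos[of k] by (simp add: field_simps)
      then show "T j * \<kappa> f1 j \<le> ennreal M' * (T k * \<kappa> f k)"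
        unfolding T_kappa using M0 by (simp add: ennreal_mult'[symmetric] ennreal_leI)
    next
      fix j assume j: "k \<le> j"
      show "\<kappa> f0 j \<le> ennreal M' * \<kappa> f k" using g[of "x j"] M0 by (intro kappa_le) auto
      show "\<kappa> f1 j \<le> ennreal M' * \<kappa> f j" using g[of "x j"] grid_mono[OF grid_x j] M0 by (intro kappa_le) auto
    qed
    have n2: "interp_norm \<theta>0 r0 b0 A0 A1 f0 + \<rho>x k * interp_L_norm 1 r1 b1 q1 a1 A0 A1 f1
       \<le> (E0 + E1) * (D.norm0 (\<kappa> f0) + \<rho>x k * D.norm1 (\<kappa> f1))" (is "?N0 + \<rho>x k * ?N1 \<le> _")
    proof -
      have "?N0 + \<rho>x k * ?N1 \<le> E0 * D.norm0 (\<kappa> f0) + \<rho>x k * (E1 * D.norm1 (\<kappa> f1))"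
        by (intro add_mono mult_left_mono E0 E1 s) auto
      also have "\<dots> = E0 * D.norm0 (\<kappa> f0) + E1 * (\<rho>x k * D.norm1 (\<kappa> f1))" by (simp add: mult_ac)
      also have "\<dots> \<le> (E0 + E1) * (D.norm0 (\<kappa> f0) + \<rho>x k * D.norm1 (\<kappa> f1))"
        by (auto simp: distrib_left distrib_right add.assoc intro!: add_mono add_increasing)
      finally show ?thesis .
    qed
    have N: "?N0 + \<rho>x k * ?N1 \<le> ?C * PR f k"
      unfolding mult.assoc by (rule order_trans[OF n2 mult_left_mono[OF n1]]) simp
    also have "\<dots> < top" using fin E0(1) E1(1) C1(1) by (auto simp: ennreal_mult_less_top)
    finally have fin2: "?N0 < top" "\<rho>x k * ?N1 < top" by auto
    then have fin3: "?N1 < top" using rho_pos[of "x k"] by (auto simp: \<rho>x_def ennreal_mult_less_top)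
    have m: "f0 \<in> pts X0" "f1 \<in> pts X1" using s fin2 fin3 by (simp_all add: X0_eq X1_eq)
    have "K_fun X0 X1 (\<rho> (x k)) f \<le> qnorm X0 f0 + \<rho> (x k) * qnorm X1 f1"
      using K_fun_le[OF nonneg_X m, of "\<rho> (x k)"] rho_pos[of "x k"] d(3) by simp
    then have "ennreal (K_fun X0 X1 (\<rho> (x k)) f) \<le> ennreal (qnorm X0 f0 + \<rho> (x k) * qnorm X1 f1)" by (rule ennreal_leI)
    also have "\<dots> = ?N0 + \<rho>x k * ?N1"
      using fin2 fin3 rho_pos[of "x k"] by (simp add: X0_eq X1_eq \<rho>x_def ennreal_mult' ennreal_plus)
    also note N
    finally show ?thesis using m d(3) by (auto simp: sum_pts_def)
  qed
  then show ?thesis using E0(1) E1(1) C1(1) by (intro exI[of _ ?C]) (auto simp: ennreal_mult_less_top)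
qed

end

section \<open>The reiteration theorem\<close>

text \<open>Domination up to a constant that does not depend on the element.  With its transitivity the parts of
  the theorem become chains of the estimates proved so far.\<close>

definition dominated :: "('a \<Rightarrow> ennreal) \<Rightarrow> 'a set \<Rightarrow> ('a \<Rightarrow> ennreal) \<Rightarrow> bool" ("(_/ \<lesssim>[_] _)" [51, 0, 51] 50) where
  "F \<lesssim>[S] G \<longleftrightarrow> (\<exists>C<top. \<forall>f\<in>S. F f \<le> C * G f)"

lemma dominated_le: "(\<And>f. f \<in> S \<Longrightarrow> F f \<le> G f) \<Longrightarrow> F \<lesssim>[S] G"
  unfolding dominated_def by (intro exI[of _ 1]) auto

lemma dominated_subset: "F \<lesssim>[T] G \<Longrightarrow> S \<subseteq> T \<Longrightarrow> F \<lesssim>[S] G"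
  unfolding dominated_def by blast

lemma dominated_trans [trans]:
  assumes "F \<lesssim>[S] G" "G \<lesssim>[S] H" shows "F \<lesssim>[S] H"
proof -
  obtain C D where C: "C < top" "\<forall>f\<in>S. F f \<le> C * G f" and D: "D < top" "\<forall>f\<in>S. G f \<le> D * H f"
    using assms unfolding dominated_def by blast
  have "F f \<le> C * D * H f" if "f \<in> S" for f
    using order_trans[OF C(2)[rule_format, OF that] mult_left_mono[OF D(2)[rule_format, OF that]]]
    by (simp add: mult.assoc)
  then show ?thesis using C(1) D(1) unfolding dominated_def
    by (intro exI[of _ "C * D"]) (auto simp: ennreal_mult_less_top)
qed

lemma dominated_add:
  assumes "F \<lesssim>[S] H" "G \<lesssim>[S] H" shows "(\<lambda>f. F f + G f) \<lesssim>[S] H"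
proof -
  obtain C D where "C < top" "\<forall>f\<in>S. F f \<le> C * H f" "D < top" "\<forall>f\<in>S. G f \<le> D * H f"
    using assms unfolding dominated_def by blast
  then show ?thesis unfolding dominated_def
    by (intro exI[of _ "C + D"]) (auto simp: distrib_right intro: add_mono)
qed

lemma dominated_of_comparable:
  assumes "\<exists>D<top. \<forall>f\<in>S. F f \<asymp>[D] G f" shows "F \<lesssim>[S] G" "G \<lesssim>[S] F"
  using assms unfolding dominated_def by blast+

lemma lq_dominated:
  assumes r: "0 < r" and "\<exists>C<top. \<forall>f\<in>S. \<forall>k. F f k \<le> C * G f k"
  shows "(\<lambda>f. lq r UNIV (\<lambda>k. c k * F f k)) \<lesssim>[S] (\<lambda>f. lq r UNIV (\<lambda>k. c k * G f k))"
proof -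
  obtain C where C: "C < top" "\<And>f k. f \<in> S \<Longrightarrow> F f k \<le> C * G f k" using assms(2) by blast
  have "c k * F f k \<le> C * (c k * G f k)" if "f \<in> S" for f k
    using mult_left_mono[OF C(2)[OF that, of k], of "c k"] by (simp add: mult_ac)
  then show ?thesis using C(1) unfolding dominated_def by (intro exI[of _ C] conjI ballI lq_le r) auto
qed

text \<open>The values of the quasi-norms are real, so an estimate between extended quasi-norms gives an
  embedding only where both are finite.\<close>

lemma embedded_finite:
  assumes X: "pts X = {f \<in> S. F f < top}" "\<And>f. f \<in> pts X \<Longrightarrow> qnorm X f = enn2real (F f)"
    and Y: "pts Y = {f \<in> S'. G f < top}" "\<And>f. f \<in> pts Y \<Longrightarrow> qnorm Y f = enn2real (G f)"
    and sub: "pts X \<subseteq> S'" and dom: "G \<lesssim>[pts X] F"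
  shows "embedded X Y"
proof -
  obtain C where C: "C < top" "\<And>f. f \<in> pts X \<Longrightarrow> G f \<le> C * F f" using dom unfolding dominated_def by blast
  have "f \<in> pts Y \<and> qnorm Y f \<le> enn2real C * qnorm X f" if f: "f \<in> pts X" for f
  proof -
    have fin: "C * F f < top" using f C(1) X(1) by (simp add: ennreal_mult_less_top)
    then have "f \<in> pts Y" using le_less_trans[OF C(2)[OF f]] f sub Y(1) by auto
    then show ?thesis
      using enn2real_mono[OF C(2)[OF f] fin] X(2)[OF f] Y(2) by (simp add: enn2real_mult)
  qed
  then show ?thesis unfolding embedded_def by blast
qed

context reiteration
begin

text \<open>Samples of a quasi-power of order \<open>\<sigma> (1 - \<theta>0)\<close>, which decays or grows geometrically according to the sign of
  \<open>\<sigma>\<close>.\<close>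

definition "rho_weight \<sigma> a k = ennreal (\<rho> (x k) powr \<sigma> * a (\<rho> (x k)))"

lemma rho_weight_shift: "rho_weight (\<sigma> - 1) a k * \<rho>x k = rho_weight \<sigma> a k"
proof -
  have p: "0 < \<rho> (x k)" by (rule rho_pos) simp
  have "\<rho> (x k) powr \<sigma> = \<rho> (x k) powr (\<sigma> - 1) * \<rho> (x k)"
    using p powr_add[of "\<rho> (x k)" "\<sigma> - 1" 1] by simp
  then show ?thesis using p by (simp add: rho_weight_def \<rho>x_def ennreal_mult''[symmetric] ennreal_mult'[symmetric] mult_ac)
qed

lemma rho_weight_geometric:
  assumes a: "slow a" and \<sigma>: "\<sigma> \<noteq> 0"
  shows "\<exists>C<top. \<forall>j k. \<sigma> * real_of_int (k - j) \<le> 0 \<longrightarrow> rho_weight \<sigma> a k \<le> C * geo (h * \<bar>\<sigma> * (1 - \<theta>0)\<bar> / 2) j k * rho_weight \<sigma> a j"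
proof -
  have s: "slow (\<lambda>t. (b0 t / \<xi> t) powr \<sigma> * (a \<circ> \<rho>) t)"
    by (intro slow_mult slow_powr slow_ratio slow_comp_rho a)
  have eq: "rho_weight \<sigma> a k = ennreal (x k powr (\<sigma> * (1 - \<theta>0)) * ((b0 (x k) / \<xi> (x k)) powr \<sigma> * (a \<circ> \<rho>) (x k)))" for k
  proof -
    have "\<rho> (x k) powr \<sigma> = x k powr (\<sigma> * (1 - \<theta>0)) * (b0 (x k) / \<xi> (x k)) powr \<sigma>"
      using slow_pos[OF slow_ratio, of "x k"] unfolding rho_eq
      by (subst powr_mult) (simp_all add: powr_powr mult.commute)
    then show ?thesis by (simp add: rho_weight_def mult.assoc)
  qed
  have h0: "0 < h" using h by simp
  obtain C where C: "C < top" "\<And>j k. \<sigma> * (1 - \<theta>0) * real_of_int (k - j) \<le> 0 \<Longrightarrow> rho_weight \<sigma> a k \<le> C * geo (h * \<bar>\<sigma> * (1 - \<theta>0)\<bar> / 2) j k * rho_weight \<sigma> a j"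
    using quasi_power_samples[OF s h0, of "\<sigma> * (1 - \<theta>0)"] \<sigma> \<theta>0 unfolding eq x_def by auto
  have "\<sigma> * (1 - \<theta>0) * real_of_int (k - j) \<le> 0" if "\<sigma> * real_of_int (k - j) \<le> 0" for j k
  proof -
    have "(1 - \<theta>0) * (\<sigma> * real_of_int (k - j)) \<le> 0" by (rule mult_nonneg_nonpos[OF _ that]) (use \<theta>0 in simp)
    then show ?thesis by (simp add: mult_ac)
  qed
  then show ?thesis using C by blast
qed

text \<open>The norm of \<open>f\<close> with parameter \<open>\<theta>\<close> after Holmstedt's formula, its two parts, and the norm of the
  last term of \<open>P\<close>, to which Hardy's inequality reduces the parts.\<close>

definition "norm_PR \<theta> r a f = lq r UNIV (\<lambda>k. rho_weight (- \<theta>) a k * PR f k)"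
definition "norm_P \<theta> r a f = lq r UNIV (\<lambda>k. rho_weight (- \<theta>) a k * D.P (\<kappa> f) k)"
definition "norm_R \<theta> r a f = lq r UNIV (\<lambda>k. rho_weight (- \<theta>) a k * (\<rho>x k * D.R (\<kappa> f) k))"
definition "norm_w \<theta> r a f = lq r UNIV (\<lambda>k. rho_weight (- \<theta>) a k * (w k * \<kappa> f k))"

lemma norm_PR_dominated:
  assumes r: "0 < r" and "norm_P \<theta> r a \<lesssim>[S] N" "norm_R \<theta> r a \<lesssim>[S] N" shows "norm_PR \<theta> r a \<lesssim>[S] N"
proof -
  obtain C where C: "C < top" "\<And>S u v. lq r S (\<lambda>k. u k + v k) \<le> C * (lq r S u + lq r S v)"
    using lq_add[OF r] by blast
  have "rho_weight (- \<theta>) a k * PR f k = rho_weight (- \<theta>) a k * D.P (\<kappa> f) k + rho_weight (- \<theta>) a k * (\<rho>x k * D.R (\<kappa> f) k)" for f k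
    by (simp add: PR_def distrib_left)
  then have "norm_PR \<theta> r a \<lesssim>[S] (\<lambda>f. norm_P \<theta> r a f + norm_R \<theta> r a f)"
    using C(1) unfolding dominated_def norm_PR_def norm_P_def norm_R_def by (simp only:) (intro exI[of _ C] conjI ballI C)
  also note dominated_add[OF assms(2,3)]
  finally show ?thesis .
qed

lemma parts_dominated:
  assumes "0 < r"
  shows "norm_P \<theta> r a \<lesssim>[S] norm_PR \<theta> r a" "norm_R \<theta> r a \<lesssim>[S] norm_PR \<theta> r a" "norm_w \<theta> r a \<lesssim>[S] norm_P \<theta> r a"
proof -
  show "norm_P \<theta> r a \<lesssim>[S] norm_PR \<theta> r a" "norm_R \<theta> r a \<lesssim>[S] norm_PR \<theta> r a"
    unfolding norm_PR_def norm_P_def norm_R_def PR_def by (intro dominated_le lq_mono assms mult_left_mono; simp)+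
  show "norm_w \<theta> r a \<lesssim>[S] norm_P \<theta> r a"
    unfolding norm_w_def norm_P_def D.P_def
    by (intro dominated_le lq_mono assms mult_left_mono lq_ge_point[where x="\<lambda>j. w j * \<kappa> f j" for f] r0) auto
qed

lemma norm_P_le_norm_w:
  assumes r: "0 < r" and a: "slow a" and \<theta>: "0 < \<theta>"
  shows "norm_P \<theta> r a \<lesssim>[UNIV] norm_w \<theta> r a"
proof -
  obtain C0 where C0: "C0 < top" "\<And>j k. - \<theta> * real_of_int (k - j) \<le> 0 \<Longrightarrow> rho_weight (- \<theta>) a k \<le> C0 * geo (h * \<bar>- \<theta> * (1 - \<theta>0)\<bar> / 2) j k * rho_weight (- \<theta>) a j"
    using rho_weight_geometric[OF a, of "- \<theta>"] \<theta> by auto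
  have p: "0 < h * \<bar>- \<theta> * (1 - \<theta>0)\<bar> / 2" using h \<theta> \<theta>0 by (simp add: zero_less_mult_iff)
  have "\<exists>C<top. \<forall>p. lq r UNIV (\<lambda>k. rho_weight (- \<theta>) a k * lq r0 {..k} p) \<le> C * lq r UNIV (\<lambda>k. rho_weight (- \<theta>) a k * p k)"
  proof (rule hardy_left[OF p r0 r C0(1)])
    fix j k :: int assume "j \<le> k"
    then have "- \<theta> * real_of_int (k - j) \<le> 0" using \<theta> by simp
    then show "rho_weight (- \<theta>) a k \<le> C0 * geo (h * \<bar>- \<theta> * (1 - \<theta>0)\<bar> / 2) j k * rho_weight (- \<theta>) a j" by (rule C0)
  qed
  then show ?thesis unfolding dominated_def norm_P_def norm_w_def D.P_def by blast
qed

lemma norm_R_le_norm_w: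
  assumes r: "0 < r" and a: "slow a" and \<theta>: "\<theta> < 1"
  shows "norm_R \<theta> r a \<lesssim>[UNIV] norm_w \<theta> r a"
proof -
  have e: "rho_weight (- \<theta>) a k * \<rho>x k = rho_weight (1 - \<theta>) a k" for k using rho_weight_shift[of "1 - \<theta>" a k] by simp
  obtain C0 where C0: "C0 < top" "\<And>j k. (1 - \<theta>) * real_of_int (k - j) \<le> 0 \<Longrightarrow> rho_weight (1 - \<theta>) a k \<le> C0 * geo (h * \<bar>(1 - \<theta>) * (1 - \<theta>0)\<bar> / 2) j k * rho_weight (1 - \<theta>) a j"
    using rho_weight_geometric[OF a, of "1 - \<theta>"] \<theta> by auto
  have p: "0 < h * \<bar>(1 - \<theta>) * (1 - \<theta>0)\<bar> / 2" using h \<theta> \<theta>0 by (simp add: zero_less_mult_iff)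
  have "\<exists>C<top. \<forall>f. lq r UNIV (\<lambda>k. rho_weight (- \<theta>) a k * (\<rho>x k * D.R f k)) \<le> C * lq r UNIV (\<lambda>k. rho_weight (- \<theta>) a k * (w k * f k))"
  proof (rule D.hardy_R[OF p r C0(1)])
    fix j k :: int assume "k \<le> j"
    then have "(1 - \<theta>) * real_of_int (k - j) \<le> 0" using \<theta> by (intro mult_nonneg_nonpos) auto
    then show "rho_weight (- \<theta>) a k * \<rho>x k \<le> C0 * geo (h * \<bar>(1 - \<theta>) * (1 - \<theta>0)\<bar> / 2) j k * (rho_weight (- \<theta>) a j * \<rho>x j)"
      unfolding e by (rule C0)
  qed
  then show ?thesis unfolding dominated_def norm_R_def norm_w_def by blast
qed

lemma reiterated_norm:
  assumes r: "0 < r" and a: "slow a"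
  shows "interp_norm \<theta> r a X0 X1 \<lesssim>[sum_pts X0 X1] norm_PR \<theta> r a" "norm_PR \<theta> r a \<lesssim>[sum_pts X0 X1] interp_norm \<theta> r a X0 X1"
proof -
  let ?S = "\<lambda>f. lq r UNIV (\<lambda>k. rho_weight (- \<theta>) a k * ennreal (K_fun X0 X1 (\<rho> (x k)) f))"
  have "0 \<le> \<rho> (x k) powr - \<theta> * a (\<rho> (x k))" for k
    using slow_pos[OF a rho_pos[of "x k"]] by simp
  then have S: "\<exists>D<top. \<forall>f\<in>sum_pts X0 X1. interp_norm \<theta> r a X0 X1 f \<asymp>[D] ?S f"
    using interp_sampled[OF nonneg_X grid_rho_x r a, of \<theta>] unfolding rho_weight_def by (simp only: ennreal_mult')
  obtain C where C: "C < top" "\<And>f k. f \<in> sum_pts X0 X1 \<Longrightarrow> PR f k \<le> C * ennreal (K_fun X0 X1 (\<rho> (x k)) f)"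
    using K_lower by blast
  have "PR f k < top" if "f \<in> sum_pts X0 X1" for f k
    by (rule le_less_trans[OF C(2)[OF that]]) (simp add: ennreal_mult_less_top C(1))
  then have "\<exists>C<top. \<forall>f\<in>sum_pts X0 X1. \<forall>k. ennreal (K_fun X0 X1 (\<rho> (x k)) f) \<le> C * PR f k"
    using K_upper sum_X_subset by blast
  from dominated_trans[OF dominated_of_comparable(1)[OF S] lq_dominated[OF r this]]
  show "interp_norm \<theta> r a X0 X1 \<lesssim>[sum_pts X0 X1] norm_PR \<theta> r a" unfolding norm_PR_def .
  from dominated_trans[OF lq_dominated[OF r K_lower] dominated_of_comparable(2)[OF S]]
  show "norm_PR \<theta> r a \<lesssim>[sum_pts X0 X1] interp_norm \<theta> r a X0 X1" unfolding norm_PR_def .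
qed

lemma norm_PR_finite_in_sum:
  assumes r: "0 < r" and a: "slow a" and f: "f \<in> sum_pts A0 A1" and fin: "norm_PR \<theta> r a f < top"
  shows "f \<in> sum_pts X0 X1"
proof -
  have "rho_weight (- \<theta>) a 0 * PR f 0 \<le> norm_PR \<theta> r a f"
    unfolding norm_PR_def by (rule lq_ge_point[where x="\<lambda>k. rho_weight (- \<theta>) a k * PR f k"]) (auto simp: r)
  then have "rho_weight (- \<theta>) a 0 * PR f 0 < top" using fin by (rule le_less_trans)
  moreover have "0 < rho_weight (- \<theta>) a 0"
    using slow_pos[OF a rho_pos, of "x 0"] rho_pos[of "x 0"] by (simp add: rho_weight_def)
  ultimately have "PR f 0 < top" by (auto simp: ennreal_mult_less_top)
  then show ?thesis using K_upper f by blast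
qed

text \<open>Pattern of the three parts of the theorem: it suffices to compare the extended quasi-norm of the
  target space with the sequence norm on all of \<open>A0 + A1\<close>.\<close>

lemma interp_X_eqI:
  assumes r: "0 < r" and a: "slow a"
    and Y: "pts Y = {f \<in> sum_pts A0 A1. N f < top}" "\<And>f. f \<in> pts Y \<Longrightarrow> qnorm Y f = enn2real (N f)"
    and N: "N \<lesssim>[sum_pts A0 A1] norm_PR \<theta> r a" "norm_PR \<theta> r a \<lesssim>[sum_pts A0 A1] N"
  shows "interp \<theta> r a X0 X1 \<cong> Y"
proof -
  let ?X = "interp \<theta> r a X0 X1"
  have X: "pts ?X = {f \<in> sum_pts X0 X1. interp_norm \<theta> r a X0 X1 f < top}" "\<And>f. qnorm ?X f = enn2real (interp_norm \<theta> r a X0 X1 f)"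
    by (simp_all add: interp_def finite_space_def interp_norm_def)
  have "pts ?X \<subseteq> sum_pts X0 X1" unfolding X(1) by blast
  note XA = this order_trans[OF this sum_X_subset]
  have YA: "pts Y \<subseteq> sum_pts A0 A1" unfolding Y(1) by blast
  have YX: "pts Y \<subseteq> sum_pts X0 X1"
  proof
    fix f assume "f \<in> pts Y"
    then have f: "f \<in> sum_pts A0 A1" "N f < top" using Y(1) by auto
    obtain C where "C < top" "norm_PR \<theta> r a f \<le> C * N f" using N(2) f(1) unfolding dominated_def by blast
    then have "norm_PR \<theta> r a f < top" using f(2) by (auto simp: ennreal_mult_less_top intro: le_less_trans)
    then show "f \<in> sum_pts X0 X1" by (rule norm_PR_finite_in_sum[OF r a f(1)])
  qed
  show ?thesis
    unfolding space_eq_def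
    using embedded_finite[OF X Y XA(2) dominated_trans[OF dominated_subset[OF N(1) XA(2)] dominated_subset[OF reiterated_norm(2)[OF r a] XA(1)]]]
      embedded_finite[OF Y X YX dominated_trans[OF dominated_subset[OF reiterated_norm(1)[OF r a] YX] dominated_subset[OF N(2) YA]]]
    by blast
qed

lemma slow_a_sharp:
  assumes a: "slow a" shows "slow (a_sharp \<theta> b0 \<xi> a \<rho>)"
proof (rule slow_cong)
  show "slow (\<lambda>t. b0 t powr (1 - \<theta>) * \<xi> t powr \<theta> * (a \<circ> \<rho>) t)"
    by (intro slow_mult slow_powr b0 \<xi> slow_comp_rho a)
qed (simp add: a_sharp_def)

text \<open>The weight \<open>a_sharp\<close> is exactly the product of the two weights: the powers of \<open>b0\<close>, of \<open>\<chi>\<close> and of \<open>t\<close> in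
  \<open>\<rho> powr (- \<theta>)\<close> combine with \<open>t powr (- \<theta>0) * b0\<close> to \<open>t powr (- \<eta>) * b0 powr (1 - \<theta>) * \<chi> powr \<theta>\<close>.\<close>

lemma norm_w_sampled:
  assumes r: "0 < r" and a: "slow a"
  shows "\<exists>C<top. \<forall>f\<in>sum_pts A0 A1.
    interp_norm ((1 - \<theta>) * \<theta>0 + \<theta>) r (a_sharp \<theta> b0 \<xi> a \<rho>) A0 A1 f
      \<asymp>[C] norm_w \<theta> r a f"
proof -
  let ?\<eta> = "(1 - \<theta>) * \<theta>0 + \<theta>"
  have "ennreal (x k powr - ?\<eta> * a_sharp \<theta> b0 \<xi> a \<rho> (x k) * K_fun A0 A1 (x k) f) = rho_weight (- \<theta>) a k * (w k * \<kappa> f k)" for k f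
  proof -
    have p: "0 < b0 (x k)" "0 < \<xi> (x k)" "0 < a (\<rho> (x k))"
      using slow_pos[OF b0] slow_pos[OF \<xi>] slow_pos[OF a rho_pos] by auto
    have "\<rho> (x k) powr - \<theta> = x k powr (- \<theta> * (1 - \<theta>0)) * (b0 (x k) powr - \<theta> * \<xi> (x k) powr \<theta>)"
      using p unfolding rho_eq
      by (subst powr_mult) (simp_all add: powr_powr powr_divide powr_minus_divide mult.commute)
    then have "(\<rho> (x k) powr - \<theta> * a (\<rho> (x k))) * (x k powr - \<theta>0 * b0 (x k))
        = (x k powr (- \<theta> * (1 - \<theta>0)) * x k powr - \<theta>0) * ((b0 (x k) powr - \<theta> * b0 (x k) powr 1) * \<xi> (x k) powr \<theta> * a (\<rho> (x k)))"
      using p by simp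
    also have "\<dots> = x k powr - ?\<eta> * a_sharp \<theta> b0 \<xi> a \<rho> (x k)"
      unfolding powr_add[symmetric] a_sharp_def by (simp add: algebra_simps)
    finally have eq: "x k powr - ?\<eta> * a_sharp \<theta> b0 \<xi> a \<rho> (x k) = (\<rho> (x k) powr - \<theta> * a (\<rho> (x k))) * (x k powr - \<theta>0 * b0 (x k))" ..
    have n: "0 \<le> \<rho> (x k) powr - \<theta> * a (\<rho> (x k))" using p by simp
    show ?thesis
      unfolding eq rho_weight_def w_def mult.assoc[of "ennreal _", symmetric] ennreal_mult'[OF n, symmetric]
      by (rule kernel_sample[OF mult_nonneg_nonneg[OF n weight_nonneg(1)]])
  qed
  then show ?thesis
    using interp_sampled[OF nonneg_A grid_x r slow_a_sharp[OF a, of \<theta>], of ?\<eta>] by (simp add: norm_w_def)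
qed

lemmas norm_w_dominated = dominated_of_comparable[OF norm_w_sampled]

theorem reiteration_interior:
  assumes r: "0 < r" and a: "slow a" and \<theta>: "0 < \<theta>" "\<theta> < 1"
  shows "interp \<theta> r a X0 X1 \<cong> interp ((1 - \<theta>) * \<theta>0 + \<theta>) r (a_sharp \<theta> b0 \<xi> a \<rho>) A0 A1"
proof (rule interp_X_eqI[OF r a])
  let ?A = "sum_pts A0 A1" and ?N = "interp_norm ((1 - \<theta>) * \<theta>0 + \<theta>) r (a_sharp \<theta> b0 \<xi> a \<rho>) A0 A1"
  show "pts (interp ((1 - \<theta>) * \<theta>0 + \<theta>) r (a_sharp \<theta> b0 \<xi> a \<rho>) A0 A1) = {f \<in> ?A. ?N f < top}"
    "qnorm (interp ((1 - \<theta>) * \<theta>0 + \<theta>) r (a_sharp \<theta> b0 \<xi> a \<rho>) A0 A1) f = enn2real (?N f)" for f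
    by (simp_all add: interp_def finite_space_def interp_norm_def)
  note norm_w_dominated(1)[OF r a]
  also note parts_dominated(3)[OF r]
  also note parts_dominated(1)[OF r]
  finally show "?N \<lesssim>[?A] norm_PR \<theta> r a" .
  have "norm_PR \<theta> r a \<lesssim>[?A] norm_w \<theta> r a"
    by (intro norm_PR_dominated r dominated_subset[OF norm_P_le_norm_w] dominated_subset[OF norm_R_le_norm_w] a \<theta>) auto
  also note norm_w_dominated(2)[OF r a]
  finally show "norm_PR \<theta> r a \<lesssim>[?A] ?N" .
qed

theorem reiteration_0:
  assumes r: "0 < r" and a: "slow a"
  shows "interp 0 r a X0 X1 \<cong> interp_L \<theta>0 r (a \<circ> \<rho>) r0 b0 A0 A1"
proof (rule interp_X_eqI[OF r a])
  let ?A = "sum_pts A0 A1" and ?N = "interp_L_norm \<theta>0 r (a \<circ> \<rho>) r0 b0 A0 A1"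
  show "pts (interp_L \<theta>0 r (a \<circ> \<rho>) r0 b0 A0 A1) = {f \<in> ?A. ?N f < top}"
    "qnorm (interp_L \<theta>0 r (a \<circ> \<rho>) r0 b0 A0 A1) f = enn2real (?N f)" for f
    by (simp_all add: interp_L_def finite_space_def interp_L_norm_def)
  have "ennreal ((a \<circ> \<rho>) (x k)) = rho_weight (- 0) a k" for k
    using rho_pos[of "x k"] by (simp add: rho_weight_def)
  then have "\<exists>D<top. \<forall>f\<in>?A. ?N f \<asymp>[D] norm_P 0 r a f"
    using interp_L_sampled[OF nonneg_A grid_x r0 r b0 slow_comp_rho[OF a], of \<theta>0]
    unfolding norm_P_def D.P_def by (simp only: kernel_sample weight_nonneg w_def[symmetric])
  note N = dominated_of_comparable[OF this]
  note N(1)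
  also note parts_dominated(1)[OF r]
  finally show "?N \<lesssim>[?A] norm_PR 0 r a" .
  have "norm_R 0 r a \<lesssim>[?A] norm_w 0 r a" by (rule dominated_subset[OF norm_R_le_norm_w[OF r a]]) auto
  also note parts_dominated(3)[OF r]
  finally have "norm_R 0 r a \<lesssim>[?A] norm_P 0 r a" .
  then have "norm_PR 0 r a \<lesssim>[?A] norm_P 0 r a" by (rule norm_PR_dominated[OF r dominated_le[OF order_refl]])
  also note N(2)
  finally show "norm_PR 0 r a \<lesssim>[?A] ?N" .
qed

theorem reiteration_1:
  assumes r: "0 < r" and a: "slow a"
  shows "interp 1 r a X0 X1 \<cong>
    inter_space (interp 1 r (a_sharp 1 b0 \<xi> a \<rho>) A0 A1) (interp_LR 1 r (a \<circ> \<rho>) r1 b1 q1 a1 A0 A1)"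
proof (rule interp_X_eqI[OF r a])
  let ?A = "sum_pts A0 A1"
  let ?N1 = "interp_norm 1 r (a_sharp 1 b0 \<xi> a \<rho>) A0 A1" and ?N2 = "interp_LR_norm 1 r (a \<circ> \<rho>) r1 b1 q1 a1 A0 A1"
  let ?Y = "inter_space (interp 1 r (a_sharp 1 b0 \<xi> a \<rho>) A0 A1) (interp_LR 1 r (a \<circ> \<rho>) r1 b1 q1 a1 A0 A1)"
  let ?N = "\<lambda>f. max (?N1 f) (?N2 f)"
  show Y: "pts ?Y = {f \<in> ?A. ?N f < top}"
    by (auto simp: inter_space_def interp_def interp_LR_def finite_space_def interp_norm_def interp_LR_norm_def)
  show "qnorm ?Y f = enn2real (?N f)" if "f \<in> pts ?Y" for f
  proof -
    have "?N1 f < top" "?N2 f < top" using that unfolding Y by auto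
    then have "enn2real (?N f) = max (enn2real (?N1 f)) (enn2real (?N2 f))"
      by (cases "?N1 f \<le> ?N2 f") (auto simp: max_def enn2real_mono dest: enn2real_mono intro: antisym)
    then show ?thesis
      by (simp add: inter_space_def interp_def interp_LR_def finite_space_def interp_norm_def interp_LR_norm_def)
  qed
  have N1: "?N1 \<lesssim>[?A] norm_w 1 r a" "norm_w 1 r a \<lesssim>[?A] ?N1" using norm_w_dominated[OF r a, of 1] by simp_all
  have "rho_weight (- 1) a k * \<rho>x k = ennreal ((a \<circ> \<rho>) (x k))" for k
    using rho_weight_shift[of 0 a k] rho_pos[of "x k"] by (simp add: rho_weight_def)
  then have "norm_R 1 r a f = lq r UNIV (\<lambda>k. ennreal ((a \<circ> \<rho>) (x k)) * D.R (\<kappa> f) k)" for f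
    by (simp only: norm_R_def mult.assoc[symmetric])
  then have "\<exists>D<top. \<forall>f\<in>?A. ?N2 f \<asymp>[D] norm_R 1 r a f"
    using interp_LR_sampled[OF nonneg_A grid_x q1 r1 r a1 b1 slow_comp_rho[OF a], of 1]
    by (simp only: D.R_def a1_kernel)
  note N2 = dominated_of_comparable[OF this]
  note le = dominated_le[of ?A _ ?N]
  have "?N \<lesssim>[?A] (\<lambda>f. ?N1 f + ?N2 f)" by (intro dominated_le) (auto simp: max_def)
  also have "\<dots> \<lesssim>[?A] norm_PR 1 r a"
    by (intro dominated_add dominated_trans[OF N1(1)] dominated_trans[OF N2(1)] dominated_trans[OF parts_dominated(3)]
        parts_dominated(1,2) r)
  finally show "?N \<lesssim>[?A] norm_PR 1 r a" .
  have "norm_P 1 r a \<lesssim>[?A] norm_w 1 r a" by (rule dominated_subset[OF norm_P_le_norm_w[OF r a]]) auto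
  also note N1(2)
  also have "?N1 \<lesssim>[?A] ?N" by (rule le) simp
  finally have P: "norm_P 1 r a \<lesssim>[?A] ?N" .
  have "?N2 \<lesssim>[?A] ?N" by (rule le) simp
  then show "norm_PR 1 r a \<lesssim>[?A] ?N" by (intro norm_PR_dominated r P dominated_trans[OF N2(2)])
qed

end

theorem theorem29:
  fixes A0 A1 :: "'v::real_vector qspace"
    and q1 r1 r r0 :: ennreal
    and a1 b1 a b0 :: "real \<Rightarrow> real"
    and \<theta>0 :: real
  assumes "quasi_banach_couple A0 A1" and "pts A0 \<inter> pts A1 \<noteq> {0}"
    and "0 < q1" and "0 < r1" and "a1 \<in> SV" and "b1 \<in> SV"
    and "sv_norm r1 b1 {1<..} < \<infinity>" and "nested_sv_norm r1 b1 q1 a1 1 < \<infinity>"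
    and "0 < \<theta>0" and "\<theta>0 < 1"
    and "0 < r" and "0 < r0" and "a \<in> SV" and "b0 \<in> SV"
  shows "let chi1 = chi r1 b1 q1 a1;
             \<rho> = rho \<theta>0 b0 chi1;
             X0 = interp \<theta>0 r0 b0 A0 A1;
             X1 = interp_L 1 r1 b1 q1 a1 A0 A1
         in (\<forall>\<theta>. 0 < \<theta> \<and> \<theta> < 1 \<longrightarrow>
               interp \<theta> r a X0 X1
                 \<cong> interp ((1 - \<theta>) * \<theta>0 + \<theta>) r (a_sharp \<theta> b0 chi1 a \<rho>) A0 A1) \<and>
            (sv_norm r a {1<..} < \<infinity> \<longrightarrow>
               interp 0 r a X0 X1 \<cong> interp_L \<theta>0 r (a \<circ> \<rho>) r0 b0 A0 A1) \<and>
            (sv_norm r a {0<..<1} < \<infinity> \<longrightarrow>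
               interp 1 r a X0 X1
                 \<cong> inter_space (interp 1 r (a_sharp 1 b0 chi1 a \<rho>) A0 A1)
                     (interp_LR 1 r (a \<circ> \<rho>) r1 b1 q1 a1 A0 A1))"
proof -
  let ?\<chi> = "chi r1 b1 q1 a1"
  note slow = assms(5,6,13,14)[THEN SV_slow]
  have fin: "sv_norm r1 b1 {1<..} < top" "nested_sv_norm r1 b1 q1 a1 1 < top" using assms(7,8) by auto
  note chi = chi_slow[OF assms(3,4) slow(1,2) fin]
  have "slow (\<lambda>t. b0 t / ?\<chi> t)" by (intro slow_divide slow(4) chi(1))
  then obtain h M where h: "1 \<le> h"
    and g: "grid (\<lambda>k. exp (h * real_of_int k) powr (1 - \<theta>0) * (b0 (exp (h * real_of_int k)) / ?\<chi> (exp (h * real_of_int k)))) M"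
    using quasi_power_grid[of "\<lambda>t. b0 t / ?\<chi> t" "1 - \<theta>0"] assms(10) by auto
  let ?x = "\<lambda>k. exp (h * real_of_int k)"
  let ?X = "chi_seq r1 (\<lambda>m. ennreal (b1 (?x m))) q1 (\<lambda>m. ennreal (a1 (?x m)))"
  interpret reiteration A0 A1 q1 r1 r0 a1 b1 b0 ?\<chi> \<theta>0 h M
  proof
    show "grid (\<lambda>k. rho \<theta>0 b0 ?\<chi> (?x k)) M" using g by (simp only: rho_def)
    obtain D where D: "D < top" "\<And>k t. ?x k \<le> t \<Longrightarrow> t < ?x (k + 1) \<Longrightarrow> chi_ennreal r1 b1 q1 a1 t \<asymp>[D] ?X k"
      using chi_sampled[OF grid_exp[OF h] assms(3,4) slow(1,2)] by blast
    have "?x k < ?x (k + 1)" for k using h by simp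
    then show "\<exists>D<top. \<forall>k. ennreal (?\<chi> (?x k)) \<asymp>[D] ?X k"
      using D by (intro exI[of _ D]) (simp add: chi(2))
  qed (use assms slow chi(1) h in auto)
  show ?thesis
    unfolding Let_def
    using reiteration_interior[OF assms(11) slow(3)] reiteration_0[OF assms(11) slow(3)] reiteration_1[OF assms(11) slow(3)]
    unfolding X0_def X1_def \<rho>_def by blast
qed


end
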